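(* Let $\omega\in S_n$ be vexillary and let $f(x_1,\dots,x_n)$ be any monomial with nonzero coefficient in $\mathfrak{G}_\omega(x_1,\dots,x_n)$. (i) There exists a monomial $f_1$ with nonzero coefficient in $\mathfrak{G}_\omega$ such that $f_1$ has the minimal degree among monomials of $\mathfrak{G}_\omega$ and $f_1\mid f$. (ii) There exists a monomial $f_2$ with nonzero coefficient in $\mathfrak{G}_\omega$ such that $f_2$ has the maximal degree among monomials of $\mathfrak{G}_\omega$ and $f\mid f_2$.
   Context: Permutations are in one-line notation; $\omega$ is vexillary if it is $2143$-avoiding. The Grothendieck polynomial $\mathfrak{G}_\omega\in\mathbb{Z}[x_1,\dots,x_n]$ is defined by $\mathfrak{G}_{\omega_0}=x_1^{n-1}x_2^{n-2}\cdots x_{n-1}$ for $\omega_0=n\,(n-1)\cdots1$ and $\mathfrak{G}_{\omega s_i}=\pi_i\mathfrak{G}_\omega$ whenever $\omega s_i$ has one fewer inversion than $\omega$, where $s_i=(i,i+1)$, $\pi_i(f)=\partial_i(f-x_{i+1}f)$ and $\partial_i(f)=(f-s_if)/(x_i-x_{i+1})$ ($s_i$ swapping $x_i,x_{i+1}$). *)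

theory Defs
  imports "HOL-Library.Poly_Mapping" "HOL-Combinatorics.Permutations"
begin

section \<open>Integer polynomials in the variables \<open>x\<^sub>1, x\<^sub>2, \<dots>\<close>\<close>

text \<open>
  A monomial is its exponent vector and a polynomial is a finitely supported map from
  monomials to coefficients, so \<^term>\<open>Poly_Mapping.keys p\<close> is the set of
  monomials that have a nonzero coefficient in \<open>p\<close>.
\<close>

type_synonym monom = "nat \<Rightarrow>\<^sub>0 nat"
type_synonym int_mpoly = "monom \<Rightarrow>\<^sub>0 int"

definition monom_poly :: "monom \<Rightarrow> int_mpoly"
  where "monom_poly m = Poly_Mapping.single m 1"

definition monom_deg :: "monom \<Rightarrow> nat"
  where "monom_deg m = (\<Sum>i\<in>Poly_Mapping.keys m. Poly_Mapping.lookup m i)"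

definition xvar :: "nat \<Rightarrow> int_mpoly"
  where "xvar i = monom_poly (Poly_Mapping.single i 1)"

text \<open>The inner \<open>map_key\<close> exchanges the exponents of \<open>x\<^sub>i\<close> and \<open>x\<^sub>i\<^sub>+\<^sub>1\<close>.\<close>

definition swap_vars :: "nat \<Rightarrow> int_mpoly \<Rightarrow> int_mpoly"
  where "swap_vars i p =
    Poly_Mapping.map_key (Poly_Mapping.map_key (transpose i (Suc i))) p"

text \<open>
  The quotient by \<open>x\<^sub>i - x\<^sub>i\<^sub>+\<^sub>1\<close>; it exists and is unique by
  \<open>div_diff_eq\<close> and \<open>div_diff_unique\<close> below.
\<close>

definition div_diff :: "nat \<Rightarrow> int_mpoly \<Rightarrow> int_mpoly"
  where "div_diff i p = (THE q. (xvar i - xvar (Suc i)) * q = p - swap_vars i p)"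

definition isobaric_div_diff :: "nat \<Rightarrow> int_mpoly \<Rightarrow> int_mpoly"
  where "isobaric_div_diff i p = div_diff i (p - xvar (Suc i) * p)"


section \<open>Permutations of \<open>{1..n}\<close>\<close>

definition inversions :: "nat \<Rightarrow> (nat \<Rightarrow> nat) \<Rightarrow> (nat \<times> nat) set"
  where "inversions n w = {(i, j). 1 \<le> i \<and> i < j \<and> j \<le> n \<and> w j < w i}"

definition longest_perm :: "nat \<Rightarrow> nat \<Rightarrow> nat"
  where "longest_perm n i = (if i \<in> {1..n} then n + 1 - i else i)"

text \<open>Avoidance of the pattern 2143.\<close>

definition vexillary :: "nat \<Rightarrow> (nat \<Rightarrow> nat) \<Rightarrow> bool"
  where "vexillary n w \<longleftrightarrow>
    \<not> (\<exists>a b c d. 1 \<le> a \<and> a < b \<and> b < c \<and> c < d \<and> d \<le> n \<and>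
         w b < w a \<and> w a < w d \<and> w d < w c)"


section \<open>Grothendieck polynomials\<close>

text \<open>
  \<open>is_grothendieck n w G\<close>: the polynomial \<open>G\<close> is obtained for \<open>w\<close> by descending from
  the longest permutation. Existence and uniqueness of \<open>G\<close> are proved in
  \<open>is_grothendieck_ex1\<close>; the defining equations are \<open>grothendieck_longest\<close> and
  \<open>grothendieck_step\<close>.
\<close>

inductive is_grothendieck :: "nat \<Rightarrow> (nat \<Rightarrow> nat) \<Rightarrow> int_mpoly \<Rightarrow> bool" for n where
  longest: "is_grothendieck n (longest_perm n) (\<Prod>i\<in>{1..<n}. xvar i ^ (n - i))"
| step: "is_grothendieck n (w \<circ> transpose i (Suc i)) (isobaric_div_diff i G)"
    if "is_grothendieck n w G" "1 \<le> i" "i < n"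
       "card (inversions n w) = Suc (card (inversions n (w \<circ> transpose i (Suc i))))"

definition grothendieck :: "nat \<Rightarrow> (nat \<Rightarrow> nat) \<Rightarrow> int_mpoly"
  where "grothendieck n w = (THE G. is_grothendieck n w G)"


section \<open>Well-definedness\<close>

subsection \<open>The operators\<close>

lemma inj_map_key_transpose:
  "inj (Poly_Mapping.map_key (transpose i j) :: monom \<Rightarrow> monom)"
proof (rule injI)
  fix p q :: monom
  assume "Poly_Mapping.map_key (transpose i j) p = Poly_Mapping.map_key (transpose i j) q"
  then have "Poly_Mapping.map_key (transpose i j) (Poly_Mapping.map_key (transpose i j) p)
    = Poly_Mapping.map_key (transpose i j) (Poly_Mapping.map_key (transpose i j) q)"
    by simp
  then show "p = q"
    by (simp add: map_key_compose inj_transpose id_def map_key_id)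
qed

lemma lookup_map_key_transpose:
  "Poly_Mapping.lookup (Poly_Mapping.map_key (transpose i j) m) k
    = Poly_Mapping.lookup m (transpose i j k)"
  by (simp add: map_key.rep_eq inj_transpose)

lemma map_key_transpose_invol:
  "Poly_Mapping.map_key (transpose i j) (Poly_Mapping.map_key (transpose i j) (m :: monom)) = m"
  by (rule poly_mapping_eqI) (simp add: lookup_map_key_transpose)

lemma lookup_swap_vars:
  "Poly_Mapping.lookup (swap_vars i p) m
    = Poly_Mapping.lookup p (Poly_Mapping.map_key (transpose i (Suc i)) m)"
  by (simp add: swap_vars_def map_key.rep_eq inj_map_key_transpose)

lemma swap_vars_add: "swap_vars i (p + q) = swap_vars i p + swap_vars i q"
  by (rule poly_mapping_eqI) (simp add: lookup_swap_vars lookup_add)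

lemma swap_vars_diff: "swap_vars i (p - q) = swap_vars i p - swap_vars i q"
  by (rule poly_mapping_eqI) (simp add: lookup_swap_vars lookup_minus)

lemma swap_vars_0 [simp]: "swap_vars i 0 = 0"
  by (rule poly_mapping_eqI) (simp add: lookup_swap_vars)

lemma swap_vars_single:
  "swap_vars i (Poly_Mapping.single m c)
    = Poly_Mapping.single (Poly_Mapping.map_key (transpose i (Suc i)) m) c"
  using map_key_single [OF inj_map_key_transpose,
      of i "Suc i" "Poly_Mapping.map_key (transpose i (Suc i)) m" c]
  by (simp add: swap_vars_def map_key_transpose_invol)

lemma swap_vars_1 [simp]: "swap_vars i 1 = 1"
  using swap_vars_single [of i 0 1] by (simp add: map_key_zero inj_transpose)

lemma swap_vars_mult: "swap_vars i (p * q) = swap_vars i p * swap_vars i q"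
proof (induction p rule: frag_induction [OF subset_UNIV])
  case (2 m)
  show ?case
  proof (induction q rule: frag_induction [OF subset_UNIV])
    case (2 m')
    show ?case
      by (simp add: mult_single swap_vars_single map_key_plus inj_transpose)
  next
    case (3 a b)
    then show ?case by (simp add: swap_vars_diff right_diff_distrib)
  qed simp
next
  case (3 a b)
  then show ?case by (simp add: swap_vars_diff left_diff_distrib)
qed simp

lemma swap_vars_X: "swap_vars i (xvar j) = xvar (transpose i (Suc i) j)"
proof -
  have "Poly_Mapping.map_key (transpose i (Suc i)) (Poly_Mapping.single j (1::nat))
    = Poly_Mapping.single (transpose i (Suc i) j) 1"
    using map_key_single [OF inj_transpose, of i "Suc i" "transpose i (Suc i) j" "1::nat"]
    by simp
  then show ?thesis by (simp add: xvar_def monom_poly_def swap_vars_single)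
qed

lemma swap_vars_invol [simp]: "swap_vars i (swap_vars i p) = p"
  by (rule poly_mapping_eqI) (simp add: lookup_swap_vars map_key_transpose_invol)

lemma swap_vars_commute:
  assumes "Suc i < j"
  shows "swap_vars i (swap_vars j p) = swap_vars j (swap_vars i p)"
proof (rule poly_mapping_eqI)
  fix m :: monom
  have "Poly_Mapping.map_key (transpose j (Suc j)) (Poly_Mapping.map_key (transpose i (Suc i)) m)
    = Poly_Mapping.map_key (transpose i (Suc i)) (Poly_Mapping.map_key (transpose j (Suc j)) m)"
    using assms by (intro poly_mapping_eqI) (simp add: lookup_map_key_transpose transpose_def)
  then show "Poly_Mapping.lookup (swap_vars i (swap_vars j p)) m
      = Poly_Mapping.lookup (swap_vars j (swap_vars i p)) m"
    by (simp add: lookup_swap_vars)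
qed

lemma swap_vars_braid:
  "swap_vars i (swap_vars (Suc i) (swap_vars i p))
    = swap_vars (Suc i) (swap_vars i (swap_vars (Suc i) p))"
proof (rule poly_mapping_eqI)
  fix m :: monom
  let ?s = "Poly_Mapping.map_key (transpose i (Suc i)) :: monom \<Rightarrow> monom"
  let ?t = "Poly_Mapping.map_key (transpose (Suc i) (Suc (Suc i))) :: monom \<Rightarrow> monom"
  have "?s (?t (?s m)) = ?t (?s (?t m))"
    by (intro poly_mapping_eqI) (simp add: lookup_map_key_transpose transpose_def)
  then show "Poly_Mapping.lookup (swap_vars i (swap_vars (Suc i) (swap_vars i p))) m
      = Poly_Mapping.lookup (swap_vars (Suc i) (swap_vars i (swap_vars (Suc i) p))) m"
    by (simp add: lookup_swap_vars)
qed

lemma X_eq_iff [simp]: "xvar i = xvar j \<longleftrightarrow> i = j"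
proof
  assume "xvar i = xvar j"
  then have "Poly_Mapping.keys (xvar i) = Poly_Mapping.keys (xvar j)" by simp
  then have "Poly_Mapping.single i (1::nat) = Poly_Mapping.single j 1"
    by (simp add: xvar_def monom_poly_def)
  then have "Poly_Mapping.keys (Poly_Mapping.single i (1::nat))
      = Poly_Mapping.keys (Poly_Mapping.single j (1::nat))" by simp
  then show "i = j" by simp
qed simp

lemma single_dvd_swap:
  "xvar i - xvar (Suc i) dvd Poly_Mapping.single m (1::int) - swap_vars i (Poly_Mapping.single m 1)"
proof (induction m rule: update_induct)
  case const
  then show ?case by simp
next
  case (update m a b)
  have dvd_mult: "xvar i - xvar (Suc i) dvd p * q - swap_vars i (p * q)"
    if "xvar i - xvar (Suc i) dvd p - swap_vars i p" "xvar i - xvar (Suc i) dvd q - swap_vars i q" for p q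
  proof -
    have "p * q - swap_vars i (p * q)
        = (p - swap_vars i p) * q + swap_vars i p * (q - swap_vars i q)"
      by (simp add: swap_vars_mult algebra_simps)
    with that show ?thesis by (metis dvd_add dvd_mult dvd_mult2)
  qed
  have "xvar i - xvar (Suc i) dvd xvar a - swap_vars i (xvar a)"
    using dvd_minus_iff [of "xvar i - xvar (Suc i)" "xvar i - xvar (Suc i)"]
    by (auto simp: swap_vars_X transpose_def)
  then have pow: "xvar i - xvar (Suc i) dvd xvar a ^ k - swap_vars i (xvar a ^ k)" for k
    by (induction k) (auto intro: dvd_mult)
  have Xpow: "xvar a ^ k = Poly_Mapping.single (Poly_Mapping.single a k) 1" for k
    by (induction k)
      (simp_all add: xvar_def monom_poly_def mult_single single_add [symmetric])
  have "Poly_Mapping.update a b m = Poly_Mapping.single a b + m"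
    using update by (intro poly_mapping_eqI)
      (auto simp: lookup_update lookup_add lookup_single in_keys_iff)
  then have "Poly_Mapping.single (Poly_Mapping.update a b m) (1::int)
      = xvar a ^ b * Poly_Mapping.single m 1"
    by (simp add: Xpow mult_single)
  then show ?case using dvd_mult [OF pow [of b] update.IH] by simp
qed

lemma dvd_swap: "xvar i - xvar (Suc i) dvd p - swap_vars i p"
proof (induction p rule: frag_induction [OF subset_UNIV])
  case (2 m)
  then show ?case using single_dvd_swap [of i m] by simp
next
  case (3 a b)
  then have "xvar i - xvar (Suc i) dvd (a - swap_vars i a) - (b - swap_vars i b)"
    by (rule dvd_diff)
  then show ?case by (simp add: swap_vars_diff algebra_simps)
qed simp

lemma div_diff_unique:
  assumes "(xvar i - xvar (Suc i)) * q = p - swap_vars i p"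
  shows "div_diff i p = q"
  unfolding div_diff_def
proof (rule the_equality)
  fix r
  assume "(xvar i - xvar (Suc i)) * r = p - swap_vars i p"
  with assms have "(xvar i - xvar (Suc i)) * r = (xvar i - xvar (Suc i)) * q" by simp
  then show "r = q" by simp
qed (fact assms)

lemma div_diff_eq: "(xvar i - xvar (Suc i)) * div_diff i p = p - swap_vars i p"
proof -
  obtain q where "p - swap_vars i p = (xvar i - xvar (Suc i)) * q"
    using dvd_swap [of i p] by (auto elim: dvdE)
  then show ?thesis using div_diff_unique by metis
qed

lemma isobaric_eq:
  "(xvar i - xvar (Suc i)) * isobaric_div_diff i p
    = (1 - xvar (Suc i)) * p - (1 - xvar i) * swap_vars i p"
  unfolding isobaric_div_diff_def div_diff_eq
  by (simp add: swap_vars_diff swap_vars_mult swap_vars_X algebra_simps)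

lemma swap_isobaric:
  assumes "Suc i < j \<or> Suc j < i"
  shows "(xvar j - xvar (Suc j)) * swap_vars i (isobaric_div_diff j p)
    = (1 - xvar (Suc j)) * swap_vars i p - (1 - xvar j) * swap_vars i (swap_vars j p)"
  using arg_cong [OF isobaric_eq [of j p], of "swap_vars i"] assms
  by (auto simp: swap_vars_diff swap_vars_mult swap_vars_X)

lemma isobaric_commute:
  assumes "Suc i < j"
  shows "isobaric_div_diff i (isobaric_div_diff j p) = isobaric_div_diff j (isobaric_div_diff i p)"
proof -
  let ?a = "xvar i" and ?b = "xvar (Suc i)" and ?c = "xvar j" and ?d = "xvar (Suc j)"
  note swap_ij = swap_isobaric [OF disjI1 [OF assms]] and swap_ji = swap_isobaric [OF disjI2 [OF assms]]
  have "(?a - ?b) * (?c - ?d) * isobaric_div_diff i (isobaric_div_diff j p)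
      = (?c - ?d) * ((1 - ?b) * isobaric_div_diff j p
          - (1 - ?a) * swap_vars i (isobaric_div_diff j p))"
    unfolding isobaric_eq [symmetric] by (simp only: ac_simps)
  also have "\<dots> = (1 - ?b) * ((?c - ?d) * isobaric_div_diff j p)
          - (1 - ?a) * ((?c - ?d) * swap_vars i (isobaric_div_diff j p))"
    by (simp add: algebra_simps)
  also have "\<dots> = (1 - ?b) * ((1 - ?d) * p - (1 - ?c) * swap_vars j p)
      - (1 - ?a) * ((1 - ?d) * swap_vars i p - (1 - ?c) * swap_vars i (swap_vars j p))"
    by (simp only: isobaric_eq swap_ij)
  also have "\<dots> = (1 - ?d) * ((1 - ?b) * p - (1 - ?a) * swap_vars i p)
      - (1 - ?c) * ((1 - ?b) * swap_vars j p - (1 - ?a) * swap_vars j (swap_vars i p))"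
    by (simp add: swap_vars_commute [OF assms] algebra_simps)
  also have "\<dots> = (1 - ?d) * ((?a - ?b) * isobaric_div_diff i p)
          - (1 - ?c) * ((?a - ?b) * swap_vars j (isobaric_div_diff i p))"
    by (simp only: isobaric_eq swap_ji)
  also have "\<dots> = (?a - ?b) * ((1 - ?d) * isobaric_div_diff i p
          - (1 - ?c) * swap_vars j (isobaric_div_diff i p))"
    by (simp add: algebra_simps)
  also have "\<dots> = (?a - ?b) * (?c - ?d) * isobaric_div_diff j (isobaric_div_diff i p)"
    unfolding isobaric_eq [symmetric] by (simp only: ac_simps)
  finally show ?thesis using assms by simp
qed

text \<open>
  Both sides of the braid relation equal, up to the Vandermonde factor, the alternating sum
  below. In the next lemma \<open>f12\<close> stands for \<open>s\<^sub>1 s\<^sub>2 f\<close>, \<open>sg\<close> for \<open>s\<^sub>2 g\<close>,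
  \<open>tsg\<close> for \<open>s\<^sub>1 s\<^sub>2 g\<close> and \<open>th\<close> for \<open>s\<^sub>1 h\<close>.
\<close>

lemma braid_aux:
  fixes a b c :: "'a :: idom"
  assumes "a \<noteq> b"
    and g: "(a - b) * g = (1 - b) * f - (1 - a) * f1"
    and sg: "(a - c) * sg = (1 - c) * f2 - (1 - a) * f21"
    and tsg: "(b - c) * tsg = (1 - c) * f12 - (1 - b) * f121"
    and h: "(b - c) * h = (1 - c) * g - (1 - b) * sg"
    and th: "(a - c) * th = (1 - c) * g - (1 - a) * tsg"
    and k: "(a - b) * k = (1 - b) * h - (1 - a) * th"
  shows "(a - b) * (b - c) * (a - c) * k =
    (1 - b) * (1 - c)^2 * f - (1 - a) * (1 - c)^2 * f1 - (1 - c) * (1 - b)^2 * f2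
    + (1 - c) * (1 - a)^2 * f12 + (1 - a) * (1 - b)^2 * f21 - (1 - b) * (1 - a)^2 * f121"
proof -
  have "(a - b) * (b - c) * (a - c) * k
      = (1 - b) * (a - c) * ((b - c) * h) - (1 - a) * (b - c) * ((a - c) * th)"
    using k by algebra
  also have "\<dots> = (1 - c) * ((1 - b) * (a - c) - (1 - a) * (b - c)) * g
      - (1 - b)^2 * ((a - c) * sg) + (1 - a)^2 * ((b - c) * tsg)"
    unfolding h th by algebra
  also have "(1 - b) * (a - c) - (1 - a) * (b - c) = (1 - c) * (a - b)" by algebra
  also have "(1 - c) * ((1 - c) * (a - b)) * g = (1 - c)^2 * ((a - b) * g)" by algebra
  finally show ?thesis unfolding g sg tsg by algebra
qed

lemma swap_isobaric_self: "swap_vars i (isobaric_div_diff i p) = isobaric_div_diff i p"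
proof -
  have "(xvar (Suc i) - xvar i) * swap_vars i (isobaric_div_diff i p)
      = (1 - xvar i) * swap_vars i p - (1 - xvar (Suc i)) * p"
    using arg_cong [OF isobaric_eq [of i p], of "swap_vars i"]
    by (simp add: swap_vars_diff swap_vars_mult swap_vars_X)
  also have "\<dots> = (xvar (Suc i) - xvar i) * isobaric_div_diff i p"
    using isobaric_eq [of i p] by algebra
  finally have "(xvar (Suc i) - xvar i) * swap_vars i (isobaric_div_diff i p)
      = (xvar (Suc i) - xvar i) * isobaric_div_diff i p" .
  then show ?thesis by simp
qed

lemma isobaric_braid:
  "isobaric_div_diff i (isobaric_div_diff (Suc i) (isobaric_div_diff i p))
    = isobaric_div_diff (Suc i) (isobaric_div_diff i (isobaric_div_diff (Suc i) p))"
proof -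
  let ?a = "xvar i" and ?b = "xvar (Suc i)" and ?c = "xvar (Suc (Suc i))"
  let ?s = "swap_vars i" and ?t = "swap_vars (Suc i)"
  let ?p = "isobaric_div_diff i" and ?q = "isobaric_div_diff (Suc i)"
  note sw = swap_vars_diff swap_vars_mult swap_vars_X
  have p: "(?a - ?b) * ?p r = (1 - ?b) * r - (1 - ?a) * ?s r" for r by (rule isobaric_eq)
  have q: "(?b - ?c) * ?q r = (1 - ?c) * r - (1 - ?b) * ?t r" for r by (rule isobaric_eq)
  have tp: "(?a - ?c) * ?t (?p r) = (1 - ?c) * ?t r - (1 - ?a) * ?t (?s r)" for r
    using arg_cong [OF p [of r], of ?t] by (simp add: sw)
  have stp: "(?b - ?c) * ?s (?t (?p r)) = (1 - ?c) * ?s (?t r) - (1 - ?b) * ?s (?t (?s r))" for r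
    using arg_cong [OF tp [of r], of ?s] by (simp add: sw)
  have sq: "(?a - ?c) * ?s (?q r) = (1 - ?c) * ?s r - (1 - ?a) * ?s (?t r)" for r
    using arg_cong [OF q [of r], of ?s] by (simp add: sw)
  have tsq: "(?a - ?b) * ?t (?s (?q r)) = (1 - ?b) * ?t (?s r) - (1 - ?a) * ?t (?s (?t r))" for r
    using arg_cong [OF sq [of r], of ?t] by (simp add: sw)
  have sqp: "(?a - ?c) * ?s (?q (?p p)) = (1 - ?c) * ?p p - (1 - ?a) * ?s (?t (?p p))"
    using sq [of "?p p"] by (simp add: swap_isobaric_self)
  have tpq: "(?a - ?c) * ?t (?p (?q p)) = (1 - ?a) * (- ?t (?s (?q p))) + (1 - ?c) * ?q p"
    using tp [of "?q p"] by (simp add: swap_isobaric_self)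
  let ?E = "(1 - ?b) * (1 - ?c)^2 * p - (1 - ?a) * (1 - ?c)^2 * ?s p - (1 - ?c) * (1 - ?b)^2 * ?t p
    + (1 - ?c) * (1 - ?a)^2 * ?s (?t p) + (1 - ?a) * (1 - ?b)^2 * ?t (?s p)
    - (1 - ?b) * (1 - ?a)^2 * ?s (?t (?s p))"
  have E1: "(?a - ?b) * (?b - ?c) * (?a - ?c) * ?p (?q (?p p)) = ?E"
    by (rule braid_aux [OF _ p tp stp q sqp p]) simp
  have tst: "?t (?s (?t p)) = ?s (?t (?s p))" by (simp add: swap_vars_braid)
  have "(?a - ?b) * (?b - ?c) * (?a - ?c) * ?q (?p (?q p))
      = (?a - ?b) * (?a - ?c) * ((?b - ?c) * ?q (?p (?q p)))" by (simp only: ac_simps)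
  also have "\<dots> = (1 - ?c) * (?a - ?c) * ((?a - ?b) * ?p (?q p))
      - (1 - ?b) * (?a - ?b) * ((?a - ?c) * ?t (?p (?q p)))"
    unfolding q [of "?p (?q p)"] by algebra
  also have "\<dots> = (1 - ?a) * ((1 - ?b) * (?a - ?b)) * ?t (?s (?q p))
      + ((1 - ?c) * (1 - ?b) * (?a - ?c) - (1 - ?b) * (?a - ?b) * (1 - ?c)) * ?q p
      - (1 - ?c) * (1 - ?a) * ((?a - ?c) * ?s (?q p))"
    unfolding p [of "?q p"] tpq by algebra
  also have "\<dots> = (1 - ?a) * (1 - ?b) * ((?a - ?b) * ?t (?s (?q p)))
      + (1 - ?c) * (1 - ?b) * ((?b - ?c) * ?q p)
      - (1 - ?c) * (1 - ?a) * ((?a - ?c) * ?s (?q p))"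
    by algebra
  also have "\<dots> = ?E"
    unfolding tsq sq q [of p] tst by algebra
  finally have "(?a - ?b) * (?b - ?c) * (?a - ?c) * ?p (?q (?p p))
      = (?a - ?b) * (?b - ?c) * (?a - ?c) * ?q (?p (?q p))" using E1 by simp
  then show ?thesis by simp
qed


subsection \<open>Permutations\<close>

lemma finite_inversions [simp]: "finite (inversions n w)"
  by (rule finite_subset [of _ "{1..n} \<times> {1..n}"]) (auto simp: inversions_def)

lemma card_inversions_le: "card (inversions n w) \<le> n * n"
proof -
  have "inversions n w \<subseteq> {1..n} \<times> {1..n}" by (auto simp: inversions_def)
  then have "card (inversions n w) \<le> card ({1..n} \<times> {1..n})" by (intro card_mono) auto
  then show ?thesis by simp
qed

lemma card_inversions_ascent:
  assumes "1 \<le> i" "i < n" "w i < w (Suc i)"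
  shows "card (inversions n (w \<circ> transpose i (Suc i))) = Suc (card (inversions n w))"
proof -
  let ?s = "transpose i (Suc i)"
  let ?f = "map_prod ?s ?s"
  have s: "?s k = (if k = i then Suc i else if k = Suc i then i else k)" for k
    by (simp add: transpose_def)
  have "inversions n (w \<circ> ?s) = insert (i, Suc i) (?f ` inversions n w)"
  proof (intro equalityI subsetI)
    fix x assume x: "x \<in> inversions n (w \<circ> ?s)"
    show "x \<in> insert (i, Suc i) (?f ` inversions n w)"
    proof (cases "x = (i, Suc i)")
      case False
      with x assms have "?f x \<in> inversions n w"
        by (auto simp: inversions_def s split: if_splits)
      moreover have "x = ?f (?f x)" by (cases x) simp
      ultimately show ?thesis by blast
    qed simp
  next
    fix x assume "x \<in> insert (i, Suc i) (?f ` inversions n w)"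
    then show "x \<in> inversions n (w \<circ> ?s)"
      using assms by (auto simp: inversions_def s split: if_splits)
  qed
  moreover have "(i, Suc i) \<notin> ?f ` inversions n w"
    using assms by (auto simp: inversions_def s split: if_splits)
  moreover have "inj_on ?f (inversions n w)"
    by (intro inj_onI) (auto dest!: transpose_eq_imp_eq)
  ultimately show ?thesis by (simp add: card_image)
qed

lemma comp_transpose_invol: "w \<circ> transpose i j \<circ> transpose i j = w"
  by (simp add: comp_assoc)

lemma step_imp_ascent:
  assumes "inj w" "1 \<le> i" "i < n"
    "card (inversions n w) = Suc (card (inversions n (w \<circ> transpose i (Suc i))))"
  shows "w (Suc i) < w i"
proof (rule ccontr)
  assume "\<not> w (Suc i) < w i"
  moreover have "w i \<noteq> w (Suc i)" using assms(1) by (simp add: inj_eq)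
  ultimately have "w i < w (Suc i)" by simp
  from card_inversions_ascent [OF assms(2,3) this] assms(4) show False by simp
qed

lemma permutes_comp_transpose:
  assumes "w permutes {1..n}" "1 \<le> i" "i < n"
  shows "(w \<circ> transpose i (Suc i)) permutes {1..n}"
  using assms by (intro permutes_compose permutes_swap_id) auto

lemma longest_perm_permutes: "longest_perm n permutes {1..n}"
proof (rule bij_imp_permutes)
  show "bij_betw (longest_perm n) {1..n} {1..n}"
    by (rule bij_betw_byWitness [where f' = "longest_perm n"]) (auto simp: longest_perm_def)
qed (auto simp: longest_perm_def)

lemma no_ascent_imp_longest:
  assumes w: "w permutes {1..n}" and desc: "\<And>i. 1 \<le> i \<Longrightarrow> i < n \<Longrightarrow> w (Suc i) < w i"
  shows "w = longest_perm n"
proof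
  fix k
  show "w k = longest_perm n k"
  proof (cases "k \<in> {1..n}")
    case True
    have rng: "w j \<in> {1..n}" if "j \<in> {1..n}" for j using permutes_in_image [OF w] that by blast
    have up: "w (Suc j) + j \<le> n" if "j < n" for j
      using that
    proof (induction j)
      case 0 then show ?case using rng [of 1] by auto
    next
      case (Suc j) then show ?case using desc [of "Suc j"] by auto
    qed
    have lo: "w (n - j) \<ge> Suc j" if "j < n" for j
      using that
    proof (induction j)
      case 0 then show ?case using rng [of n] by auto
    next
      case (Suc j)
      then have "w (Suc (n - Suc j)) < w (n - Suc j)" by (intro desc) auto
      moreover have "Suc (n - Suc j) = n - j" using Suc.prems by simp
      ultimately show ?case using Suc by simp
    qed
    have "w k + (k - 1) \<le> n" using True up [of "k - 1"] by auto
    moreover have "Suc (n - k) \<le> w k" using True lo [of "n - k"] by auto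
    ultimately have "w k = n + 1 - k" using True unfolding atLeastAtMost_iff by linarith
    with True show ?thesis by (simp add: longest_perm_def)
  next
    case False
    then show ?thesis using w by (auto simp: permutes_not_in longest_perm_def)
  qed
qed


subsection \<open>Existence and uniqueness\<close>

lemma is_grothendieck_permutes: "is_grothendieck n w G \<Longrightarrow> w permutes {1..n}"
  by (induction rule: is_grothendieck.induct)
    (rule longest_perm_permutes, rule permutes_comp_transpose)

lemma is_grothendieck_ascent:
  assumes G: "is_grothendieck n (w \<circ> transpose i (Suc i)) G" and i: "1 \<le> i" "i < n"
    and "w i < w (Suc i)"
  shows "is_grothendieck n w (isobaric_div_diff i G)"
  using step [OF G i] card_inversions_ascent [of i n w] assms by (simp add: comp_transpose_invol)

lemma is_grothendieck_cases:
  assumes "is_grothendieck n w G"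
  obtains "w = longest_perm n" "G = (\<Prod>i\<in>{1..<n}. xvar i ^ (n - i))"
  | i H where "1 \<le> i" "i < n" "w i < w (Suc i)" "G = isobaric_div_diff i H"
      "is_grothendieck n (w \<circ> transpose i (Suc i)) H"
  using assms
proof (cases rule: is_grothendieck.cases)
  case (step v H i)
  then have "inj v" using is_grothendieck_permutes permutes_inj by blast
  with step have "v (Suc i) < v i" using step_imp_ascent by blast
  with step show ?thesis
    by (intro that(2) [of i H]) (auto simp: comp_transpose_invol)
qed (use that in auto)

lemma is_grothendieck_exists:
  "w permutes {1..n} \<Longrightarrow> \<exists>G. is_grothendieck n w G"
proof (induction "n * n - card (inversions n w)" arbitrary: w rule: less_induct)
  case less
  show ?case
  proof (cases "\<exists>i. 1 \<le> i \<and> i < n \<and> w i < w (Suc i)")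
    case True
    then obtain i where i: "1 \<le> i" "i < n" "w i < w (Suc i)" by blast
    let ?v = "w \<circ> transpose i (Suc i)"
    have "n * n - card (inversions n ?v) < n * n - card (inversions n w)"
      using card_inversions_ascent [OF i] card_inversions_le [of n ?v] by simp
    then obtain G where "is_grothendieck n ?v G"
      using less permutes_comp_transpose i by blast
    then show ?thesis using is_grothendieck_ascent i by blast
  next
    case False
    have "w (Suc i) < w i" if "1 \<le> i" "i < n" for i
    proof -
      have "w i \<noteq> w (Suc i)" using permutes_inj [OF less.prems] by (simp add: inj_eq)
      with False that show ?thesis by (meson linorder_neqE_nat)
    qed
    then have "w = longest_perm n" using no_ascent_imp_longest less.prems by blast
    then show ?thesis using longest by blast
  qed
qed

lemma is_grothendieck_unique:
  "is_grothendieck n w G \<Longrightarrow> is_grothendieck n w H \<Longrightarrow> G = H"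
proof (induction "n * n - card (inversions n w)" arbitrary: w G H rule: less_induct)
  case less
  have w: "w permutes {1..n}" using less.prems is_grothendieck_permutes by blast
  have no_asc: "\<not> longest_perm n i < longest_perm n (Suc i)" if "1 \<le> i" "i < n" for i
    using that by (simp add: longest_perm_def)
  have IH: "A = B" if "1 \<le> i" "i < n" "w i < w (Suc i)"
    "is_grothendieck n (w \<circ> transpose i (Suc i)) A"
    "is_grothendieck n (w \<circ> transpose i (Suc i)) B" for i A B
  proof (rule less.hyps [OF _ that(4,5)])
    show "n * n - card (inversions n (w \<circ> transpose i (Suc i))) < n * n - card (inversions n w)"
      using card_inversions_ascent [OF that(1-3)]
        card_inversions_le [of n "w \<circ> transpose i (Suc i)"] by simp
  qed
  have main: "isobaric_div_diff i A = isobaric_div_diff j B"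
    if "i \<le> j" and i: "1 \<le> i" "i < n" "w i < w (Suc i)"
      and j: "1 \<le> j" "j < n" "w j < w (Suc j)"
      and A: "is_grothendieck n (w \<circ> transpose i (Suc i)) A"
      and B: "is_grothendieck n (w \<circ> transpose j (Suc j)) B" for i j A B
  proof -
    let ?s = "transpose i (Suc i)" and ?t = "transpose j (Suc j)"
    consider "j = i" | "j = Suc i" | "Suc i < j" using \<open>i \<le> j\<close> by linarith
    then show ?thesis
    proof cases
      case 1
      then show ?thesis using IH [OF i A] B by simp
    next
      case 2
      have "(w \<circ> ?s \<circ> ?t \<circ> ?s) permutes {1..n}"
        using w i j by (intro permutes_comp_transpose)
      then obtain C where C: "is_grothendieck n (w \<circ> ?s \<circ> ?t \<circ> ?s) C"
        using is_grothendieck_exists by blast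
      have "w \<circ> ?s \<circ> ?t \<circ> ?s = w \<circ> ?t \<circ> ?s \<circ> ?t"
        using 2 by (auto simp: fun_eq_iff transpose_def)
      with C have C': "is_grothendieck n (w \<circ> ?t \<circ> ?s \<circ> ?t) C" by simp
      have "is_grothendieck n (w \<circ> ?s \<circ> ?t) (isobaric_div_diff i C)"
        by (rule is_grothendieck_ascent [OF C]) (use i j 2 in auto)
      then have "is_grothendieck n (w \<circ> ?s) (isobaric_div_diff j (isobaric_div_diff i C))"
        by (rule is_grothendieck_ascent) (use i j 2 in auto)
      then have A': "A = isobaric_div_diff j (isobaric_div_diff i C)" using IH [OF i A] by blast
      have "is_grothendieck n (w \<circ> ?t \<circ> ?s) (isobaric_div_diff j C)"
        by (rule is_grothendieck_ascent [OF C']) (use i j 2 in auto)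
      then have "is_grothendieck n (w \<circ> ?t) (isobaric_div_diff i (isobaric_div_diff j C))"
        by (rule is_grothendieck_ascent) (use i j 2 in auto)
      then have "B = isobaric_div_diff i (isobaric_div_diff j C)" using IH [OF j B] by blast
      with A' 2 show ?thesis by (simp add: isobaric_braid)
    next
      case 3
      have "(w \<circ> ?s \<circ> ?t) permutes {1..n}" using w i j by (intro permutes_comp_transpose)
      then obtain C where C: "is_grothendieck n (w \<circ> ?s \<circ> ?t) C"
        using is_grothendieck_exists by blast
      have "w \<circ> ?s \<circ> ?t = w \<circ> ?t \<circ> ?s" using 3 by (auto simp: fun_eq_iff transpose_def)
      with C have C': "is_grothendieck n (w \<circ> ?t \<circ> ?s) C" by simp
      have "is_grothendieck n (w \<circ> ?s) (isobaric_div_diff j C)"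
        by (rule is_grothendieck_ascent [OF C]) (use i j 3 in auto)
      then have A': "A = isobaric_div_diff j C" using IH [OF i A] by blast
      have "is_grothendieck n (w \<circ> ?t) (isobaric_div_diff i C)"
        by (rule is_grothendieck_ascent [OF C']) (use i j 3 in auto)
      then have "B = isobaric_div_diff i C" using IH [OF j B] by blast
      with A' 3 show ?thesis by (simp add: isobaric_commute [OF 3])
    qed
  qed
  from less.prems(1) show ?case
  proof (cases rule: is_grothendieck_cases)
    case 1
    from less.prems(2) show ?thesis
      by (cases rule: is_grothendieck_cases) (use 1 no_asc in auto)
  next
    case (2 i A)
    from less.prems(2) show ?thesis
    proof (cases rule: is_grothendieck_cases)
      case 1
      with 2 no_asc show ?thesis by auto
    next
      case (2 j B)
      note H = this and G = \<open>1 \<le> i\<close> \<open>i < n\<close> \<open>w i < w (Suc i)\<close>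
        \<open>G = isobaric_div_diff i A\<close> \<open>is_grothendieck n (w \<circ> transpose i (Suc i)) A\<close>
      show ?thesis
      proof (cases "i \<le> j")
        case True
        from main [OF True G(1-3) H(1-3) G(5) H(5)] show ?thesis by (simp add: G(4) H(4))
      next
        case False
        then have "j \<le> i" by simp
        from main [OF this H(1-3) G(1-3) H(5) G(5)] show ?thesis by (simp add: G(4) H(4))
      qed
    qed
  qed
qed

lemma is_grothendieck_ex1:
  "w permutes {1..n} \<Longrightarrow> \<exists>!G. is_grothendieck n w G"
  using is_grothendieck_exists is_grothendieck_unique by blast

lemma is_grothendieck_grothendieck:
  "w permutes {1..n} \<Longrightarrow> is_grothendieck n w (grothendieck n w)"
  unfolding grothendieck_def by (rule theI' [OF is_grothendieck_ex1])

lemma grothendieck_eqI: "is_grothendieck n w G \<Longrightarrow> grothendieck n w = G"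
  unfolding grothendieck_def by (rule the_equality) (auto intro: is_grothendieck_unique)

lemma grothendieck_longest:
  "grothendieck n (longest_perm n) = (\<Prod>i\<in>{1..<n}. xvar i ^ (n - i))"
  by (rule grothendieck_eqI [OF longest])

lemma grothendieck_step:
  assumes "w permutes {1..n}" "1 \<le> i" "i < n"
    "card (inversions n w) = Suc (card (inversions n (w \<circ> transpose i (Suc i))))"
  shows "grothendieck n (w \<circ> transpose i (Suc i)) = isobaric_div_diff i (grothendieck n w)"
  using assms by (intro grothendieck_eqI step is_grothendieck_grothendieck)

end

(*
  A vexillary Grothendieck polynomial is a signed generating function of flagged set-valued
  tableaux.  Its first descent m gives the first row: moving w(m) to the front produces a
  permutation u in which the values above u(1) increase, so that its polynomial is x_1^(u(1)-1)
  times the shifted polynomial of w with w(m) deleted, and pi_1, ..., pi_(m-1) raise the flag of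
  this row one letter at a time.

  A row is encoded by the numbers r(l) of its boxes whose smallest entry, minus the row index, is
  less than l.  All terms of a fixed degree have the same sign, so the support is the union,
  over the patterns of rows, of the monomials between a lower one, all of the same degree, and
  an upper one.  This gives (i).  The excess of the upper degree counts the strict drops
  I(i+1,l) < I(i,l).  Two kinds of moves on a pattern never decrease the upper monomial: lowering
  the last of several equal entries of a column l, and raising the first.  When nothing can be
  lowered, every run of active rows is strictly decreasing and then constant; if it has fewer
  drops than some other pattern, raising entries upwards from the start of the constant part
  creates a new drop.  This gives (ii).
*)
theory Submission
  imports Defs
begin

section \<open>Index shift of the variables, linearity of pi_i, and two-variable sums\<close>

section \<open>Shifting the variables and the isobaric operators\<close>

text \<open>That pi_t raises the flag of the first row is not clear, because pi_t also acts on all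
  lower rows. Exchanging x_t and x_(t+1) changes, in each row, only the number of boxes whose
  smallest letter is at most t. Letters are counted relative to the row index, so these entries lie
  on one antidiagonal of the array I(i,l), one per row. They can be summed from the bottom row
  upwards with everything else frozen.

  The obstacle is that such a partial sum is not symmetric in x_t and x_(t+1), since its topmost
  entry is still bounded by the row above. It replaces an involution on tableaux by identities in
  two variables.

  For (ii), neither kind of move increases the monomial by itself. A lowering may leave it
  unchanged, so a potential has to decrease. A raising may destroy an extra letter in the row above,
  so a whole chain of raisings is needed, and the row lengths must leave room for it.\<close>

definition shift_monom :: "monom \<Rightarrow> monom"
  where "shift_monom m = Abs_poly_mapping (\<lambda>k. case k of 0 \<Rightarrow> 0 | Suc j \<Rightarrow> Poly_Mapping.lookup m j)"

lemma lookup_shift_monom: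
  "Poly_Mapping.lookup (shift_monom m) k
    = (case k of 0 \<Rightarrow> 0 | Suc j \<Rightarrow> Poly_Mapping.lookup m j)"
proof -
  have "{k. (case k of 0 \<Rightarrow> 0 | Suc j \<Rightarrow> Poly_Mapping.lookup m j) \<noteq> 0}
      \<subseteq> Suc ` {j. Poly_Mapping.lookup m j \<noteq> 0}"
  proof
    fix k assume "k \<in> {k. (case k of 0 \<Rightarrow> 0 | Suc j \<Rightarrow> Poly_Mapping.lookup m j) \<noteq> 0}"
    then show "k \<in> Suc ` {j. Poly_Mapping.lookup m j \<noteq> 0}" by (cases k) auto
  qed
  then have "finite {k. (case k of 0 \<Rightarrow> 0 | Suc j \<Rightarrow> Poly_Mapping.lookup m j) \<noteq> 0}"
    by (rule finite_subset) simp
  then show ?thesis by (simp add: shift_monom_def Abs_poly_mapping_inverse)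
qed

lemma lookup_shift_monom_0 [simp]: "Poly_Mapping.lookup (shift_monom m) 0 = 0"
  and lookup_shift_monom_Suc [simp]:
    "Poly_Mapping.lookup (shift_monom m) (Suc k) = Poly_Mapping.lookup m k"
  by (simp_all add: lookup_shift_monom)

lemma shift_monom_0 [simp]: "shift_monom 0 = 0"
  by (rule poly_mapping_eqI) (simp add: lookup_shift_monom split: nat.split)

lemma shift_monom_add: "shift_monom (m + m') = shift_monom m + shift_monom m'"
  by (rule poly_mapping_eqI) (simp add: lookup_shift_monom lookup_add split: nat.split)

lemma shift_monom_single: "shift_monom (Poly_Mapping.single k c) = Poly_Mapping.single (Suc k) c"
  by (rule poly_mapping_eqI) (auto simp: lookup_shift_monom lookup_single split: nat.split)

lemma inj_shift_monom: "inj shift_monom"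
  by (rule injI) (metis lookup_shift_monom_Suc poly_mapping_eqI)

definition shift :: "int_mpoly \<Rightarrow> int_mpoly"
  where "shift = frag_extend (\<lambda>m. Poly_Mapping.single (shift_monom m) 1)"

lemma shift_0 [simp]: "shift 0 = 0"
  by (simp add: shift_def)

lemma shift_single [simp]: "shift (Poly_Mapping.single m 1) = Poly_Mapping.single (shift_monom m) 1"
  by (simp add: shift_def)

lemma shift_add: "shift (p + q) = shift p + shift q"
  by (simp add: shift_def frag_extend_add)

lemma shift_diff: "shift (p - q) = shift p - shift q"
  by (simp add: shift_def frag_extend_diff)

lemma shift_1 [simp]: "shift 1 = 1"
  using shift_single [of 0] by simp

lemma shift_mult: "shift (p * q) = shift p * shift q"
proof (induction p rule: frag_induction [OF subset_UNIV])
  case (2 m)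
  show ?case
  proof (induction q rule: frag_induction [OF subset_UNIV])
    case (2 m')
    show ?case by (simp add: mult_single shift_monom_add)
  next
    case (3 a b)
    then show ?case by (simp add: shift_diff right_diff_distrib)
  qed simp
next
  case (3 a b)
  then show ?case by (simp add: shift_diff left_diff_distrib)
qed simp

lemma shift_xvar [simp]: "shift (xvar i) = xvar (Suc i)"
  by (simp add: xvar_def monom_poly_def shift_monom_single)

lemma shift_power: "shift (p ^ k) = shift p ^ k"
  by (induction k) (simp_all add: shift_mult)

lemma shift_sum: "shift (sum f A) = (\<Sum>a\<in>A. shift (f a))"
  by (induction A rule: infinite_finite_induct) (simp_all add: shift_add)

lemma shift_prod: "shift (prod f A) = (\<Prod>a\<in>A. shift (f a))"
  by (induction A rule: infinite_finite_induct) (simp_all add: shift_mult)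

lemma swap_vars_power: "swap_vars i (p ^ k) = swap_vars i p ^ k"
  by (induction k) (simp_all add: swap_vars_mult)

lemma swap_vars_sum: "swap_vars i (sum f A) = (\<Sum>a\<in>A. swap_vars i (f a))"
  by (induction A rule: infinite_finite_induct) (simp_all add: swap_vars_add)

lemma swap_vars_prod: "swap_vars i (prod f A) = (\<Prod>a\<in>A. swap_vars i (f a))"
  by (induction A rule: infinite_finite_induct) (simp_all add: swap_vars_mult)

lemma swap_vars_Suc_shift: "swap_vars (Suc i) (shift p) = shift (swap_vars i p)"
proof (induction p rule: frag_induction [OF subset_UNIV])
  case (2 m)
  have "Poly_Mapping.map_key (transpose (Suc i) (Suc (Suc i))) (shift_monom m)
      = shift_monom (Poly_Mapping.map_key (transpose i (Suc i)) m)"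
    by (rule poly_mapping_eqI)
      (auto simp: lookup_map_key_transpose lookup_shift_monom transpose_def split: nat.split)
  then show ?case by (simp add: swap_vars_single)
next
  case (3 a b)
  then show ?case by (simp add: swap_vars_diff shift_diff)
qed simp

text \<open>Two shifts leave neither x_0 nor x_1. Exponent vectors are indexed from 0 while the
  letters start at 1, so x_0 is a dummy variable that serves as the boundary case.\<close>

lemma swap_vars_0_shift_shift: "swap_vars 0 (shift (shift p)) = shift (shift p)"
proof (induction p rule: frag_induction [OF subset_UNIV])
  case (2 m)
  have "Poly_Mapping.map_key (transpose 0 (Suc 0)) (shift_monom (shift_monom m))
      = shift_monom (shift_monom m)"
    by (rule poly_mapping_eqI)
      (auto simp: lookup_map_key_transpose lookup_shift_monom transpose_def split: nat.split)
  then show ?case by (simp add: swap_vars_single)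
next
  case (3 a b)
  then show ?case by (simp add: swap_vars_diff shift_diff)
qed simp

lemma isobaric_eqI:
  assumes "(xvar i - xvar (Suc i)) * q
    = (1 - xvar (Suc i)) * p - (1 - xvar i) * swap_vars i p"
  shows "isobaric_div_diff i p = q"
proof -
  have "(xvar i - xvar (Suc i)) * isobaric_div_diff i p = (xvar i - xvar (Suc i)) * q"
    using assms isobaric_eq by simp
  then show ?thesis by simp
qed

lemma isobaric_0 [simp]: "isobaric_div_diff i 0 = 0"
  by (rule isobaric_eqI) simp

lemma isobaric_add: "isobaric_div_diff i (p + q) = isobaric_div_diff i p + isobaric_div_diff i q"
proof (rule isobaric_eqI)
  show "(xvar i - xvar (Suc i)) * (isobaric_div_diff i p + isobaric_div_diff i q)
      = (1 - xvar (Suc i)) * (p + q) - (1 - xvar i) * swap_vars i (p + q)"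
    unfolding distrib_left [of "xvar i - xvar (Suc i)"] isobaric_eq swap_vars_add
    by (simp add: algebra_simps)
qed

lemma isobaric_sum: "isobaric_div_diff i (sum f A) = (\<Sum>a\<in>A. isobaric_div_diff i (f a))"
  by (induction A rule: infinite_finite_induct) (simp_all add: isobaric_add)

lemma isobaric_mult_sym:
  assumes "swap_vars i s = s"
  shows "isobaric_div_diff i (s * p) = s * isobaric_div_diff i p"
proof (rule isobaric_eqI)
  have "(xvar i - xvar (Suc i)) * (s * isobaric_div_diff i p)
      = s * ((xvar i - xvar (Suc i)) * isobaric_div_diff i p)"
    by (simp only: ac_simps)
  then show "(xvar i - xvar (Suc i)) * (s * isobaric_div_diff i p)
      = (1 - xvar (Suc i)) * (s * p) - (1 - xvar i) * swap_vars i (s * p)"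
    unfolding isobaric_eq swap_vars_mult assms by (simp add: algebra_simps)
qed

lemma isobaric_Suc_shift: "isobaric_div_diff (Suc i) (shift p) = shift (isobaric_div_diff i p)"
proof (rule isobaric_eqI)
  have "(xvar (Suc i) - xvar (Suc (Suc i))) * shift (isobaric_div_diff i p)
      = shift ((xvar i - xvar (Suc i)) * isobaric_div_diff i p)"
    by (simp add: shift_mult shift_diff)
  then show "(xvar (Suc i) - xvar (Suc (Suc i))) * shift (isobaric_div_diff i p)
      = (1 - xvar (Suc (Suc i))) * shift p - (1 - xvar (Suc i)) * swap_vars (Suc i) (shift p)"
    by (simp add: isobaric_eq shift_mult shift_diff swap_vars_Suc_shift)
qed

text \<open>The complete homogeneous symmetric polynomial h_d(x, y).\<close>

definition sym_sum :: "'a::comm_ring_1 \<Rightarrow> 'a \<Rightarrow> nat \<Rightarrow> 'a"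
  where "sym_sum x y d = (\<Sum>c\<le>d. x ^ c * y ^ (d - c))"

lemma sym_sum_commute: "sym_sum x y d = sym_sum y x d"
proof -
  have "sym_sum x y d = (\<Sum>c\<le>d. x ^ (d - c) * y ^ (d - (d - c)))"
    unfolding sym_sum_def
    by (rule sum.reindex_bij_witness [where i = "\<lambda>c. d - c" and j = "\<lambda>c. d - c"]) auto
  also have "\<dots> = sym_sum y x d"
    unfolding sym_sum_def by (rule sum.cong) (auto simp: mult.commute)
  finally show ?thesis .
qed

lemma sym_sum_diff_mult: "(x - y) * sym_sum x y d = x ^ Suc d - y ^ Suc d"
proof -
  have "sym_sum x y d = (\<Sum>c<Suc d. y ^ (Suc d - Suc c) * x ^ c)"
    unfolding sym_sum_def lessThan_Suc_atMost by (rule sum.cong) (auto simp: mult.commute)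
  then show ?thesis by (simp only: power_diff_sumr2)
qed

text \<open>The Grothendieck polynomial of a single row of d boxes in two letters; it arises as
  pi_i(x_i^(d+1)) in \<open>isobaric_power\<close>.\<close>

definition iso_sum :: "'a::comm_ring_1 \<Rightarrow> 'a \<Rightarrow> nat \<Rightarrow> 'a"
  where "iso_sum x y d = sym_sum x y d - (if d = 0 then 0 else x * y * sym_sum x y (d - 1))"

lemma iso_sum_commute: "iso_sum x y d = iso_sum y x d"
  by (simp add: iso_sum_def sym_sum_commute [of x y] mult.commute)

lemma iso_sum_diff_mult:
  "(x - y) * iso_sum x y d = (1 - y) * x ^ Suc d - (1 - x) * y ^ Suc d"
proof (cases d)
  case 0
  then show ?thesis by (simp add: iso_sum_def sym_sum_def algebra_simps)
next
  case (Suc e)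
  have "(x - y) * iso_sum x y d
      = (x - y) * sym_sum x y d - x * y * ((x - y) * sym_sum x y e)"
    by (simp add: iso_sum_def Suc algebra_simps)
  then show ?thesis unfolding sym_sum_diff_mult by (simp add: Suc algebra_simps)
qed

text \<open>The summand \<open>c\<close> is a row of \<open>c\<close> boxes x followed by boxes y,
  and 1 - y lets the last x-box also hold y. \<open>iso_sum_eq2\<close> attaches the second letter
  to the first y-box instead. Both forms are needed: the first matches an extra letter of the row
  itself, the second one of the row above.\<close>

lemma iso_sum_eq1: "iso_sum x y d = (\<Sum>c\<le>d. x ^ c * y ^ (d - c) * (if c = 0 then 1 else 1 - y))"
proof (cases d)
  case (Suc e)
  have "(\<Sum>c\<le>d. x ^ c * y ^ (d - c) * (if c = 0 then 1 else 1 - y))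
    = (\<Sum>c\<le>d. x ^ c * y ^ (d - c)) - (\<Sum>c\<le>d. if c = 0 then 0 else x ^ c * y ^ (d - c) * y)"
    unfolding sum_subtractf [symmetric] by (rule sum.cong) (auto simp: algebra_simps)
  moreover have "(\<Sum>c\<le>d. if c = 0 then 0 else x ^ c * y ^ (d - c) * y) = x * y * sym_sum x y e"
    unfolding Suc sum.atMost_Suc_shift by (simp add: sym_sum_def sum_distrib_left algebra_simps)
  ultimately show ?thesis by (simp add: iso_sum_def Suc sym_sum_def)
qed (simp add: iso_sum_def sym_sum_def)

lemma iso_sum_eq2: "iso_sum x y d = (\<Sum>c\<le>d. x ^ c * y ^ (d - c) * (if c = d then 1 else 1 - x))"
proof -
  have "iso_sum x y d = (\<Sum>c\<le>d. y ^ c * x ^ (d - c) * (if c = 0 then 1 else 1 - x))"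
    unfolding iso_sum_commute [of x y] by (rule iso_sum_eq1)
  also have "\<dots> = (\<Sum>c\<le>d. y ^ (d - c) * x ^ (d - (d - c)) * (if d - c = 0 then 1 else 1 - x))"
    by (rule sum.reindex_bij_witness [where i = "\<lambda>c. d - c" and j = "\<lambda>c. d - c"]) auto
  also have "\<dots> = (\<Sum>c\<le>d. x ^ c * y ^ (d - c) * (if c = d then 1 else 1 - x))"
    by (rule sum.cong) (auto simp: mult.commute)
  finally show ?thesis .
qed

lemma swap_xvar [simp]: "swap_vars i (xvar i) = xvar (Suc i)" "swap_vars i (xvar (Suc i)) = xvar i"
  by (simp_all add: swap_vars_X)

lemma swap_xvar_other [simp]: "j \<noteq> i \<Longrightarrow> j \<noteq> Suc i \<Longrightarrow> swap_vars i (xvar j) = xvar j"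
  by (simp add: swap_vars_X transpose_def)

lemma isobaric_power: "isobaric_div_diff i (xvar i ^ Suc d) = iso_sum (xvar i) (xvar (Suc i)) d"
  by (rule isobaric_eqI) (simp add: iso_sum_diff_mult swap_vars_mult swap_vars_power)

text \<open>The factor 1 - x_i completes the 1 - x_(i+1) inside pi_i to a symmetric product, which
  leaves the divided difference of a power. Without the power nothing is left, as in
  \<open>isobaric_one_minus\<close>.\<close>

lemma isobaric_power_diff:
  "isobaric_div_diff i (xvar i ^ Suc d * (1 - xvar i))
    = (1 - xvar i) * (1 - xvar (Suc i)) * sym_sum (xvar i) (xvar (Suc i)) d"
proof (rule isobaric_eqI)
  have "(xvar i - xvar (Suc i)) * ((1 - xvar i) * (1 - xvar (Suc i)) * sym_sum (xvar i) (xvar (Suc i)) d)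
    = (1 - xvar i) * (1 - xvar (Suc i)) * ((xvar i - xvar (Suc i)) * sym_sum (xvar i) (xvar (Suc i)) d)"
    by (simp only: ac_simps)
  then show "(xvar i - xvar (Suc i)) * ((1 - xvar i) * (1 - xvar (Suc i)) * sym_sum (xvar i) (xvar (Suc i)) d)
    = (1 - xvar (Suc i)) * (xvar i ^ Suc d * (1 - xvar i))
      - (1 - xvar i) * swap_vars i (xvar i ^ Suc d * (1 - xvar i))"
    unfolding sym_sum_diff_mult
    by (simp add: swap_vars_mult swap_vars_power swap_vars_diff algebra_simps)
qed

lemma isobaric_one_minus: "isobaric_div_diff i (1 - xvar i) = 0"
  by (rule isobaric_eqI) (simp add: swap_vars_diff algebra_simps)

section \<open>Summation over one entry with frozen neighbours\<close>

section \<open>Sums over one entry of a row\<close>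

text \<open>\<open>c\<close> and \<open>d\<close> count the boxes of a row and of the next row whose
  level is below that of z. The only box that can take z as an extra letter is the last of the
  \<open>c\<close> boxes. If \<open>d < c\<close>, the box below it is absent or has at least the
  level of z, hence a larger letter.\<close>

definition cap :: "'a::comm_ring_1 \<Rightarrow> nat \<Rightarrow> nat \<Rightarrow> 'a"
  where "cap z c d = (if c < d then 0 else if d < c then 1 - z else 1)"

text \<open>What depends on one entry \<open>c\<close> of a row between its frozen neighbours
  \<open>r\<close> and \<open>s\<close>: \<open>c - r\<close> boxes hold x and \<open>s - c\<close>
  hold y, and \<open>q\<close> is the entry of the next row at the level of y. In
  \<open>cap_mid_sum\<close> the entry \<open>p\<close> of the row above is taken into account as
  well.\<close>

definition mid_sum :: "'a::comm_ring_1 \<Rightarrow> 'a \<Rightarrow> nat \<Rightarrow> nat \<Rightarrow> nat \<Rightarrow> 'a"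
  where "mid_sum x y r s q = (\<Sum>c\<in>{r..s}. x ^ (c - r) * y ^ (s - c) * cap y c q)"

definition cap_mid_sum :: "'a::comm_ring_1 \<Rightarrow> 'a \<Rightarrow> nat \<Rightarrow> nat \<Rightarrow> nat \<Rightarrow> nat \<Rightarrow> 'a"
  where "cap_mid_sum x y r s q p
    = (\<Sum>c\<in>{r..s}. cap x p c * (x ^ (c - r) * y ^ (s - c) * cap y c q))"

text \<open>The corrections of \<open>iso_sum_eq1\<close> and \<open>iso_sum_eq2\<close> at once;
  reversing the summation exchanges them, so the sum is symmetric.\<close>

definition bi_sum :: "'a::comm_ring_1 \<Rightarrow> 'a \<Rightarrow> nat \<Rightarrow> 'a"
  where "bi_sum x y d = (\<Sum>c\<le>d. x ^ c * y ^ (d - c) * (if c = 0 then 1 else 1 - y) * (if c = d then 1 else 1 - x))"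

lemma bi_sum_commute: "bi_sum x y d = bi_sum y x d"
proof -
  have "bi_sum x y d = (\<Sum>c\<le>d. x ^ (d - c) * y ^ (d - (d - c)) * (if d - c = 0 then 1 else 1 - y)
      * (if d - c = d then 1 else 1 - x))"
    unfolding bi_sum_def
    by (rule sum.reindex_bij_witness [where i = "\<lambda>c. d - c" and j = "\<lambda>c. d - c"]) auto
  also have "\<dots> = bi_sum y x d"
    unfolding bi_sum_def by (rule sum.cong) (auto simp: mult.commute)
  finally show ?thesis .
qed

lemma sum_shift_start:
  fixes f :: "nat \<Rightarrow> 'a::comm_monoid_add"
  assumes "r \<le> q" "q \<le> s" "\<And>c. c < q \<Longrightarrow> f c = 0"
  shows "sum f {r..s} = (\<Sum>k\<le>s - q. f (q + k))"
proof -
  have "sum f {r..s} = sum f {q..s}"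
    by (rule sum.mono_neutral_right) (use assms in auto)
  also have "\<dots> = (\<Sum>k\<le>s - q. f (q + k))"
    by (rule sum.reindex_bij_witness [where i = "\<lambda>k. q + k" and j = "\<lambda>c. c - q"]) (use assms in auto)
  finally show ?thesis .
qed

text \<open>The terms with \<open>c < q\<close> vanish, so x^(q-r) comes out of the sum. The lower
  rows supply y^(q-r), which completes it to a symmetric power.\<close>

lemma mid_sum_low:
  assumes "r \<le> q" "q \<le> s"
  shows "y ^ (q - r) * mid_sum x y r s q = (x * y) ^ (q - r) * iso_sum x y (s - q)"
proof -
  have "mid_sum x y r s q = (\<Sum>k\<le>s - q. x ^ (q + k - r) * y ^ (s - (q + k)) * cap y (q + k) q)"
    unfolding mid_sum_def by (rule sum_shift_start) (use assms in \<open>auto simp: cap_def\<close>)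
  also have "\<dots> = x ^ (q - r) * iso_sum x y (s - q)"
    unfolding iso_sum_eq1 sum_distrib_left
  proof (rule sum.cong)
    fix k assume "k \<in> {..s - q}"
    then have e: "q + k - r = (q - r) + k" "s - (q + k) = s - q - k" using assms by auto
    show "x ^ (q + k - r) * y ^ (s - (q + k)) * cap y (q + k) q
      = x ^ (q - r) * (x ^ k * y ^ (s - q - k) * (if k = 0 then 1 else 1 - y))"
      unfolding e power_add by (simp add: cap_def mult.assoc)
  qed simp
  finally show ?thesis by (simp add: power_mult_distrib ac_simps)
qed

lemma mid_sum_high:
  assumes "q < r" "r \<le> s"
  shows "mid_sum x y r s q = (1 - y) * sym_sum x y (s - r)"
proof -
  have "mid_sum x y r s q = (\<Sum>k\<le>s - r. x ^ (r + k - r) * y ^ (s - (r + k)) * cap y (r + k) q)"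
    unfolding mid_sum_def
    by (rule sum.reindex_bij_witness [where i = "\<lambda>k. r + k" and j = "\<lambda>c. c - r"]) (use assms in auto)
  also have "\<dots> = (1 - y) * sym_sum x y (s - r)"
    unfolding sym_sum_def sum_distrib_left
    by (rule sum.cong) (use assms in \<open>auto simp: cap_def\<close>)
  finally show ?thesis .
qed

lemma cap_mid_sum_large: "s < p \<Longrightarrow> cap_mid_sum x y r s q p = (1 - x) * mid_sum x y r s q"
  unfolding cap_mid_sum_def mid_sum_def sum_distrib_left
  by (rule sum.cong) (auto simp: cap_def)

text \<open>The row above forces \<open>c \<le> p\<close>, so all boxes between columns
  \<open>p\<close> and \<open>s\<close> hold y. This is the origin of the power in
  \<open>sym_part\<close>.\<close>

lemma cap_mid_sum_small:
  assumes "p \<le> s"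
  shows "cap_mid_sum x y r s q p = y ^ (s - p) * cap_mid_sum x y r p q p"
proof -
  have "cap_mid_sum x y r s q p
      = (\<Sum>c\<in>{r..p}. cap x p c * (x ^ (c - r) * y ^ (s - c) * cap y c q))"
    unfolding cap_mid_sum_def
    by (rule sum.mono_neutral_right) (use assms in \<open>auto simp: cap_def\<close>)
  also have "\<dots> = y ^ (s - p) * cap_mid_sum x y r p q p"
    unfolding cap_mid_sum_def sum_distrib_left
  proof (rule sum.cong)
    fix c assume "c \<in> {r..p}"
    then have "s - c = (s - p) + (p - c)" using assms by auto
    then have e: "y ^ (s - c) = y ^ (s - p) * y ^ (p - c)" by (simp add: power_add)
    show "cap x p c * (x ^ (c - r) * y ^ (s - c) * cap y c q)
      = y ^ (s - p) * (cap x p c * (x ^ (c - r) * y ^ (p - c) * cap y c q))"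
      unfolding e by (simp only: ac_simps)
  qed simp
  finally show ?thesis .
qed

lemma cap_mid_sum_low:
  assumes "r \<le> q" "q \<le> p"
  shows "y ^ (q - r) * cap_mid_sum x y r p q p = (x * y) ^ (q - r) * bi_sum x y (p - q)"
proof -
  have "cap_mid_sum x y r p q p = (\<Sum>k\<le>p - q. cap x p (q + k) *
      (x ^ (q + k - r) * y ^ (p - (q + k)) * cap y (q + k) q))"
    unfolding cap_mid_sum_def by (rule sum_shift_start) (use assms in \<open>auto simp: cap_def\<close>)
  also have "\<dots> = x ^ (q - r) * bi_sum x y (p - q)"
    unfolding bi_sum_def sum_distrib_left
  proof (rule sum.cong)
    fix k assume k: "k \<in> {..p - q}"
    then have e: "q + k - r = (q - r) + k" "p - (q + k) = p - q - k" using assms by auto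
    have e2: "cap x p (q + k) = (if k = p - q then 1 else 1 - x)"
      using k assms by (auto simp: cap_def)
    have e3: "cap y (q + k) q = (if k = 0 then 1 else 1 - y)" by (auto simp: cap_def)
    show "cap x p (q + k) * (x ^ (q + k - r) * y ^ (p - (q + k)) * cap y (q + k) q)
      = x ^ (q - r) * (x ^ k * y ^ (p - q - k) * (if k = 0 then 1 else 1 - y) * (if k = p - q then 1 else 1 - x))"
      unfolding e e2 e3 power_add by (simp only: ac_simps)
  qed simp
  finally show ?thesis by (simp add: power_mult_distrib ac_simps)
qed

lemma cap_mid_sum_eq_0: "s < q \<Longrightarrow> cap_mid_sum x y r s q p = 0"
  unfolding cap_mid_sum_def by (rule sum.neutral) (auto simp: cap_def)

lemma cap_mid_sum_empty: "s < r \<Longrightarrow> cap_mid_sum x y r s q p = 0"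
  by (simp add: cap_mid_sum_def)

lemma cap_mid_sum_high:
  assumes "q < r" "r \<le> p"
  shows "cap_mid_sum x y r p q p = (1 - y) * iso_sum x y (p - r)"
proof -
  have "cap_mid_sum x y r p q p = (\<Sum>k\<le>p - r. cap x p (r + k) *
      (x ^ (r + k - r) * y ^ (p - (r + k)) * cap y (r + k) q))"
    unfolding cap_mid_sum_def
    by (rule sum.reindex_bij_witness [where i = "\<lambda>k. r + k" and j = "\<lambda>c. c - r"]) (use assms in auto)
  also have "\<dots> = (1 - y) * iso_sum x y (p - r)"
    unfolding iso_sum_eq2 sum_distrib_left
  proof (rule sum.cong)
    fix k assume k: "k \<in> {..p - r}"
    then have e: "r + k - r = k" "p - (r + k) = p - r - k" using assms by auto
    have e2: "cap x p (r + k) = (if k = p - r then 1 else 1 - x)"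
      using k assms by (auto simp: cap_def)
    have e3: "cap y (r + k) q = 1 - y" using assms by (auto simp: cap_def)
    show "cap x p (r + k) * (x ^ (r + k - r) * y ^ (p - (r + k)) * cap y (r + k) q)
      = (1 - y) * (x ^ k * y ^ (p - r - k) * (if k = p - r then 1 else 1 - x))"
      unfolding e e2 e3 by (simp only: ac_simps)
  qed simp
  finally show ?thesis .
qed

text \<open>The invariant of the induction over rows. \<open>q\<close> is the entry of a row just
  after the varying one, and \<open>p\<close> is the entry of the row above that bounds the varying
  one. If \<open>p \<le> q\<close>, the boxes between columns \<open>p\<close> and \<open>q\<close>
  are forced to hold x_(t+1). If \<open>q < p\<close>, the varying entry always stays below
  \<open>p\<close>, and the row above can always take x_t as an extra letter.\<close>

definition sym_part :: "nat \<Rightarrow> nat \<Rightarrow> nat \<Rightarrow> int_mpoly \<Rightarrow> bool"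
  where "sym_part t q p h \<longleftrightarrow>
    (\<exists>s. swap_vars t s = s \<and> h = (if p \<le> q then xvar (Suc t) ^ (q - p) else 1 - xvar t) * s)"

lemma sym_part_0: "sym_part t q p 0"
  unfolding sym_part_def by (rule exI [of _ 0]) simp

lemma sym_part_add: "sym_part t q p h \<Longrightarrow> sym_part t q p h' \<Longrightarrow> sym_part t q p (h + h')"
  unfolding sym_part_def by (metis swap_vars_add distrib_left)

lemma sym_part_sum: "(\<And>a. a \<in> A \<Longrightarrow> sym_part t q p (h a)) \<Longrightarrow> sym_part t q p (sum h A)"
  by (induction A rule: infinite_finite_induct) (auto intro: sym_part_0 sym_part_add)

lemma sym_part_mult:
  assumes "swap_vars t k = k" "sym_part t q p h"
  shows "sym_part t q p (k * h)"
proof -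
  obtain s where "swap_vars t s = s" "h = (if p \<le> q then xvar (Suc t) ^ (q - p) else 1 - xvar t) * s"
    using assms(2) unfolding sym_part_def by blast
  with assms(1) show ?thesis
    unfolding sym_part_def by (intro exI [of _ "k * s"]) (simp add: swap_vars_mult ac_simps)
qed

lemma sym_part_shift:
  assumes "sym_part t q p h"
  shows "sym_part (Suc t) q p (shift h)"
proof -
  obtain s where "swap_vars t s = s" "h = (if p \<le> q then xvar (Suc t) ^ (q - p) else 1 - xvar t) * s"
    using assms unfolding sym_part_def by blast
  then show ?thesis
    unfolding sym_part_def
    by (intro exI [of _ "shift s"]) (simp add: swap_vars_Suc_shift shift_mult shift_power shift_diff)
qed

lemma swap_sums:
  "swap_vars t (sym_sum (xvar t) (xvar (Suc t)) d) = sym_sum (xvar t) (xvar (Suc t)) d"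
  "swap_vars t (iso_sum (xvar t) (xvar (Suc t)) d) = iso_sum (xvar t) (xvar (Suc t)) d"
  "swap_vars t (bi_sum (xvar t) (xvar (Suc t)) d) = bi_sum (xvar t) (xvar (Suc t)) d"
proof -
  show 1: "swap_vars t (sym_sum (xvar t) (xvar (Suc t)) d) = sym_sum (xvar t) (xvar (Suc t)) d" for d
    unfolding sym_sum_commute [of "xvar t"]
    by (subst sym_sum_commute) (simp add: sym_sum_def swap_vars_sum swap_vars_mult swap_vars_power)
  show "swap_vars t (iso_sum (xvar t) (xvar (Suc t)) d) = iso_sum (xvar t) (xvar (Suc t)) d"
    by (simp add: iso_sum_def swap_vars_diff swap_vars_mult 1 mult.commute)
  have [simp]: "swap_vars t (if b then 1 else 1 - xvar t) = (if b then 1 else 1 - xvar (Suc t))"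
    "swap_vars t (if b then 1 else 1 - xvar (Suc t)) = (if b then 1 else 1 - xvar t)" for b
    by (simp_all add: swap_vars_diff)
  have "swap_vars t (bi_sum (xvar t) (xvar (Suc t)) d) = bi_sum (xvar (Suc t)) (xvar t) d"
    by (simp add: bi_sum_def swap_vars_sum swap_vars_mult swap_vars_power swap_vars_diff)
  then show "swap_vars t (bi_sum (xvar t) (xvar (Suc t)) d) = bi_sum (xvar t) (xvar (Suc t)) d"
    using bi_sum_commute by metis
qed

text \<open>One step up the antidiagonal. In each order of the four bounds, the factor that
  \<open>h\<close> brings from the lower rows makes the sum symmetric: y^(q-r) turns x^(q-r) into
  (xy)^(q-r), and 1 - x turns 1 - y into (1-x)(1-y). What remains is the factor for the new bounds
  \<open>s\<close> and \<open>p\<close>; in the other cases the sum is zero.\<close>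

lemma sym_part_cap_mid_sum:
  assumes "sym_part t q r h"
  shows "sym_part t s p (cap_mid_sum (xvar t) (xvar (Suc t)) r s q p * h)"
proof -
  let ?x = "xvar t" and ?y = "xvar (Suc t)"
  obtain g where g: "swap_vars t g = g" and h: "h = (if r \<le> q then ?y ^ (q - r) else 1 - ?x) * g"
    using assms unfolding sym_part_def by blast
  let ?P = "\<lambda>h. sym_part t s p h"
  have xy: "swap_vars t ((?x * ?y) ^ k) = (?x * ?y) ^ k" for k
    by (simp add: swap_vars_power swap_vars_mult mult.commute)
  have xy1: "swap_vars t ((1 - ?x) * (1 - ?y)) = (1 - ?x) * (1 - ?y)"
    by (simp add: swap_vars_mult swap_vars_diff mult.commute)
  consider "p \<le> s" "r \<le> q" "q \<le> p" | "p \<le> s" "r \<le> q" "p < q" | "p \<le> s" "q < r" "r \<le> p"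
    | "p \<le> s" "p < r"
    | "s < p" "r \<le> q" "q \<le> s" | "s < p" "s < q" | "s < p" "q < r" "r \<le> s" | "s < p" "s < r"
    by linarith
  then show ?thesis
  proof cases
    case 1
    have "cap_mid_sum ?x ?y r s q p * h = ?y ^ (s - p) * ((?y ^ (q - r) * cap_mid_sum ?x ?y r p q p) * g)"
      using 1 h by (simp add: cap_mid_sum_small [of p s] ac_simps)
    also have "\<dots> = ?y ^ (s - p) * ((?x * ?y) ^ (q - r) * bi_sum ?x ?y (p - q) * g)"
      unfolding cap_mid_sum_low [OF 1(2,3)] ..
    finally show ?thesis using 1 g unfolding sym_part_def
      by (intro exI [of _ "(?x * ?y) ^ (q - r) * bi_sum ?x ?y (p - q) * g"])
        (simp add: swap_vars_mult swap_sums xy del: power_mult_distrib)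
  next
    case 2
    then show ?thesis
      by (simp add: cap_mid_sum_small [of p s] cap_mid_sum_eq_0 sym_part_0)
  next
    case 3
    have "cap_mid_sum ?x ?y r s q p * h = ?y ^ (s - p) * ((1 - ?x) * cap_mid_sum ?x ?y r p q p * g)"
      using 3 h by (simp only: cap_mid_sum_small [of p s] if_not_P linorder_not_le ac_simps)
    also have "\<dots> = ?y ^ (s - p) * (((1 - ?x) * (1 - ?y)) * iso_sum ?x ?y (p - r) * g)"
      unfolding cap_mid_sum_high [OF 3(2,3)] by (simp only: ac_simps)
    finally show ?thesis using 3 g unfolding sym_part_def
      by (intro exI [of _ "((1 - ?x) * (1 - ?y)) * iso_sum ?x ?y (p - r) * g"])
        (simp add: swap_vars_mult swap_sums xy1 [unfolded swap_vars_mult])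
  next
    case 4
    then show ?thesis
      by (simp add: cap_mid_sum_small [of p s] cap_mid_sum_empty sym_part_0)
  next
    case 5
    have "cap_mid_sum ?x ?y r s q p * h = (1 - ?x) * ((?y ^ (q - r) * mid_sum ?x ?y r s q) * g)"
      using 5 h by (simp only: cap_mid_sum_large [of s p] if_P ac_simps)
    also have "\<dots> = (1 - ?x) * ((?x * ?y) ^ (q - r) * iso_sum ?x ?y (s - q) * g)"
      unfolding mid_sum_low [OF 5(2,3)] ..
    finally show ?thesis using 5 g unfolding sym_part_def
      by (intro exI [of _ "(?x * ?y) ^ (q - r) * iso_sum ?x ?y (s - q) * g"])
        (simp add: swap_vars_mult swap_sums xy del: power_mult_distrib)
  next
    case 6
    then show ?thesis
      by (simp add: cap_mid_sum_eq_0 sym_part_0)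
  next
    case 7
    have "cap_mid_sum ?x ?y r s q p * h = (1 - ?x) * ((1 - ?x) * mid_sum ?x ?y r s q * g)"
      using 7 h by (simp only: cap_mid_sum_large [of s p] if_not_P linorder_not_le ac_simps)
    also have "\<dots> = (1 - ?x) * (((1 - ?x) * (1 - ?y)) * sym_sum ?x ?y (s - r) * g)"
      unfolding mid_sum_high [OF 7(2,3)] by (simp only: ac_simps)
    finally show ?thesis using 7 g unfolding sym_part_def
      by (intro exI [of _ "((1 - ?x) * (1 - ?y)) * sym_sum ?x ?y (s - r) * g"])
        (simp add: swap_vars_mult swap_sums xy1 [unfolded swap_vars_mult])
  next
    case 8
    then show ?thesis
      by (simp add: cap_mid_sum_empty sym_part_0)
  qed
qed

section \<open>Generating functions of flagged rows and their near symmetry\<close>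

section \<open>Row polynomials\<close>

definition valid_row :: "nat \<Rightarrow> nat \<Rightarrow> (nat \<Rightarrow> nat) \<Rightarrow> bool"
  where "valid_row a v r \<longleftrightarrow> r 0 = 0 \<and> (\<forall>l. r l \<le> r (Suc l)) \<and> (\<forall>l>v. r l = a)"

fun rows :: "(nat \<times> nat) list \<Rightarrow> (nat \<Rightarrow> nat) set"
  where "rows [] = {\<lambda>_. 0}"
  | "rows ((a, v) # rs) = {r. valid_row a v r}"

text \<open>
  The list \<open>rs\<close> contains the length and the highest level of each row. An entry of level \<open>l\<close>
  in row \<open>i\<close> (counted from 0) stands for the letter \<open>i + l + 1\<close>; the letters of a row start anew
  with 1, whence the shifts. The factor \<open>cap\<close> vanishes unless columns increase, and is
  \<open>1 - x\<close> if the letter may be added to a box of the upper row.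
\<close>

fun row_poly :: "(nat \<times> nat) list \<Rightarrow> (nat \<Rightarrow> nat) \<Rightarrow> int_mpoly"
  where "row_poly [] r = (if r \<in> rows [] then 1 else 0)"
  | "row_poly ((a, v) # rs) r = (if r \<in> rows ((a, v) # rs) then
      (\<Prod>l\<le>v. xvar (Suc l) ^ (r (Suc l) - r l)) *
      (\<Sum>q\<in>rows rs. (\<Prod>l\<le>v. cap (xvar (Suc l)) (r l) (q l)) * shift (row_poly rs q)) else 0)"

definition flag_poly :: "(nat \<times> nat) list \<Rightarrow> int_mpoly"
  where "flag_poly rs = (\<Sum>r\<in>rows rs. row_poly rs r)"

text \<open>Lengths decrease weakly while the largest letters increase weakly: level
  \<open>v\<close> of a row and level \<open>u\<close> of the next one are the letters v + 1 and u +
  2 when counted from the upper row.\<close>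

fun flag_ok :: "(nat \<times> nat) list \<Rightarrow> bool"
  where "flag_ok ((a, v) # (b, u) # rs) \<longleftrightarrow> b \<le> a \<and> v \<le> Suc u \<and> flag_ok ((b, u) # rs)"
  | "flag_ok _ \<longleftrightarrow> True"

lemma flag_ok_tl: "flag_ok (x # rs) \<Longrightarrow> flag_ok rs"
  by (cases x; cases rs) auto

lemma valid_row_mono: "valid_row a v r \<Longrightarrow> l \<le> l' \<Longrightarrow> r l \<le> r l'"
  by (rule lift_Suc_mono_le [of r]) (auto simp: valid_row_def)

lemma valid_row_le: "valid_row a v r \<Longrightarrow> r l \<le> a"
  using valid_row_mono [of a v r l "l + Suc v"] by (simp add: valid_row_def)

lemma finite_rows [simp]: "finite (rows rs)"
proof (cases rs rule: rows.cases)
  case (2 a v rs')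
  have "rows rs \<subseteq> {r. \<forall>l. (l \<in> {..v} \<longrightarrow> r l \<in> {..a}) \<and> (l \<notin> {..v} \<longrightarrow> r l = a)}"
    using valid_row_le by (auto simp: 2 valid_row_def)
  then show ?thesis
    by (rule finite_subset) (rule finite_set_of_finite_funs, auto)
qed simp

lemma rows_le_hd: "q \<in> rows ((b, u) # rs) \<Longrightarrow> q l \<le> b"
  using valid_row_le by auto

lemma rows_0: "q \<in> rows rs \<Longrightarrow> q 0 = 0"
  by (cases rs rule: rows.cases) (auto simp: valid_row_def)

lemma row_poly_outside: "r \<notin> rows rs \<Longrightarrow> row_poly rs r = 0"
  by (cases rs rule: rows.cases) auto

lemma row_poly_in_range_shift: "row_poly rs r \<in> range shift"
proof (cases rs rule: rows.cases)
  case 1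
  have "(1 :: int_mpoly) = shift 1" "(0 :: int_mpoly) = shift 0" by simp_all
  then show ?thesis unfolding 1 by (auto simp del: shift_0 shift_1)
next
  case (2 a v rs')
  have z: "(0 :: int_mpoly) = shift 0" by simp
  have "shift ((\<Prod>l\<le>v. xvar l ^ (r (Suc l) - r l)) *
      (\<Sum>q\<in>rows rs'. (\<Prod>l\<le>v. cap (xvar l) (r l) (q l)) * row_poly rs' q))
    = (\<Prod>l\<le>v. xvar (Suc l) ^ (r (Suc l) - r l)) *
      (\<Sum>q\<in>rows rs'. (\<Prod>l\<le>v. cap (xvar (Suc l)) (r l) (q l)) * shift (row_poly rs' q))"
    by (auto simp: shift_mult shift_prod shift_sum shift_power cap_def shift_diff
        intro!: prod.cong sum.cong arg_cong2 [of _ _ _ _ "(*)"])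
  then show ?thesis unfolding 2 row_poly.simps using z by (metis rangeI)
qed

text \<open>The contribution of \<open>rs\<close> to the row above when only the entry at level
  \<open>t\<close> of its first row varies. Before the shift, the letter of level \<open>t\<close>
  in the row above is x_t.\<close>

definition capped :: "(nat \<times> nat) list \<Rightarrow> nat \<Rightarrow> (nat \<Rightarrow> nat) \<Rightarrow> nat \<Rightarrow> int_mpoly"
  where "capped rs t u p = (\<Sum>c\<le>p. cap (xvar t) p c * row_poly rs (u(t := c)))"

text \<open>The 0 at \<open>t\<close> is a placeholder; the sum over the actual entry there is left
  to \<open>capped\<close>.\<close>

definition rows_but :: "(nat \<times> nat) list \<Rightarrow> nat \<Rightarrow> (nat \<Rightarrow> nat) set"
  where "rows_but rs t = (\<lambda>q. q(t := 0)) ` rows rs"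

lemma sum_rows_split:
  fixes k :: "(nat \<Rightarrow> nat) \<Rightarrow> int_mpoly"
  assumes "\<And>q c. k (q(t := c)) = k q"
  shows "(\<Sum>q\<in>rows rs. k q * cap (xvar (Suc t)) m (q t) * shift (row_poly rs q))
    = (\<Sum>u\<in>rows_but rs t. k u * shift (capped rs t u m))"
proof -
  let ?f = "\<lambda>q. k q * cap (xvar (Suc t)) m (q t) * shift (row_poly rs q)"
  have "sum ?f (rows rs) = (\<Sum>u\<in>rows_but rs t. sum ?f {q \<in> rows rs. q(t := 0) = u})"
    unfolding rows_but_def by (rule sum.image_gen) simp
  also have "\<dots> = (\<Sum>u\<in>rows_but rs t. k u * shift (capped rs t u m))"
  proof (rule sum.cong)
    fix u assume u: "u \<in> rows_but rs t"
    then have ut: "u t = 0" by (auto simp: rows_but_def)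
    have fin: "finite {c. u(t := c) \<in> rows rs}"
    proof (rule finite_imageD)
      show "finite ((\<lambda>c. u(t := c)) ` {c. u(t := c) \<in> rows rs})"
        by (rule finite_subset [OF _ finite_rows [of rs]]) auto
      show "inj_on (\<lambda>c. u(t := c)) {c. u(t := c) \<in> rows rs}"
        by (rule inj_onI) (metis fun_upd_same)
    qed
    have "sum ?f {q \<in> rows rs. q(t := 0) = u} = (\<Sum>c\<in>{c. u(t := c) \<in> rows rs}. ?f (u(t := c)))"
      by (rule sum.reindex_bij_witness [where i = "\<lambda>c. u(t := c)" and j = "\<lambda>q. q t"])
        (use ut in auto)
    also have "\<dots> = (\<Sum>c\<in>{c. u(t := c) \<in> rows rs}.
        k u * (cap (xvar (Suc t)) m c * shift (row_poly rs (u(t := c)))))"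
      by (simp add: assms mult.assoc)
    also have "\<dots> = k u * (\<Sum>c\<in>{c. u(t := c) \<in> rows rs}.
        cap (xvar (Suc t)) m c * shift (row_poly rs (u(t := c))))"
      by (simp add: sum_distrib_left)
    also have "(\<Sum>c\<in>{c. u(t := c) \<in> rows rs}.
        cap (xvar (Suc t)) m c * shift (row_poly rs (u(t := c))))
      = (\<Sum>c\<le>m. cap (xvar (Suc t)) m c * shift (row_poly rs (u(t := c))))"
      by (rule sum.mono_neutral_cong [OF _ fin]) (auto simp: cap_def row_poly_outside)
    also have "\<dots> = shift (capped rs t u m)"
      by (auto simp: capped_def shift_sum shift_mult cap_def shift_diff intro!: sum.cong)
    finally show "sum ?f {q \<in> rows rs. q(t := 0) = u} = k u * shift (capped rs t u m)" .
  qed simp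
  finally show ?thesis .
qed

lemma swap_vars_cap: "l \<noteq> t \<Longrightarrow> l \<noteq> Suc t \<Longrightarrow> swap_vars t (cap (xvar l) c d) = cap (xvar l) c d"
  by (simp add: cap_def swap_vars_diff)

lemma valid_row_fun_upd:
  assumes "Suc t \<le> v"
  shows "valid_row a v (u(Suc t := c)) \<longleftrightarrow>
    valid_row a v (u(Suc t := u t)) \<and> c \<in> {u t..u (Suc (Suc t))}" (is "?L \<longleftrightarrow> ?R")
proof
  assume L: ?L
  then have "(u(Suc t := c)) t \<le> (u(Suc t := c)) (Suc t)"
    "(u(Suc t := c)) (Suc t) \<le> (u(Suc t := c)) (Suc (Suc t))" by (auto simp only: valid_row_def)
  then have c: "u t \<le> c" "c \<le> u (Suc (Suc t))" by simp_all
  have "(u(Suc t := u t)) l \<le> (u(Suc t := u t)) (Suc l)" for l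
  proof -
    have "(u(Suc t := c)) l \<le> (u(Suc t := c)) (Suc l)" using L by (simp only: valid_row_def)
    then show ?thesis using c by (auto split: if_splits)
  qed
  with L c assms show "?R" by (auto simp: valid_row_def)
next
  assume R: "?R"
  have "(u(Suc t := c)) l \<le> (u(Suc t := c)) (Suc l)" for l
  proof -
    have "(u(Suc t := u t)) l \<le> (u(Suc t := u t)) (Suc l)" using R by (simp only: valid_row_def)
    then show ?thesis using R by (auto split: if_splits)
  qed
  with R assms show ?L by (auto simp: valid_row_def)
qed

lemma prod_split2:
  fixes f :: "nat \<Rightarrow> 'a::comm_monoid_mult"
  assumes "Suc t \<le> v"
  shows "(\<Prod>l\<le>v. f l) = (\<Prod>l\<in>{..v} - {t, Suc t}. f l) * f t * f (Suc t)"
proof -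
  have "(\<Prod>l\<le>v. f l) = f t * (\<Prod>l\<in>{..v} - {t}. f l)"
    by (rule prod.remove) (use assms in auto)
  also have "(\<Prod>l\<in>{..v} - {t}. f l) = f (Suc t) * (\<Prod>l\<in>{..v} - {t} - {Suc t}. f l)"
    by (rule prod.remove) (use assms in auto)
  also have "{..v} - {t} - {Suc t} = {..v} - {t, Suc t}" by auto
  finally show ?thesis by (simp only: ac_simps)
qed

text \<open>Exchanging x_(t+1) and x_(t+2) concerns only the levels \<open>t\<close> and
  \<open>t + 1\<close>. The products over the other levels are fixed by the exchange
  (\<open>swap_vars_factors\<close>) and are therefore collected in front.\<close>

lemma row_poly_expand:
  assumes "Suc t \<le> v" "u(Suc t := c) \<in> rows ((a, v) # rs)"
  shows "row_poly ((a, v) # rs) (u(Suc t := c)) =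
    (\<Sum>q\<in>rows_but rs t.
      (\<Prod>l\<in>{..v} - {t, Suc t}. xvar (Suc l) ^ (u (Suc l) - u l))
      * (\<Prod>l\<in>{..v} - {t, Suc t}. cap (xvar (Suc l)) (u l) (q l))
      * (xvar (Suc t) ^ (c - u t) * xvar (Suc (Suc t)) ^ (u (Suc (Suc t)) - c)
          * cap (xvar (Suc (Suc t))) c (q (Suc t)))
      * shift (capped rs t q (u t)))"
proof -
  let ?w = "u(Suc t := c)"
  let ?I = "{..v} - {t, Suc t}"
  have M: "(\<Prod>l\<le>v. xvar (Suc l) ^ (?w (Suc l) - ?w l))
    = (\<Prod>l\<in>?I. xvar (Suc l) ^ (u (Suc l) - u l)) *
       (xvar (Suc t) ^ (c - u t) * xvar (Suc (Suc t)) ^ (u (Suc (Suc t)) - c))" (is "_ = ?M * ?X")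
    unfolding prod_split2 [OF assms(1)] by (simp add: mult.assoc)
  have C: "(\<Prod>l\<le>v. cap (xvar (Suc l)) (?w l) (q l))
    = ((\<Prod>l\<in>?I. cap (xvar (Suc l)) (u l) (q l)) * cap (xvar (Suc (Suc t))) c (q (Suc t)))
      * cap (xvar (Suc t)) (u t) (q t)" (is "_ = ?K q * _") for q
    unfolding prod_split2 [OF assms(1)] by (simp add: ac_simps)
  have "row_poly ((a, v) # rs) ?w =
      ?M * ?X * (\<Sum>q\<in>rows rs. ?K q * cap (xvar (Suc t)) (u t) (q t) * shift (row_poly rs q))"
    using assms(2) by (simp add: M [symmetric] C del: fun_upd_apply)
  also have "\<dots> = ?M * ?X * (\<Sum>q\<in>rows_but rs t. ?K q * shift (capped rs t q (u t)))"
    by (subst sum_rows_split) (auto intro!: prod.cong arg_cong2 [of _ _ _ _ "(*)"])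
  finally show ?thesis by (simp add: sum_distrib_left ac_simps)
qed

lemma swap_vars_factors:
  "swap_vars (Suc t) (\<Prod>l\<in>{..v} - {t, Suc t}. xvar (Suc l) ^ e l)
    = (\<Prod>l\<in>{..v} - {t, Suc t}. xvar (Suc l) ^ e l)"
  "swap_vars (Suc t) (\<Prod>l\<in>{..v} - {t, Suc t}. cap (xvar (Suc l)) (u l) (q l))
    = (\<Prod>l\<in>{..v} - {t, Suc t}. cap (xvar (Suc l)) (u l) (q l))"
  by (auto simp: swap_vars_prod swap_vars_power swap_vars_cap intro!: prod.cong)

text \<open>The lower end of an antidiagonal. The entry at level 0 is always 0, so all boxes counted
  by \<open>u 1\<close> hold x_1. The rest of this row has letters from 2 on, and after the shift so
  do the rows below; nothing else involves x_0 or x_1.\<close>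

lemma sym_part_capped_0: "sym_part 0 (u (Suc 0)) 0 (capped rs 0 u 0)"
proof (cases rs rule: rows.cases)
  case 1
  then show ?thesis
    by (auto simp: sym_part_def capped_def cap_def fun_eq_iff intro: exI [of _ 0] exI [of _ 1])
next
  case (2 a v rs')
  let ?w = "u(0 := 0)"
  show ?thesis
  proof (cases "?w \<in> rows rs")
    case True
    then have w: "valid_row a v ?w" by (simp add: 2)
    let ?g = "(\<Prod>l\<in>{0<..v}. xvar (Suc l) ^ (?w (Suc l) - ?w l)) *
      (\<Sum>q\<in>rows rs'. (\<Prod>l\<in>{0<..v}. cap (xvar (Suc l)) (?w l) (q l)) * shift (row_poly rs' q))"
    have split0: "(\<Prod>l\<le>v. f l) = f 0 * (\<Prod>l\<in>{0<..v}. f l)" for f :: "nat \<Rightarrow> int_mpoly"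
    proof -
      have "{..v} = insert 0 {0<..v}" by auto
      then show ?thesis by simp
    qed
    have "row_poly rs ?w = xvar (Suc 0) ^ u (Suc 0) * ?g"
    proof -
      have "(\<Sum>q\<in>rows rs'. (\<Prod>l\<le>v. cap (xvar (Suc l)) (?w l) (q l)) * shift (row_poly rs' q))
        = (\<Sum>q\<in>rows rs'. (\<Prod>l\<in>{0<..v}. cap (xvar (Suc l)) (?w l) (q l)) * shift (row_poly rs' q))"
      proof (rule sum.cong)
        fix q assume "q \<in> rows rs'"
        then have "cap (xvar (Suc 0)) (?w 0) (q 0) = 1" by (simp add: rows_0 cap_def)
        then show "(\<Prod>l\<le>v. cap (xvar (Suc l)) (?w l) (q l)) * shift (row_poly rs' q)
          = (\<Prod>l\<in>{0<..v}. cap (xvar (Suc l)) (?w l) (q l)) * shift (row_poly rs' q)"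
          by (simp only: split0 mult_1_left)
      qed simp
      moreover have "(\<Prod>l\<le>v. xvar (Suc l) ^ (?w (Suc l) - ?w l))
          = xvar (Suc 0) ^ u (Suc 0) * (\<Prod>l\<in>{0<..v}. xvar (Suc l) ^ (?w (Suc l) - ?w l))"
        by (simp add: split0)
      ultimately show ?thesis using True unfolding 2 row_poly.simps by (simp only: if_True mult.assoc)
    qed
    moreover have "swap_vars 0 ?g = ?g"
    proof -
      have "swap_vars 0 (shift (row_poly rs' q)) = shift (row_poly rs' q)" for q
        using row_poly_in_range_shift [of rs' q] swap_vars_0_shift_shift by auto
      then show ?thesis
        by (auto simp: swap_vars_mult swap_vars_prod swap_vars_sum swap_vars_power swap_vars_cap
            intro!: prod.cong sum.cong arg_cong2 [of _ _ _ _ "(*)"] simp del: fun_upd_apply)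
    qed
    ultimately show ?thesis
      unfolding sym_part_def by (intro exI [of _ ?g]) (simp add: capped_def cap_def del: fun_upd_apply)
  next
    case False
    then show ?thesis by (simp add: capped_def row_poly_outside sym_part_0)
  qed
qed

text \<open>The letters of level \<open>t\<close> in a row have level \<open>t - 1\<close> in the
  next one, which explains the descent in \<open>t\<close> along with \<open>rs\<close>.
  \<open>flag_ok\<close> guarantees that level \<open>t - 1\<close> is still within the flag of the
  next row, so that its entry is free to vary.\<close>

lemma sym_part_capped:
  assumes "flag_ok rs" "case rs of [] \<Rightarrow> True | (a, v) # _ \<Rightarrow> t \<le> v" "t = 0 \<Longrightarrow> p = 0"
  shows "sym_part t (u (Suc t)) p (capped rs t u p)"
  using assms
proof (induction rs arbitrary: t p u)
  case Nil
  show ?case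
  proof (cases "\<forall>l. l \<noteq> t \<longrightarrow> u l = 0")
    case True
    then have "u(t := c) \<in> rows [] \<longleftrightarrow> c = 0" for c by (auto simp: fun_eq_iff)
    then have "capped [] t u p = (\<Sum>c\<in>{0}. cap (xvar t) p c)"
      unfolding capped_def by (intro sum.mono_neutral_cong) auto
    with True show ?thesis
      unfolding sym_part_def by (intro exI [of _ 1]) (auto simp: cap_def)
  next
    case False
    then have "u(t := c) \<notin> rows []" for c by (auto simp: fun_eq_iff)
    then have "capped [] t u p = 0" by (simp add: capped_def)
    then show ?thesis by (simp add: sym_part_0)
  qed
next
  case (Cons x rs)
  obtain a v where x: "x = (a, v)" by (cases x)
  show ?case
  proof (cases t)
    case 0
    then show ?thesis using Cons.prems sym_part_capped_0 by simp
  next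
    case (Suc k)
    then have k: "Suc k \<le> v" using Cons.prems x by simp
    show ?thesis
    proof (cases "valid_row a v (u(Suc k := u k))")
      case False
      then have "u(Suc k := c) \<notin> rows ((a, v) # rs)" for c
        using valid_row_fun_upd [OF k, of a u c] by auto
      then have "capped ((a, v) # rs) (Suc k) u p = 0" by (simp add: capped_def row_poly_outside)
      then show ?thesis by (simp add: sym_part_0 Suc x)
    next
      case True
      let ?A = "\<lambda>q. (\<Prod>l\<in>{..v} - {k, Suc k}. xvar (Suc l) ^ (u (Suc l) - u l))
        * (\<Prod>l\<in>{..v} - {k, Suc k}. cap (xvar (Suc l)) (u l) (q l))"
      let ?B = "\<lambda>q c. xvar (Suc k) ^ (c - u k) * xvar (Suc (Suc k)) ^ (u (Suc (Suc k)) - c)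
          * cap (xvar (Suc (Suc k))) c (q (Suc k))"
      have mem: "u(Suc k := c) \<in> rows ((a, v) # rs) \<longleftrightarrow> c \<in> {u k..u (Suc (Suc k))}" for c
        using valid_row_fun_upd [OF k, of a u c] True by simp
      have "capped ((a, v) # rs) (Suc k) u p
          = (\<Sum>c\<in>{u k..u (Suc (Suc k))}. cap (xvar (Suc k)) p c * row_poly ((a, v) # rs) (u(Suc k := c)))"
        unfolding capped_def
      proof (rule sum.mono_neutral_cong)
        show "cap (xvar (Suc k)) p c * row_poly ((a, v) # rs) (u(Suc k := c)) = 0"
          if "c \<in> {u k..u (Suc (Suc k))} - {..p}" for c using that by (simp add: cap_def)
        show "cap (xvar (Suc k)) p c * row_poly ((a, v) # rs) (u(Suc k := c)) = 0"
          if "c \<in> {..p} - {u k..u (Suc (Suc k))}" for c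
          using that mem [of c] row_poly_outside [of "u(Suc k := c)" "(a, v) # rs"]
          by (simp del: row_poly.simps)
      qed simp_all
      also have "\<dots> = (\<Sum>c\<in>{u k..u (Suc (Suc k))}. \<Sum>q\<in>rows_but rs k.
          ?A q * (cap (xvar (Suc k)) p c * ?B q c * shift (capped rs k q (u k))))"
      proof (rule sum.cong)
        fix c assume "c \<in> {u k..u (Suc (Suc k))}"
        then have "u(Suc k := c) \<in> rows ((a, v) # rs)" using mem by blast
        from row_poly_expand [OF k this]
        show "cap (xvar (Suc k)) p c * row_poly ((a, v) # rs) (u(Suc k := c))
          = (\<Sum>q\<in>rows_but rs k. ?A q * (cap (xvar (Suc k)) p c * ?B q c * shift (capped rs k q (u k))))"
          by (simp add: sum_distrib_left ac_simps del: row_poly.simps)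
      qed simp
      also have "\<dots> = (\<Sum>q\<in>rows_but rs k. ?A q *
          (cap_mid_sum (xvar (Suc k)) (xvar (Suc (Suc k))) (u k) (u (Suc (Suc k))) (q (Suc k)) p
            * shift (capped rs k q (u k))))"
        unfolding cap_mid_sum_def
        by (subst sum.swap) (simp add: sum_distrib_left sum_distrib_right ac_simps)
      finally have eq: "capped ((a, v) # rs) (Suc k) u p = \<dots>" .
      have "sym_part k (q (Suc k)) (u k) (capped rs k q (u k))" for q
      proof (rule Cons.IH)
        show "flag_ok rs" using Cons.prems(1) by (rule flag_ok_tl)
        show "case rs of [] \<Rightarrow> True | (a, v) # _ \<Rightarrow> k \<le> v"
          using Cons.prems(1) k by (auto simp: x split: list.split)
        show "k = 0 \<Longrightarrow> u k = 0" using True by (auto simp: valid_row_def)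
      qed
      then have "sym_part (Suc k) (u (Suc (Suc k))) p
          (cap_mid_sum (xvar (Suc k)) (xvar (Suc (Suc k))) (u k) (u (Suc (Suc k))) (q (Suc k)) p
            * shift (capped rs k q (u k)))" for q
        by (intro sym_part_cap_mid_sum sym_part_shift)
      then have "sym_part (Suc k) (u (Suc (Suc k))) p (?A q *
          (cap_mid_sum (xvar (Suc k)) (xvar (Suc (Suc k))) (u k) (u (Suc (Suc k))) (q (Suc k)) p
            * shift (capped rs k q (u k))))" for q
        by (rule sym_part_mult [rotated]) (simp add: swap_vars_mult swap_vars_factors)
      then show ?thesis unfolding Suc x eq by (rule sym_part_sum)
    qed
  qed
qed

text \<open>The factor in \<open>h\<close> splits the product into a symmetric part and x_t^(d+1) or
  x_t^(d+1) (1 - x_t), for which pi_t is known; the results are the two evaluations of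
  \<open>mid_sum\<close>. For \<open>r = Suc a\<close> only 1 - x_t is left, and pi_t kills
  it.\<close>

lemma isobaric_sym_part:
  assumes h: "sym_part t q r h" and "q \<le> a" "r \<le> Suc a"
  shows "isobaric_div_diff t (xvar t ^ (Suc a - r) * h)
    = (if r \<le> a then mid_sum (xvar t) (xvar (Suc t)) r a q * h else 0)"
proof -
  let ?x = "xvar t" and ?y = "xvar (Suc t)"
  obtain g where g: "swap_vars t g = g" and h: "h = (if r \<le> q then ?y ^ (q - r) else 1 - ?x) * g"
    using assms unfolding sym_part_def by blast
  have xy: "swap_vars t ((?x * ?y) ^ k) = (?x * ?y) ^ k" for k
    by (simp add: swap_vars_power swap_vars_mult mult.commute)
  consider "r \<le> q" | "q < r" "r \<le> a" | "r = Suc a" using assms by linarith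
  then show ?thesis
  proof cases
    case 1
    then have e: "Suc a - r = (q - r) + Suc (a - q)" using assms by auto
    have "?x ^ (Suc a - r) * h = ((?x * ?y) ^ (q - r) * g) * ?x ^ Suc (a - q)"
      using 1 by (simp only: h e power_add power_mult_distrib if_True ac_simps)
    also have "isobaric_div_diff t \<dots> = ((?x * ?y) ^ (q - r) * g) * iso_sum ?x ?y (a - q)"
      unfolding isobaric_power [symmetric] by (rule isobaric_mult_sym) (simp only: swap_vars_mult g xy [unfolded swap_vars_mult])
    also have "\<dots> = ((?x * ?y) ^ (q - r) * iso_sum ?x ?y (a - q)) * g"
      by (simp only: ac_simps)
    also have "\<dots> = mid_sum ?x ?y r a q * h"
      unfolding mid_sum_low [OF 1 \<open>q \<le> a\<close>, symmetric] using 1 by (simp add: h ac_simps)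
    finally show ?thesis using 1 assms by simp
  next
    case 2
    then have e: "Suc a - r = Suc (a - r)" by auto
    have "?x ^ (Suc a - r) * h = g * (?x ^ Suc (a - r) * (1 - ?x))"
      using 2 by (simp only: h e if_False linorder_not_le [symmetric] simp_thms if_not_P ac_simps)
    also have "isobaric_div_diff t \<dots> = g * ((1 - ?x) * (1 - ?y) * sym_sum ?x ?y (a - r))"
      unfolding isobaric_power_diff [symmetric] by (rule isobaric_mult_sym) (fact g)
    also have "\<dots> = mid_sum ?x ?y r a q * h"
      unfolding mid_sum_high [OF 2] using 2 by (simp add: h ac_simps)
    finally show ?thesis using 2 by simp
  next
    case 3
    have "isobaric_div_diff t (g * (1 - ?x)) = 0"
      using isobaric_mult_sym [OF g] isobaric_one_minus by simp
    with 3 \<open>q \<le> a\<close> show ?thesis by (simp add: h mult.commute)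
  qed
qed

section \<open>Raising the flag of the first row\<close>

definition prefixes :: "nat \<Rightarrow> nat \<Rightarrow> (nat \<Rightarrow> nat) set"
  where "prefixes t a = {u. u 0 = 0 \<and> (\<forall>l<t. u l \<le> u (Suc l)) \<and> u t \<le> a \<and> (\<forall>l>t. u l = 0)}"

definition extend :: "nat \<Rightarrow> (nat \<Rightarrow> nat) \<Rightarrow> nat \<Rightarrow> nat \<Rightarrow> nat \<Rightarrow> nat"
  where "extend t u c a = (\<lambda>l. if l \<le> t then u l else if l = Suc t then c else a)"

lemma extend_valid:
  assumes "u \<in> prefixes t a" "c \<in> {u t..a}"
  shows "valid_row a (Suc t) (extend t u c a)"
proof -
  have "extend t u c a l \<le> extend t u c a (Suc l)" for l
  proof -
    consider "l < t" | "l = t" | "l = Suc t" | "l > Suc t" by linarith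
    then show ?thesis using assms by cases (auto simp: extend_def prefixes_def)
  qed
  then show ?thesis using assms by (auto simp: valid_row_def extend_def prefixes_def)
qed

lemma prefix_of_valid:
  assumes "valid_row a v r" "t \<le> v"
  shows "(\<lambda>l. if l \<le> t then r l else 0) \<in> prefixes t a"
  using assms valid_row_le [OF assms(1)] by (auto simp: valid_row_def prefixes_def)

lemma finite_prefixes: "finite (prefixes t a)"
proof -
  have "u l \<le> a" if "u \<in> prefixes t a" "l \<le> t" for u l
  proof -
    have "valid_row a (Suc t) (extend t u a a)"
      using that by (intro extend_valid) (auto simp: prefixes_def)
    from valid_row_le [OF this, of l] that show ?thesis by (simp add: extend_def)
  qed
  then have "prefixes t a \<subseteq> {u. \<forall>l. (l \<in> {..t} \<longrightarrow> u l \<in> {..a}) \<and> (l \<notin> {..t} \<longrightarrow> u l = 0)}"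
    by (auto simp: prefixes_def)
  then show ?thesis
    by (rule finite_subset) (rule finite_set_of_finite_funs, auto)
qed

lemma sum_rows_Suc:
  "(\<Sum>r\<in>rows ((a, Suc t) # rs). f r) = (\<Sum>u\<in>prefixes t a. \<Sum>c\<in>{u t..a}. f (extend t u c a))"
proof -
  have "(\<Sum>u\<in>prefixes t a. \<Sum>c\<in>{u t..a}. f (extend t u c a))
      = (\<Sum>(u, c)\<in>(SIGMA u:prefixes t a. {u t..a}). f (extend t u c a))"
    by (rule sum.Sigma) (auto simp: finite_prefixes)
  also have "\<dots> = (\<Sum>r\<in>rows ((a, Suc t) # rs). f r)"
  proof (rule sum.reindex_bij_witness [where i = "\<lambda>r. (\<lambda>l. if l \<le> t then r l else 0, r (Suc t))"
        and j = "\<lambda>(u, c). extend t u c a"]; clarsimp)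
    fix u c
    assume u: "u \<in> prefixes t a" and c: "u t \<le> c" "c \<le> a"
    show "(\<lambda>l. if l \<le> t then extend t u c a l else 0) = u \<and> extend t u c a (Suc t) = c"
      using u by (auto simp: extend_def prefixes_def fun_eq_iff)
    show "valid_row a (Suc t) (extend t u c a)" using u c by (intro extend_valid) auto
  next
    fix r assume r: "valid_row a (Suc t) r"
    show "extend t (\<lambda>l. if l \<le> t then r l else 0) (r (Suc t)) a = r"
      using r by (auto simp: extend_def fun_eq_iff valid_row_def)
    show "(\<lambda>l. if l \<le> t then r l else 0) \<in> prefixes t a \<and> r t \<le> r (Suc t) \<and> r (Suc t) \<le> a"
      using prefix_of_valid [OF r, of t] r valid_row_le [OF r] by (auto simp: valid_row_def)
  qed
  finally show ?thesis ..
qed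

lemma sum_rows_prefixes:
  "(\<Sum>r\<in>rows ((a, t) # rs). f r) = (\<Sum>u\<in>prefixes t a. f (extend t u a a))"
proof (rule sum.reindex_bij_witness [where i = "\<lambda>u. extend t u a a"
      and j = "\<lambda>r l. if l \<le> t then r l else 0"]; (clarsimp)?)
  fix u assume u: "u \<in> prefixes t a"
  show "(\<lambda>l. if l \<le> t then extend t u a a l else 0) = u"
    using u by (auto simp: extend_def prefixes_def fun_eq_iff)
  have "valid_row a (Suc t) (extend t u a a)"
    using u by (intro extend_valid) (auto simp: prefixes_def)
  then show "valid_row a t (extend t u a a)" by (auto simp: valid_row_def extend_def)
next
  fix r assume r: "valid_row a t r"
  show "extend t (\<lambda>l. if l \<le> t then r l else 0) a a = r"
    using r by (auto simp: extend_def fun_eq_iff valid_row_def)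
  then show "f (extend t (\<lambda>l. if l \<le> t then r l else 0) a a) = f r" by simp
  show "(\<lambda>l. if l \<le> t then r l else 0) \<in> prefixes t a"
    using prefix_of_valid [OF r] by simp
qed

text \<open>pi_(t+1) trades one box of the first row for one more letter. The entries up to level
  \<open>t\<close> are frozen. The operator acts on the power of x_(t+1) together with the
  antidiagonal below it, and its result is the sum over a new free entry at level
  \<open>t + 1\<close>. Prefixes that already fill the longer row, \<open>u t = Suc a\<close>, are
  annihilated.\<close>

lemma flag_poly_step:
  assumes "flag_ok rs" "case rs of [] \<Rightarrow> True | (b, v) # _ \<Rightarrow> b \<le> a \<and> t \<le> v"
  shows "isobaric_div_diff (Suc t) (flag_poly ((Suc a, t) # rs)) = flag_poly ((a, Suc t) # rs)"
proof -
  let ?x = "xvar (Suc t)" and ?y = "xvar (Suc (Suc t))"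
  let ?A = "\<lambda>u q. (\<Prod>l<t. xvar (Suc l) ^ (u (Suc l) - u l)) * (\<Prod>l<t. cap (xvar (Suc l)) (u l) (q l))"
  let ?H = "\<lambda>u q. shift (capped rs t q (u t))"
  have new: "flag_poly ((a, Suc t) # rs) = (\<Sum>u\<in>prefixes t a. \<Sum>q\<in>rows_but rs t.
      ?A u q * (mid_sum ?x ?y (u t) a (q (Suc t)) * ?H u q))"
    unfolding flag_poly_def sum_rows_Suc
  proof (rule sum.cong)
    fix u assume u: "u \<in> prefixes t a"
    have I: "{..Suc t} - {t, Suc t} = {..<t}" by auto
    have "row_poly ((a, Suc t) # rs) (extend t u c a) = (\<Sum>q\<in>rows_but rs t. ?A u q *
        ((?x ^ (c - u t) * ?y ^ (a - c) * cap ?y c (q (Suc t))) * ?H u q))"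
      if c: "c \<in> {u t..a}" for c
    proof -
      have e: "(extend t u 0 a)(Suc t := c) = extend t u c a"
        by (auto simp: extend_def fun_eq_iff)
      have mem: "extend t u c a \<in> rows ((a, Suc t) # rs)" using extend_valid [OF u c] by simp
      have low: "extend t u 0 a l = u l" if "l \<le> t" for l using that by (simp add: extend_def)
      have high: "extend t u 0 a (Suc (Suc t)) = a" by (simp add: extend_def)
      have p1: "(\<Prod>l<t. xvar (Suc l) ^ (extend t u 0 a (Suc l) - extend t u 0 a l))
          = (\<Prod>l<t. xvar (Suc l) ^ (u (Suc l) - u l))"
        by (rule prod.cong) (auto simp: low)
      have p2: "(\<Prod>l<t. cap (xvar (Suc l)) (extend t u 0 a l) (q l))
          = (\<Prod>l<t. cap (xvar (Suc l)) (u l) (q l))" for q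
        by (rule prod.cong) (auto simp: low)
      show ?thesis
        using row_poly_expand [of t "Suc t" "extend t u 0 a" c a rs] mem
        unfolding e I p1 p2 high low [OF order_refl] by (simp only: le_refl simp_thms mult.assoc)
    qed
    then have "(\<Sum>c\<in>{u t..a}. row_poly ((a, Suc t) # rs) (extend t u c a))
      = (\<Sum>c\<in>{u t..a}. \<Sum>q\<in>rows_but rs t. ?A u q *
        ((?x ^ (c - u t) * ?y ^ (a - c) * cap ?y c (q (Suc t))) * ?H u q))"
      by (intro sum.cong) auto
    also have "\<dots> = (\<Sum>q\<in>rows_but rs t.
      ?A u q * (mid_sum ?x ?y (u t) a (q (Suc t)) * ?H u q))"
      by (subst sum.swap) (simp add: mid_sum_def sum_distrib_left sum_distrib_right ac_simps)
    finally show "(\<Sum>c\<in>{u t..a}. row_poly ((a, Suc t) # rs) (extend t u c a)) = \<dots>" .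
  qed simp
  have old: "flag_poly ((Suc a, t) # rs) = (\<Sum>u\<in>prefixes t (Suc a). \<Sum>q\<in>rows_but rs t.
      ?A u q * (?x ^ (Suc a - u t) * ?H u q))"
    unfolding flag_poly_def sum_rows_prefixes
  proof (rule sum.cong)
    fix u assume u: "u \<in> prefixes t (Suc a)"
    let ?r = "extend t u (Suc a) (Suc a)"
    have "valid_row (Suc a) (Suc t) ?r"
      using u by (intro extend_valid) (auto simp: prefixes_def)
    then have mem: "?r \<in> rows ((Suc a, t) # rs)" by (auto simp: valid_row_def extend_def)
    have low: "?r l = u l" if "l \<le> t" for l using that by (simp add: extend_def)
    have p1: "(\<Prod>l\<le>t. xvar (Suc l) ^ (?r (Suc l) - ?r l))
        = (\<Prod>l<t. xvar (Suc l) ^ (u (Suc l) - u l)) * ?x ^ (Suc a - u t)" (is "_ = ?M * _")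
    proof -
      have "(\<Prod>l<t. xvar (Suc l) ^ (?r (Suc l) - ?r l)) = ?M"
        by (rule prod.cong) (auto simp: low)
      then show ?thesis by (simp add: lessThan_Suc_atMost [symmetric] extend_def)
    qed
    have p2: "(\<Prod>l\<le>t. cap (xvar (Suc l)) (?r l) (q l))
        = (\<Prod>l<t. cap (xvar (Suc l)) (u l) (q l)) * cap ?x (u t) (q t)" (is "_ = ?K q * _") for q
    proof -
      have "(\<Prod>l<t. cap (xvar (Suc l)) (?r l) (q l)) = ?K q"
        by (rule prod.cong) (auto simp: low)
      then show ?thesis by (simp add: lessThan_Suc_atMost [symmetric] low)
    qed
    have "row_poly ((Suc a, t) # rs) ?r = ?M * ?x ^ (Suc a - u t) *
        (\<Sum>q\<in>rows rs. ?K q * cap ?x (u t) (q t) * shift (row_poly rs q))"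
      unfolding row_poly.simps p1 p2 using mem by (simp only: if_True)
    also have "\<dots> = ?M * ?x ^ (Suc a - u t) * (\<Sum>q\<in>rows_but rs t. ?K q * ?H u q)"
      by (subst sum_rows_split) auto
    finally show "row_poly ((Suc a, t) # rs) ?r = (\<Sum>q\<in>rows_but rs t.
      ?A u q * (?x ^ (Suc a - u t) * ?H u q))"
      by (simp add: sum_distrib_left ac_simps)
  qed simp
  have A: "swap_vars (Suc t) (?A u q) = ?A u q" for u q
    by (auto simp: swap_vars_mult swap_vars_prod swap_vars_power swap_vars_cap
        intro!: prod.cong arg_cong2 [of _ _ _ _ "(*)"])
  have "isobaric_div_diff (Suc t) (flag_poly ((Suc a, t) # rs))
    = (\<Sum>u\<in>prefixes t (Suc a). \<Sum>q\<in>rows_but rs t. if u t \<le> a then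
        ?A u q * (mid_sum ?x ?y (u t) a (q (Suc t)) * ?H u q) else 0)"
    unfolding old isobaric_sum
  proof (intro sum.cong refl)
    fix u q assume u: "u \<in> prefixes t (Suc a)" and q: "q \<in> rows_but rs t"
    have "q l \<le> a" for l
    proof (cases rs rule: rows.cases)
      case 1
      then show ?thesis using q by (auto simp: rows_but_def)
    next
      case (2 b v rs')
      then obtain q' where "q' \<in> rows rs" "q = q'(t := 0)" using q by (auto simp: rows_but_def)
      moreover have "b \<le> a" using assms(2) 2 by simp
      ultimately show ?thesis using rows_le_hd [of q' b v rs' l] 2 by simp
    qed
    then have qa: "q (Suc t) \<le> a" .
    have ua: "u t \<le> Suc a" using u by (simp add: prefixes_def)
    have "sym_part t (q (Suc t)) (u t) (capped rs t q (u t))"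
      by (rule sym_part_capped [OF assms(1)])
        (use assms(2) u in \<open>auto simp: prefixes_def split: list.splits\<close>)
    then have "sym_part (Suc t) (q (Suc t)) (u t) (?H u q)" by (rule sym_part_shift)
    from isobaric_sym_part [OF this qa ua]
    show "isobaric_div_diff (Suc t) (?A u q * (?x ^ (Suc a - u t) * ?H u q))
      = (if u t \<le> a then ?A u q * (mid_sum ?x ?y (u t) a (q (Suc t)) * ?H u q) else 0)"
      unfolding isobaric_mult_sym [OF A] by simp
  qed
  also have "\<dots> = flag_poly ((a, Suc t) # rs)"
    unfolding new
  proof (rule sum.mono_neutral_cong_right)
    show "\<forall>u\<in>prefixes t (Suc a) - prefixes t a. (\<Sum>q\<in>rows_but rs t. if u t \<le> a then
        ?A u q * (mid_sum ?x ?y (u t) a (q (Suc t)) * ?H u q) else 0) = 0"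
    proof
      fix u assume "u \<in> prefixes t (Suc a) - prefixes t a"
      then have "\<not> u t \<le> a" by (auto simp: prefixes_def)
      then show "(\<Sum>q\<in>rows_but rs t. if u t \<le> a then
        ?A u q * (mid_sum ?x ?y (u t) a (q (Suc t)) * ?H u q) else 0) = 0" by simp
    qed
  qed (auto simp: finite_prefixes, auto simp: prefixes_def)
  finally show ?thesis .
qed

lemma flag_poly_base:
  assumes "case rs of [] \<Rightarrow> True | (b, v) # _ \<Rightarrow> b \<le> a"
  shows "flag_poly ((a, 0) # rs) = xvar 1 ^ a * shift (flag_poly rs)"
proof -
  let ?r = "\<lambda>l::nat. if l = 0 then 0 else a"
  have "rows ((a, 0) # rs) = {?r}"
    by (auto simp: valid_row_def fun_eq_iff)
  then have "flag_poly ((a, 0) # rs) = xvar 1 ^ a * (\<Sum>q\<in>rows rs. cap (xvar 1) 0 (q 0) * shift (row_poly rs q))"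
    by (simp add: flag_poly_def)
  also have "(\<Sum>q\<in>rows rs. cap (xvar 1) 0 (q 0) * shift (row_poly rs q)) = shift (flag_poly rs)"
    unfolding flag_poly_def shift_sum by (rule sum.cong) (auto simp: rows_0 cap_def)
  finally show ?thesis .
qed

section \<open>Recursion on the first descent of a vexillary permutation\<close>

section \<open>Grothendieck polynomials of vexillary permutations\<close>

lemma grothendieck_ascent:
  assumes "w permutes {1..n}" "1 \<le> i" "i < n" "w i < w (Suc i)"
  shows "grothendieck n w = isobaric_div_diff i (grothendieck n (w \<circ> transpose i (Suc i)))"
  using is_grothendieck_ascent [OF is_grothendieck_grothendieck [OF permutes_comp_transpose] assms(2-4)]
    assms by (intro grothendieck_eqI) auto

lemma grothendieck_in_range_shift:
  assumes "w permutes {1..n}"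
  shows "grothendieck n w \<in> range shift"
  using is_grothendieck_grothendieck [OF assms]
proof (induction rule: is_grothendieck.induct)
  case longest
  have "(\<Prod>i\<in>{1..<n}. xvar i ^ (n - i)) = shift (\<Prod>i\<in>{1..<n}. xvar (i - 1) ^ (n - i))"
    unfolding shift_prod by (rule prod.cong) (auto simp: shift_power)
  then show ?case by auto
next
  case (step w G i)
  then show ?case using isobaric_Suc_shift [of "i - 1"] by auto
qed

text \<open>The one-line word with its \<open>m\<close>-th letter deleted, standardized.\<close>

definition drop_at :: "nat \<Rightarrow> nat \<Rightarrow> (nat \<Rightarrow> nat) \<Rightarrow> nat \<Rightarrow> nat"
  where "drop_at n m w i = (if 1 \<le> i \<and> i \<le> n then
    (let z = w (if i < m then i else Suc i) in if z < w m then z else z - 1) else i)"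

lemma drop_at_less_iff:
  assumes "inj w" "1 \<le> i" "i \<le> n" "1 \<le> j" "j \<le> n"
  shows "drop_at n m w i < drop_at n m w j \<longleftrightarrow>
    w (if i < m then i else Suc i) < w (if j < m then j else Suc j)"
proof -
  have "w (if i < m then i else Suc i) \<noteq> w m" "w (if j < m then j else Suc j) \<noteq> w m"
    using assms(1) by (auto simp: inj_eq)
  moreover have "(if a < c then a else a - 1) < (if b < c then b else b - 1) \<longleftrightarrow> a < b"
    if "a \<noteq> c" "b \<noteq> c" for a b c :: nat using that by auto
  ultimately show ?thesis using assms(2-) unfolding drop_at_def Let_def by simp
qed

lemma drop_at_permutes:
  assumes w: "w permutes {1..Suc n}" and m: "1 \<le> m" "m \<le> Suc n"
  shows "drop_at n m w permutes {1..n}"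
proof (rule bij_imp_permutes)
  have inj: "inj w" using w by (rule permutes_inj)
  have "inj_on (drop_at n m w) {1..n}"
  proof (rule inj_onI)
    fix i j assume ij: "i \<in> {1..n}" "j \<in> {1..n}" "drop_at n m w i = drop_at n m w j"
    then have "\<not> w (if i < m then i else Suc i) < w (if j < m then j else Suc j)"
      "\<not> w (if j < m then j else Suc j) < w (if i < m then i else Suc i)"
      using drop_at_less_iff [OF inj, of i n j m] drop_at_less_iff [OF inj, of j n i m] by auto
    then have "w (if i < m then i else Suc i) = w (if j < m then j else Suc j)" by linarith
    then have "(if i < m then i else Suc i) = (if j < m then j else Suc j)"
      using inj by (simp add: inj_eq)
    then show "i = j" by (auto split: if_splits)
  qed
  moreover have "drop_at n m w ` {1..n} \<subseteq> {1..n}"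
  proof
    fix y assume "y \<in> drop_at n m w ` {1..n}"
    then obtain i where i: "1 \<le> i" "i \<le> n" "y = drop_at n m w i" by auto
    let ?j = "if i < m then i else Suc i"
    have "?j \<in> {1..Suc n}" using i by auto
    then have "w ?j \<in> {1..Suc n}" "w m \<in> {1..Suc n}"
      using permutes_in_image [OF w] m by auto
    moreover have "w ?j \<noteq> w m" using inj by (auto simp: inj_eq)
    ultimately show "y \<in> {1..n}" using i by (auto simp: drop_at_def Let_def)
  qed
  ultimately show "bij_betw (drop_at n m w) {1..n} {1..n}"
    by (simp add: bij_betw_def endo_inj_surj)
qed (auto simp: drop_at_def)

text \<open>The same value is deleted, once from its old position and once after it has moved one
  place to the left.\<close>

lemma drop_at_comp_transpose:
  assumes "1 \<le> t" "t \<le> n"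
  shows "drop_at n t (w \<circ> transpose t (Suc t)) = drop_at n (Suc t) w"
  using assms by (auto simp: fun_eq_iff drop_at_def transpose_def Let_def less_Suc_eq)

lemma drop_at_1_comp_transpose:
  assumes "1 \<le> i" "Suc i \<le> n"
  shows "drop_at n 1 (w \<circ> transpose (Suc i) (Suc (Suc i))) = drop_at n 1 w \<circ> transpose i (Suc i)"
  using assms by (auto simp: fun_eq_iff drop_at_def transpose_def Let_def)

definition avoids_132_at_first :: "nat \<Rightarrow> (nat \<Rightarrow> nat) \<Rightarrow> bool"
  where "avoids_132_at_first n u \<longleftrightarrow> (\<forall>a b. 1 < a \<and> a < b \<and> b \<le> n \<and> u 1 < u a \<and> u 1 < u b \<longrightarrow> u a < u b)"

lemma grothendieck_first_longest:
  "grothendieck (Suc n) (longest_perm (Suc n))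
    = xvar 1 ^ n * shift (grothendieck n (longest_perm n))"
proof (cases n)
  case 0
  then show ?thesis by (simp add: grothendieck_longest)
next
  case (Suc k)
  have "(\<Prod>i\<in>{1..<Suc n}. xvar i ^ (Suc n - i))
      = xvar 1 ^ n * (\<Prod>i\<in>{Suc 1..<Suc n}. xvar i ^ (Suc n - i))"
    by (subst prod.atLeast_Suc_lessThan) (use Suc in auto)
  also have "(\<Prod>i\<in>{Suc 1..<Suc n}. xvar i ^ (Suc n - i)) = (\<Prod>i\<in>{1..<n}. xvar (Suc i) ^ (n - i))"
    by (subst prod.shift_bounds_Suc_ivl) simp
  finally show ?thesis by (simp add: grothendieck_longest shift_prod shift_power)
qed

text \<open>Outer induction on n, inner induction downwards from the longest permutation. At an
  ascent beyond position 1 whose smaller value is below u(1), the operator pi_i has i > 1, fixes x_1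
  and passes to the shifted factor. If there is no such ascent, u is the longest permutation or u(2)
  = u(1) + 1. In the latter case pi_1 meets a symmetric factor times x_1, and pi_1(x_1) = 1.\<close>

lemma grothendieck_first:
  assumes "u permutes {1..Suc n}" "avoids_132_at_first (Suc n) u"
  shows "grothendieck (Suc n) u = xvar 1 ^ (u 1 - 1) * shift (grothendieck n (drop_at n 1 u))"
  using assms
proof (induction n arbitrary: u)
  case (0 u)
  then have "u = longest_perm (Suc 0)" by (intro no_ascent_imp_longest) auto
  moreover have "drop_at 0 1 u = longest_perm 0" by (auto simp: drop_at_def longest_perm_def fun_eq_iff)
  moreover have "longest_perm (Suc 0) 1 - 1 = 0" by (simp add: longest_perm_def)
  ultimately show ?case using grothendieck_first_longest [of 0] by simp
next
  case (Suc n u)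
  let ?N = "Suc (Suc n)"
  show ?case using Suc.prems
  proof (induction "?N * ?N - card (inversions ?N u)" arbitrary: u rule: less_induct)
    case less
    note u = less.prems(1) and ok = less.prems(2)
    have inj: "inj u" using u by (rule permutes_inj)
    have rng: "u j \<in> {1..?N}" if "j \<in> {1..?N}" for j using permutes_in_image [OF u] that by blast
    have dec: "?N * ?N - card (inversions ?N (u \<circ> transpose i (Suc i)))
        < ?N * ?N - card (inversions ?N u)" if "1 \<le> i" "i < ?N" "u i < u (Suc i)" for i
      using card_inversions_ascent [of i ?N u, OF that]
        card_inversions_le [of ?N "u \<circ> transpose i (Suc i)"] by simp
    show ?case
    proof (cases "\<exists>i\<ge>1. Suc i < ?N \<and> u (Suc i) < u (Suc (Suc i)) \<and> u (Suc i) < u 1")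
      case True
      then obtain i where i: "1 \<le> i" "Suc i < ?N" "u (Suc i) < u (Suc (Suc i))" "u (Suc i) < u 1"
        by blast
      let ?v = "u \<circ> transpose (Suc i) (Suc (Suc i))"
      have v: "?v permutes {1..?N}" using u i by (intro permutes_comp_transpose) auto
      have v1: "?v 1 = u 1" using i by (simp add: transpose_def)
      have "?v a < ?v b" if ab: "1 < a" "a < b" "b \<le> ?N" "u 1 < ?v a" "u 1 < ?v b" for a b
      proof -
        \<comment> \<open>Only this pair changes its order, and its second value in
          \<open>?v\<close> is now the one below u(1).\<close>
        have "\<not> (a = Suc i \<and> b = Suc (Suc i))" using ab i by auto
        then have "transpose (Suc i) (Suc (Suc i)) a < transpose (Suc i) (Suc (Suc i)) b"
          "1 < transpose (Suc i) (Suc (Suc i)) a" "transpose (Suc i) (Suc (Suc i)) b \<le> ?N"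
          using ab i by (auto simp: transpose_def)
        then show ?thesis using ok ab by (simp add: avoids_132_at_first_def)
      qed
      then have vok: "avoids_132_at_first ?N ?v" unfolding avoids_132_at_first_def v1 by blast
      let ?y = "drop_at (Suc n) 1 u"
      have y: "?y permutes {1..Suc n}" using u by (rule drop_at_permutes) auto
      have asc: "?y i < ?y (Suc i)" using i by (subst drop_at_less_iff [OF inj]) auto
      have "grothendieck ?N u = isobaric_div_diff (Suc i) (grothendieck ?N ?v)"
        by (rule grothendieck_ascent [OF u]) (use i in auto)
      also have "grothendieck ?N ?v
          = xvar 1 ^ (u 1 - 1) * shift (grothendieck (Suc n) (?y \<circ> transpose i (Suc i)))"
        using less.hyps [OF dec v vok] i v1 drop_at_1_comp_transpose [of i "Suc n" u] by simp
      also have "isobaric_div_diff (Suc i) \<dots> =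
          xvar 1 ^ (u 1 - 1) * isobaric_div_diff (Suc i) (shift (grothendieck (Suc n) (?y \<circ> transpose i (Suc i))))"
        by (rule isobaric_mult_sym) (use i in \<open>simp add: swap_vars_power\<close>)
      also have "\<dots> = xvar 1 ^ (u 1 - 1) * shift (grothendieck (Suc n) ?y)"
        unfolding isobaric_Suc_shift using grothendieck_ascent [OF y _ _ asc] i by simp
      finally show ?thesis .
    next
      case False
      then have desc: "u (Suc (Suc i)) < u (Suc i)"
        if "1 \<le> i" "Suc i < ?N" "u (Suc i) < u 1" for i
      proof -
        have "\<not> u (Suc i) < u (Suc (Suc i))" using False that by blast
        moreover have "u (Suc i) \<noteq> u (Suc (Suc i))" using inj by (simp add: inj_eq)
        ultimately show ?thesis by linarith
      qed
      show ?thesis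
      proof (cases "u 1 = ?N")
        case True
        have lt: "u j < u 1" if "1 < j" "j \<le> ?N" for j
        proof -
          have "u j \<noteq> u 1" using inj that by (auto simp: inj_eq)
          then show ?thesis using rng [of j] that True by auto
        qed
        have "u (Suc i) < u i" if "1 \<le> i" "i < ?N" for i
        proof (cases "i = 1")
          case False
          then show ?thesis using desc [of "i - 1"] lt [of i] that by auto
        qed (use lt [of 2] in \<open>simp add: numeral_2_eq_2\<close>)
        then have ul: "u = longest_perm ?N" by (rule no_ascent_imp_longest [OF u])
        have "drop_at (Suc n) 1 u = longest_perm (Suc n)"
          unfolding ul by (auto simp: drop_at_def longest_perm_def fun_eq_iff Let_def)
        then show ?thesis using grothendieck_first_longest [of "Suc n"] True ul by simp
      next
        case False
        then have "Suc (u 1) \<in> {1..?N}" using rng [of 1] by auto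
        then obtain p where p: "p \<in> {1..?N}" "u p = Suc (u 1)"
          using permutes_image [OF u] by (metis imageE)
        then have p1: "p > 1" by (cases "p = 1") auto
        \<comment> \<open>Otherwise the descents in \<open>desc\<close> propagate from position 2 to
          the end, and all later values are below u(1), although u(1) + 1 has to occur.\<close>
        have u2: "u 2 > u 1"
        proof (rule ccontr)
          assume "\<not> u 2 > u 1"
          moreover have "u 2 \<noteq> u 1" using inj by (simp add: inj_eq)
          ultimately have *: "u 2 < u 1" by simp
          have "u (Suc (Suc j)) < u 1" if "Suc (Suc j) \<le> ?N" for j
            using that
          proof (induction j)
            case 0
            then show ?case using * by (simp add: numeral_2_eq_2)
          next
            case (Suc j)
            then show ?case using desc [of "Suc j"] by simp
          qed
          from this [of "p - 2"] p p1 show False by (simp add: Suc_diff_Suc numeral_2_eq_2)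
        qed
        \<comment> \<open>The values above u(1) appear in increasing order, so the first of them is
          the smallest.\<close>
        have "u 2 = Suc (u 1)"
        proof (cases "p = 2")
          case False
          then have "2 < p" using p1 by simp
          then have "u 2 < u p" using ok [unfolded avoids_132_at_first_def, rule_format, of 2 p] u2 p by simp
          then show ?thesis using p u2 by simp
        qed (use p in simp)
        then have u2': "u (Suc 1) = Suc (u 1)" by (simp add: numeral_2_eq_2)
        let ?v = "u \<circ> transpose 1 (Suc 1)"
        let ?y = "drop_at (Suc n) 1 u"
        have v: "?v permutes {1..?N}" using u by (intro permutes_comp_transpose) auto
        have v1: "?v 1 = Suc (u 1)" using u2' by simp
        have "?v a < ?v b" if ab: "1 < a" "a < b" "b \<le> ?N" "Suc (u 1) < ?v a" "Suc (u 1) < ?v b" for a b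
        proof -
          have "a \<noteq> Suc 1" using ab by auto
          then have "?v a = u a" "?v b = u b" using ab by (auto simp: transpose_def)
          then show ?thesis using ok ab by (simp add: avoids_132_at_first_def)
        qed
        then have vok: "avoids_132_at_first ?N ?v" unfolding avoids_132_at_first_def v1 by blast
        \<comment> \<open>u(1) and u(2) are adjacent with consecutive values, so deleting either
          leaves the same standardized word.\<close>
        have vy: "drop_at (Suc n) 1 ?v = ?y"
        proof -
          have "drop_at (Suc n) (Suc 1) u i = ?y i" for i
          proof (cases "i = 1")
            case True
            then show ?thesis using u2' by (simp add: drop_at_def Let_def)
          next
            case False
            have "u (Suc i) \<noteq> u 1" if "i > 0" using inj that by (simp add: inj_eq)
            moreover have "u (Suc i) \<noteq> u (Suc 1)" using inj False by (simp add: inj_eq)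
            ultimately show ?thesis using False u2' by (auto simp: drop_at_def Let_def)
          qed
          then show ?thesis using drop_at_comp_transpose [of 1 "Suc n" u] by auto
        qed
        have y: "?y permutes {1..Suc n}" using u by (rule drop_at_permutes) auto
        have y1: "?y 1 = u 1" using u2' by (simp add: drop_at_def Let_def)
        have yok: "avoids_132_at_first (Suc n) ?y"
          unfolding avoids_132_at_first_def
        proof (intro allI impI)
          fix a b assume ab: "1 < a \<and> a < b \<and> b \<le> Suc n \<and> ?y 1 < ?y a \<and> ?y 1 < ?y b"
          then have "u (Suc 1) < u (Suc a)" "u (Suc 1) < u (Suc b)"
            using drop_at_less_iff [OF inj, of 1 "Suc n" a 1] drop_at_less_iff [OF inj, of 1 "Suc n" b 1]
            by auto
          then have "u (Suc a) < u (Suc b)" using ok ab u2' by (auto simp: avoids_132_at_first_def)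
          then show "?y a < ?y b" using ab by (subst drop_at_less_iff [OF inj]) auto
        qed
        define H where "H = grothendieck n (drop_at n 1 ?y)"
        \<comment> \<open>\<open>?y\<close> has the same first value as \<open>u\<close>. After the
          shift this yields x_2^(u(1)-1), which makes the power of x_1 symmetric up to one factor
          x_1.\<close>
        have Gy: "grothendieck (Suc n) ?y = xvar 1 ^ (u 1 - 1) * shift H"
          using Suc.IH [OF y yok] y1 by (simp add: H_def)
        have "drop_at n 1 ?y permutes {1..n}" using y by (rule drop_at_permutes) auto
        then have "H \<in> range shift" unfolding H_def by (rule grothendieck_in_range_shift)
        then have Hs: "swap_vars (Suc 0) (shift (shift H)) = shift (shift H)"
          unfolding swap_vars_Suc_shift using swap_vars_0_shift_shift by auto
        have "u 1 > 0" using rng [of 1] by auto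
        then have pw: "xvar 1 ^ u 1 = xvar 1 ^ (u 1 - 1) * xvar 1 ^ Suc 0"
          by (simp add: power_Suc2 [symmetric] del: power_Suc)
        have s: "swap_vars 1 ((xvar 1 * xvar (Suc 1)) ^ (u 1 - 1) * shift (shift H))
            = (xvar 1 * xvar (Suc 1)) ^ (u 1 - 1) * shift (shift H)"
          using Hs by (simp add: swap_vars_mult swap_vars_power mult.commute)
        have "grothendieck ?N u = isobaric_div_diff 1 (grothendieck ?N ?v)"
          by (rule grothendieck_ascent [OF u]) (use u2' in auto)
        also have "grothendieck ?N ?v = xvar 1 ^ u 1 * shift (grothendieck (Suc n) ?y)"
          using less.hyps [OF dec v vok] u2' v1 vy by simp
        also have "\<dots> = ((xvar 1 * xvar (Suc 1)) ^ (u 1 - 1) * shift (shift H)) * xvar 1 ^ Suc 0"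
          unfolding Gy pw by (simp add: shift_mult shift_power power_mult_distrib ac_simps)
        also have "isobaric_div_diff 1 \<dots> = (xvar 1 * xvar (Suc 1)) ^ (u 1 - 1) * shift (shift H)"
          unfolding isobaric_mult_sym [OF s] isobaric_power by (simp add: iso_sum_def sym_sum_def)
        also have "\<dots> = xvar 1 ^ (u 1 - 1) * shift (grothendieck (Suc n) ?y)"
          unfolding Gy by (simp add: shift_mult shift_power power_mult_distrib ac_simps)
        finally show ?thesis .
      qed
    qed
  qed
qed

text \<open>Undoes the move of the value to the front one position at a time. Each step keeps the
  word with this value deleted, and hence \<open>rs\<close>. The row length is the value minus its
  position, so it falls by one while the flag rises by one, as in
  \<open>flag_poly_step\<close>.\<close>

lemma grothendieck_insert_row:
  assumes "w permutes {1..Suc n}" "t \<le> n"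
    and "\<And>i. 1 \<le> i \<Longrightarrow> i \<le> t \<Longrightarrow> w i < w (Suc i)"
    and "\<And>a b. Suc t < a \<Longrightarrow> a < b \<Longrightarrow> b \<le> Suc n \<Longrightarrow> w (Suc t) < w a \<Longrightarrow> w (Suc t) < w b \<Longrightarrow> w a < w b"
    and "grothendieck n (drop_at n (Suc t) w) = flag_poly rs" "flag_ok rs"
    and "case rs of [] \<Rightarrow> True | (b, v) # _ \<Rightarrow> b \<le> w (Suc t) - Suc t \<and> t \<le> Suc v"
  shows "grothendieck (Suc n) w = flag_poly ((w (Suc t) - Suc t, t) # rs)"
  using assms
proof (induction t arbitrary: w)
  case 0
  have "avoids_132_at_first (Suc n) w" using 0(4) by (auto simp: avoids_132_at_first_def)
  then have "grothendieck (Suc n) w = xvar 1 ^ (w 1 - 1) * shift (flag_poly rs)"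
    using grothendieck_first [OF 0(1)] 0(5) by simp
  also have "\<dots> = flag_poly ((w 1 - 1, 0) # rs)"
    by (rule flag_poly_base [symmetric]) (use 0(7) in \<open>auto split: list.split\<close>)
  finally show ?case by simp
next
  case (Suc t w)
  let ?v = "w \<circ> transpose (Suc t) (Suc (Suc t))"
  note w = Suc.prems(1) and inc = Suc.prems(3)
  have v: "?v permutes {1..Suc n}" using w Suc.prems(2) by (intro permutes_comp_transpose) auto
  have v1: "?v (Suc t) = w (Suc (Suc t))" "?v (Suc (Suc t)) = w (Suc t)" by simp_all
  have vo: "?v j = w j" if "j \<noteq> Suc t" "j \<noteq> Suc (Suc t)" for j
    using that by (simp add: transpose_def)
  have asc: "w (Suc t) < w (Suc (Suc t))" using inc [of "Suc t"] by simp
  \<comment> \<open>The increasing start keeps the subtractions in the row lengths from being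
    truncated.\<close>
  have ge: "j \<le> w j" if "1 \<le> j" "j \<le> Suc (Suc t)" for j
    using that
  proof (induction j)
    case (Suc j)
    show ?case
    proof (cases "j = 0")
      case True
      have "w 1 \<in> {1..Suc n}" using permutes_in_image [OF w, of 1] by simp
      then show ?thesis using True by simp
    next
      case False
      then show ?thesis using Suc inc [of j] by simp
    qed
  qed simp
  let ?a = "w (Suc (Suc t)) - Suc (Suc t)"
  have a: "w (Suc (Suc t)) - Suc t = Suc ?a" using ge [of "Suc (Suc t)"] by simp
  have "grothendieck (Suc n) ?v = flag_poly ((?v (Suc t) - Suc t, t) # rs)"
  proof (rule Suc.IH [OF v])
    show "?v i < ?v (Suc i)" if "1 \<le> i" "i \<le> t" for i
    proof (cases "i = t")
      case True
      then show ?thesis using inc [of t] asc that vo [of t] by simp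
    next
      case False
      then show ?thesis using inc [of i] that vo [of i] vo [of "Suc i"] by simp
    qed
    show "?v a < ?v b" if "Suc t < a" "a < b" "b \<le> Suc n" "?v (Suc t) < ?v a" "?v (Suc t) < ?v b" for a b
    proof -
      have "a \<noteq> Suc (Suc t)" using that asc by auto
      then show ?thesis using that Suc.prems(4) [of a b] vo [of a] vo [of b] v1 by simp
    qed
    show "grothendieck n (drop_at n (Suc t) ?v) = flag_poly rs"
      using Suc.prems(2,5) drop_at_comp_transpose [of "Suc t" n w] by simp
    show "case rs of [] \<Rightarrow> True | (b, v) # _ \<Rightarrow> b \<le> ?v (Suc t) - Suc t \<and> t \<le> Suc v"
      using Suc.prems(7) a by (auto split: list.splits)
  qed (use Suc.prems in auto)
  then have Gv: "grothendieck (Suc n) ?v = flag_poly ((Suc ?a, t) # rs)" by (simp add: a)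
  have "grothendieck (Suc n) w = isobaric_div_diff (Suc t) (grothendieck (Suc n) ?v)"
    by (rule grothendieck_ascent [OF w]) (use asc Suc.prems(2) in auto)
  also have "\<dots> = flag_poly ((?a, Suc t) # rs)"
    unfolding Gv by (rule flag_poly_step [OF Suc.prems(6)]) (use Suc.prems(7) in \<open>auto split: list.splits\<close>)
  finally show ?case .
qed

text \<open>The default is the last position \<open>n\<close>; without a descent the permutation is
  the identity and its first row is empty.\<close>

definition first_descent :: "nat \<Rightarrow> (nat \<Rightarrow> nat) \<Rightarrow> nat"
  where "first_descent n w = (LEAST m. 1 \<le> m \<and> (n \<le> m \<or> w (Suc m) < w m))"

lemma first_descent:
  assumes "n \<ge> 1"
  shows "1 \<le> first_descent n w" "first_descent n w \<le> n"
    "first_descent n w < n \<Longrightarrow> w (Suc (first_descent n w)) < w (first_descent n w)"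
    "inj w \<Longrightarrow> 1 \<le> i \<Longrightarrow> i < first_descent n w \<Longrightarrow> w i < w (Suc i)"
proof -
  let ?P = "\<lambda>m. 1 \<le> m \<and> (n \<le> m \<or> w (Suc m) < w m)"
  have Pn: "?P n" using assms by simp
  have P: "?P (first_descent n w)" unfolding first_descent_def by (rule LeastI [of ?P, OF Pn])
  then show "1 \<le> first_descent n w"
    "first_descent n w < n \<Longrightarrow> w (Suc (first_descent n w)) < w (first_descent n w)" by auto
  show "first_descent n w \<le> n" unfolding first_descent_def by (rule Least_le [of ?P, OF Pn])
  assume i: "inj w" "1 \<le> i" "i < first_descent n w"
  then have "\<not> ?P i" unfolding first_descent_def by (intro not_less_Least)
  moreover have "w (Suc i) \<noteq> w i" using i(1) by (simp add: inj_eq)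
  ultimately show "w i < w (Suc i)" using i(2) by auto
qed

lemma vexillary_drop_at:
  assumes "inj w" "vexillary (Suc n) w"
  shows "vexillary n (drop_at n m w)"
  unfolding vexillary_def
proof
  let ?s = "\<lambda>i. if i < m then i else Suc i"
  assume "\<exists>a b c d. 1 \<le> a \<and> a < b \<and> b < c \<and> c < d \<and> d \<le> n \<and>
    drop_at n m w b < drop_at n m w a \<and> drop_at n m w a < drop_at n m w d \<and>
    drop_at n m w d < drop_at n m w c"
  then obtain a b c d where *: "1 \<le> a" "a < b" "b < c" "c < d" "d \<le> n"
    "w (?s b) < w (?s a)" "w (?s a) < w (?s d)" "w (?s d) < w (?s c)"
    using drop_at_less_iff [OF assms(1)]
    by (smt (verit, best) le_trans less_imp_le_nat)
  then have "1 \<le> ?s a" "?s a < ?s b" "?s b < ?s c" "?s c < ?s d" "?s d \<le> Suc n" by auto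
  with * assms(2) show False unfolding vexillary_def by blast
qed

text \<open>The row length w(m) - m is the Lehmer code at the first descent m, since exactly the m -
  1 earlier values among those below w(m) precede it. The first row is named in the statement
  because the induction step has to compare it with the new row for \<open>flag_ok\<close>.\<close>

lemma vexillary_grothendieck:
  assumes "w permutes {1..n}" "vexillary n w"
  shows "\<exists>rs. grothendieck n w = flag_poly rs \<and> flag_ok rs \<and> (n = 0 \<longrightarrow> rs = []) \<and>
    (0 < n \<longrightarrow> (\<exists>rs'. rs = (w (first_descent n w) - first_descent n w, first_descent n w - 1) # rs'))"
  using assms
proof (induction n arbitrary: w)
  case (0 w)
  then have "w = longest_perm 0" by (auto simp: fun_eq_iff longest_perm_def)
  then have "grothendieck 0 w = flag_poly []"
    by (simp add: grothendieck_longest flag_poly_def)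
  then show ?case by (intro exI [of _ "[]"]) simp
next
  case (Suc n w)
  note perm = Suc.prems(1)
  have inj: "inj w" using perm by (rule permutes_inj)
  define m where "m = first_descent (Suc n) w"
  have m: "1 \<le> m" "m \<le> Suc n" and desc: "m < Suc n \<Longrightarrow> w (Suc m) < w m"
    and inc: "\<And>i. 1 \<le> i \<Longrightarrow> i < m \<Longrightarrow> w i < w (Suc i)"
    using first_descent [of "Suc n" w] inj by (auto simp: m_def)
  have mono: "w i < w j" if "1 \<le> i" "i < j" "j \<le> m" for i j
    using that(2,3)
  proof (induction j)
    case (Suc j)
    then show ?case using inc [of j] that(1) by (cases "i = j") auto
  qed simp
  \<comment> \<open>A violation would be a pattern 2143 at the positions m, m + 1, a, b.\<close>
  have tail: "w a < w b" if "m < a" "a < b" "b \<le> Suc n" "w m < w a" "w m < w b" for a b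
  proof (rule ccontr)
    assume "\<not> w a < w b"
    moreover have "w a \<noteq> w b" using inj that by (auto simp: inj_eq)
    ultimately have ab: "w b < w a" by simp
    have d: "w (Suc m) < w m" using desc that by simp
    then have "Suc m \<noteq> a" using that by auto
    then have "Suc m < a" using that by simp
    then show False using Suc.prems(2) m ab d that unfolding vexillary_def by blast
  qed
  let ?y = "drop_at n m w"
  have y: "?y permutes {1..n}" using Suc.prems(1) m by (rule drop_at_permutes)
  obtain rs where rs: "grothendieck n ?y = flag_poly rs" "flag_ok rs" "n = 0 \<Longrightarrow> rs = []"
    "0 < n \<Longrightarrow> (\<exists>rs'. rs = (?y (first_descent n ?y) - first_descent n ?y, first_descent n ?y - 1) # rs')"
    using Suc.IH [OF y vexillary_drop_at [OF inj Suc.prems(2)]] by blast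
  have hd: "case rs of [] \<Rightarrow> True | (b, v) # _ \<Rightarrow> b \<le> w m - m \<and> m - 1 \<le> Suc v"
  proof (cases "n = 0")
    case False
    then have n: "1 \<le> n" by simp
    define k where "k = first_descent n ?y"
    have injy: "inj ?y" using y by (rule permutes_inj)
    have k: "1 \<le> k" "k \<le> n" and ydesc: "k < n \<Longrightarrow> ?y (Suc k) < ?y k"
      and yinc: "\<And>i. 1 \<le> i \<Longrightarrow> i < k \<Longrightarrow> ?y i < ?y (Suc i)"
      using first_descent [OF n, of ?y] injy by (auto simp: k_def)
    \<comment> \<open>The ascents among the positions before m survive the deletion.\<close>
    have mk: "m - 1 \<le> k"
    proof (rule ccontr)
      assume c: "\<not> m - 1 \<le> k"
      then have "?y (Suc k) < ?y k" using ydesc m by simp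
      moreover have "?y k < ?y (Suc k)"
        using c k m inc [of k] by (subst drop_at_less_iff [OF inj]) auto
      ultimately show False by simp
    qed
    have "?y k - k \<le> w m - m"
    proof (cases "k = m - 1")
      case True
      then have "?y k = (if w k < w m then w k else w k - 1)" using k m by (simp add: drop_at_def Let_def)
      moreover have "w k < w m" using mono [of k m] k m True by auto
      ultimately show ?thesis using True k by simp
    next
      case False
      then have km: "m \<le> k" using mk by simp
      have yk: "?y k = (if w (Suc k) < w m then w (Suc k) else w (Suc k) - 1)"
        using k km by (simp add: drop_at_def Let_def)
      show ?thesis
      proof (cases "w (Suc k) < w m")
        case True
        then show ?thesis using yk km by simp
      next
        case False
        moreover have "w (Suc k) \<noteq> w m" using inj km by (auto simp: inj_eq)
        ultimately have gt: "w m < w (Suc k)" by simp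
        \<comment> \<open>Values above w(m) do not occur before m, and after m they increase. So all
          values up to w(k+1) are taken by position k + 1, which bounds w(k+1) - w(m) by k + 1 -
          m.\<close>
        have "{w m<..w (Suc k)} \<subseteq> w ` {m<..Suc k}"
        proof
          fix x assume x: "x \<in> {w m<..w (Suc k)}"
          have "w (Suc k) \<in> {1..Suc n}" using permutes_in_image [OF Suc.prems(1)] k by auto
          then have "x \<in> {1..Suc n}" using x by auto
          then obtain p where p: "p \<in> {1..Suc n}" "x = w p"
            using permutes_image [OF Suc.prems(1)] by (metis imageE)
          have "\<not> p < m" using mono [of p m] p x by auto
          moreover have "p \<noteq> m" using p x by auto
          moreover have "\<not> Suc k < p" using tail [of "Suc k" p] p x gt km by auto
          ultimately show "x \<in> w ` {m<..Suc k}" using p by auto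
        qed
        then have "card {w m<..w (Suc k)} \<le> card {m<..Suc k}"
          using surj_card_le by blast
        then have "w (Suc k) - w m \<le> Suc k - m" by simp
        moreover have "m \<le> w m"
        proof -
          have "j \<le> w j" if "1 \<le> j" "j \<le> m" for j
            using that
          proof (induction j)
            case (Suc j)
            show ?case
            proof (cases "j = 0")
              case True
              have "w 1 \<in> {1..Suc n}" using permutes_in_image [OF perm] by auto
              then show ?thesis using True by simp
            next
              case False
              then show ?thesis using Suc inc [of j] by simp
            qed
          qed simp
          then show ?thesis using m by simp
        qed
        ultimately show ?thesis using yk gt by simp
      qed
    qed
    moreover have "m - 1 \<le> Suc (k - 1)" using mk k by simp
    ultimately show ?thesis using rs(4) n by (auto simp: k_def)
  qed (use rs(3) in simp)
  have e: "Suc (m - 1) = m" using m by simp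
  have "grothendieck (Suc n) w = flag_poly ((w m - m, m - 1) # rs)"
    by (rule grothendieck_insert_row [of w n "m - 1" rs, unfolded e])
      (use perm m inc tail rs(1,2) hd in auto)
  moreover have "flag_ok ((w m - m, m - 1) # rs)"
    using hd rs(2) by (cases rs) auto
  ultimately show ?case using m by (intro exI [of _ "(w m - m, m - 1) # rs"]) (simp add: m_def)
qed

section \<open>Supports without cancellation, described by patterns\<close>

section \<open>Supports\<close>

lemma monom_deg_superset:
  assumes "finite A" "Poly_Mapping.keys m \<subseteq> A"
  shows "monom_deg m = (\<Sum>i\<in>A. Poly_Mapping.lookup m i)"
  unfolding monom_deg_def
  by (rule sum.mono_neutral_left) (use assms in \<open>auto simp: in_keys_iff\<close>)

lemma monom_deg_0 [simp]: "monom_deg 0 = 0"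
  by (simp add: monom_deg_def)

lemma monom_deg_add: "monom_deg (m + m') = monom_deg m + monom_deg m'"
proof -
  let ?A = "Poly_Mapping.keys m \<union> Poly_Mapping.keys m'"
  have "Poly_Mapping.keys (m + m') \<subseteq> ?A" by (rule Poly_Mapping.keys_add)
  then show ?thesis
    using monom_deg_superset [of ?A] by (simp add: lookup_add sum.distrib)
qed

lemma monom_deg_single [simp]: "monom_deg (Poly_Mapping.single i k) = k"
  by (simp add: monom_deg_superset [of "{i}"])

lemma monom_deg_shift_monom [simp]: "monom_deg (shift_monom m) = monom_deg m"
proof -
  have "Poly_Mapping.keys (shift_monom m) \<subseteq> Suc ` Poly_Mapping.keys m"
  proof
    fix k assume "k \<in> Poly_Mapping.keys (shift_monom m)"
    then show "k \<in> Suc ` Poly_Mapping.keys m" by (cases k) (auto simp: in_keys_iff)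
  qed
  then have "monom_deg (shift_monom m)
      = (\<Sum>i\<in>Suc ` Poly_Mapping.keys m. Poly_Mapping.lookup (shift_monom m) i)"
    by (intro monom_deg_superset) auto
  then show ?thesis by (simp add: sum.reindex monom_deg_def)
qed

text \<open>With signs determined by the degree, nothing cancels: the support of a sum is the union
  and that of a product the sumset.\<close>

definition signed :: "nat \<Rightarrow> int_mpoly \<Rightarrow> bool"
  where "signed d p \<longleftrightarrow> (\<forall>m. 0 \<le> (- 1) ^ (d + monom_deg m) * Poly_Mapping.lookup p m)"

lemma signed_0 [simp]: "signed d 0"
  by (simp add: signed_def)

lemma signed_sum:
  assumes "finite A" "\<And>a. a \<in> A \<Longrightarrow> signed d (p a)"
  shows "signed d (sum p A)"
    and "Poly_Mapping.keys (sum p A) = (\<Union>a\<in>A. Poly_Mapping.keys (p a))"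
proof -
  have eq: "(- 1) ^ (d + monom_deg m) * Poly_Mapping.lookup (sum p A) m
      = (\<Sum>a\<in>A. (- 1) ^ (d + monom_deg m) * Poly_Mapping.lookup (p a) m)" for m
    by (simp add: lookup_sum sum_distrib_left)
  have nn: "0 \<le> (- 1) ^ (d + monom_deg m) * Poly_Mapping.lookup (p a) m" if "a \<in> A" for a m
    using assms(2) [OF that] by (simp add: signed_def)
  show "signed d (sum p A)"
    unfolding signed_def eq using nn by (intro allI sum_nonneg)
  show "Poly_Mapping.keys (sum p A) = (\<Union>a\<in>A. Poly_Mapping.keys (p a))"
  proof (rule set_eqI)
    fix m
    have "m \<notin> Poly_Mapping.keys (sum p A)
        \<longleftrightarrow> (- 1) ^ (d + monom_deg m) * Poly_Mapping.lookup (sum p A) m = 0"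
      by (simp add: in_keys_iff)
    also have "\<dots> \<longleftrightarrow> (\<forall>a\<in>A. (- 1) ^ (d + monom_deg m) * Poly_Mapping.lookup (p a) m = 0)"
      unfolding eq using assms(1) nn by (intro sum_nonneg_eq_0_iff) auto
    also have "\<dots> \<longleftrightarrow> (\<forall>a\<in>A. m \<notin> Poly_Mapping.keys (p a))" by (simp add: in_keys_iff)
    finally show "m \<in> Poly_Mapping.keys (sum p A) \<longleftrightarrow> m \<in> (\<Union>a\<in>A. Poly_Mapping.keys (p a))" by auto
  qed
qed

lemma poly_as_sum:
  fixes p :: int_mpoly
  shows "p = (\<Sum>m\<in>Poly_Mapping.keys p. Poly_Mapping.single m (Poly_Mapping.lookup p m))"
  by (rule poly_mapping_eqI) (auto simp: lookup_sum lookup_single when_def in_keys_iff)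

lemma signed_mult:
  assumes "signed d p" "signed e q"
  shows "signed (d + e) (p * q)"
    and "Poly_Mapping.keys (p * q) = {m + m' |m m'. m \<in> Poly_Mapping.keys p \<and> m' \<in> Poly_Mapping.keys q}"
proof -
  let ?P = "\<lambda>(m, m'). Poly_Mapping.single (m + m') (Poly_Mapping.lookup p m * Poly_Mapping.lookup q m')"
  let ?A = "Poly_Mapping.keys p \<times> Poly_Mapping.keys q"
  have "p * q = (\<Sum>m\<in>Poly_Mapping.keys p. \<Sum>m'\<in>Poly_Mapping.keys q. ?P (m, m'))"
    by (subst (1) poly_as_sum [of p], subst (1) poly_as_sum [of q])
      (simp add: sum_product mult_single)
  then have eq: "p * q = sum ?P ?A" by (simp add: sum.cartesian_product)
  have s: "signed (d + e) (?P x)" if "x \<in> ?A" for x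
  proof -
    obtain m m' where x: "x = (m, m')" by (cases x)
    have "0 \<le> ((- 1) ^ (d + monom_deg m) * Poly_Mapping.lookup p m)
        * ((- 1) ^ (e + monom_deg m') * Poly_Mapping.lookup q m')"
      by (rule mult_nonneg_nonneg) (use assms in \<open>simp_all add: signed_def\<close>)
    then show ?thesis
      by (auto simp: signed_def x lookup_single when_def monom_deg_add power_add ac_simps)
  qed
  show "signed (d + e) (p * q)" unfolding eq using s by (intro signed_sum) auto
  have "Poly_Mapping.keys (sum ?P ?A) = (\<Union>x\<in>?A. Poly_Mapping.keys (?P x))"
    using s by (intro signed_sum(2)) auto
  also have "\<dots> = (\<Union>x\<in>?A. {fst x + snd x})"
    by (rule SUP_cong) (auto simp: in_keys_iff)
  also have "\<dots> = {m + m' |m m'. m \<in> Poly_Mapping.keys p \<and> m' \<in> Poly_Mapping.keys q}"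
    by auto blast
  finally show "Poly_Mapping.keys (p * q) = \<dots>" unfolding eq .
qed

lemma signed_1 [simp]: "signed 0 1"
  using power_add [of "-1 :: int"] by (auto simp: signed_def lookup_one when_def)

lemma signed_prod:
  assumes "finite A" "\<And>a. a \<in> A \<Longrightarrow> signed (d a) (p a)"
  shows "signed (sum d A) (prod p A)" (is ?S)
    and "Poly_Mapping.keys (prod p A) = {sum g A |g. \<forall>a\<in>A. g a \<in> Poly_Mapping.keys (p a)}" (is ?K)
proof -
  have "?S \<and> ?K"
    using assms
  proof (induction A rule: finite_induct)
    case (insert x A)
    then have IH: "signed (sum d A) (prod p A)"
      "Poly_Mapping.keys (prod p A) = {sum g A |g. \<forall>a\<in>A. g a \<in> Poly_Mapping.keys (p a)}"
      and x: "signed (d x) (p x)" by auto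
    have "Poly_Mapping.keys (p x * prod p A)
        = {m + m' |m m'. m \<in> Poly_Mapping.keys (p x) \<and> m' \<in> Poly_Mapping.keys (prod p A)}"
      by (rule signed_mult(2) [OF x IH(1)])
    also have "\<dots> = {sum g (insert x A) |g. \<forall>a\<in>insert x A. g a \<in> Poly_Mapping.keys (p a)}"
    proof (intro equalityI subsetI)
      fix f assume "f \<in> {m + m' |m m'. m \<in> Poly_Mapping.keys (p x) \<and> m' \<in> Poly_Mapping.keys (prod p A)}"
      then obtain m g where *: "f = m + sum g A" "m \<in> Poly_Mapping.keys (p x)"
        "\<forall>a\<in>A. g a \<in> Poly_Mapping.keys (p a)" unfolding IH(2) by auto
      have "sum (g(x := m)) A = sum g A" using insert by (intro sum.cong) auto
      then have "f = sum (g(x := m)) (insert x A)" using * insert by simp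
      moreover have "\<forall>a\<in>insert x A. (g(x := m)) a \<in> Poly_Mapping.keys (p a)" using * by auto
      ultimately show "f \<in> {sum g (insert x A) |g. \<forall>a\<in>insert x A. g a \<in> Poly_Mapping.keys (p a)}"
        by blast
    next
      fix f assume "f \<in> {sum g (insert x A) |g. \<forall>a\<in>insert x A. g a \<in> Poly_Mapping.keys (p a)}"
      then show "f \<in> {m + m' |m m'. m \<in> Poly_Mapping.keys (p x) \<and> m' \<in> Poly_Mapping.keys (prod p A)}"
        unfolding IH(2) using insert by auto
    qed
    finally show ?case using signed_mult(1) [OF x IH(1)] insert by simp
  qed simp
  then show ?S ?K by auto
qed

lemma xvar_power_eq: "xvar i ^ k = Poly_Mapping.single (Poly_Mapping.single i k) 1"
  by (induction k) (simp_all add: xvar_def monom_poly_def mult_single single_add [symmetric])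

lemma signed_xvar_power: "signed k (xvar i ^ k)"
  by (auto simp: xvar_power_eq signed_def lookup_single when_def power_add [symmetric] mult_2 [symmetric])

lemma keys_xvar_power: "Poly_Mapping.keys (xvar i ^ k) = {Poly_Mapping.single i k}"
  by (simp add: xvar_power_eq)

lemma lookup_one_minus_xvar:
  "Poly_Mapping.lookup (1 - xvar i) m = (if m = 0 then 1 else if m = Poly_Mapping.single i 1 then - 1 else 0)"
proof -
  have "Poly_Mapping.single i (1::nat) \<noteq> 0"
    by (metis lookup_single_eq lookup_zero zero_neq_one)
  then show ?thesis
    by (auto simp: lookup_minus lookup_one xvar_def monom_poly_def lookup_single when_def)
qed

lemma signed_cap: "signed 0 (cap (xvar i) c d)"
  by (auto simp: cap_def signed_def lookup_one_minus_xvar lookup_one when_def)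

lemma keys_cap:
  "Poly_Mapping.keys (cap (xvar i) c d) = (if c < d then {} else if d < c
    then {0, Poly_Mapping.single i 1} else {0})"
  by (auto simp: cap_def in_keys_iff lookup_one_minus_xvar split: if_splits)

lemma lookup_shift:
  "Poly_Mapping.lookup (shift p) (shift_monom m) = Poly_Mapping.lookup p m"
  "m' \<notin> range shift_monom \<Longrightarrow> Poly_Mapping.lookup (shift p) m' = 0"
proof -
  have "Poly_Mapping.lookup (shift p) (shift_monom m) = Poly_Mapping.lookup p m \<and>
    (m' \<notin> range shift_monom \<longrightarrow> Poly_Mapping.lookup (shift p) m' = 0)"
  proof (induction p rule: frag_induction [OF subset_UNIV])
    case (2 x)
    then show ?case using inj_shift_monom by (auto simp: lookup_single when_def inj_eq)
  next
    case (3 a b)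
    then show ?case by (auto simp: shift_diff lookup_minus)
  qed simp
  then show "Poly_Mapping.lookup (shift p) (shift_monom m) = Poly_Mapping.lookup p m"
    "m' \<notin> range shift_monom \<Longrightarrow> Poly_Mapping.lookup (shift p) m' = 0" by auto
qed

lemma signed_shift: "signed d p \<Longrightarrow> signed d (shift p)"
  unfolding signed_def
proof
  fix m assume p: "\<forall>m. 0 \<le> (- 1) ^ (d + monom_deg m) * Poly_Mapping.lookup p m"
  show "0 \<le> (- 1) ^ (d + monom_deg m) * Poly_Mapping.lookup (shift p) m"
    using p by (cases "m \<in> range shift_monom") (auto simp: lookup_shift)
qed

lemma keys_shift: "Poly_Mapping.keys (shift p) = shift_monom ` Poly_Mapping.keys p"
proof (intro equalityI subsetI)
  fix m assume m: "m \<in> Poly_Mapping.keys (shift p)"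
  then have "m \<in> range shift_monom" using lookup_shift(2) [of m p] by (auto simp: in_keys_iff)
  then show "m \<in> shift_monom ` Poly_Mapping.keys p" using m by (auto simp: in_keys_iff lookup_shift)
qed (auto simp: in_keys_iff lookup_shift)

text \<open>Occurrences of the letter of level \<open>l\<close> in row \<open>r\<close> above row
  \<open>q\<close>: as a smallest entry and, if \<open>b\<close>, also as an extra letter wherever
  there is room for one. Thus \<open>b\<close> selects the lower or the upper monomial of a
  pattern.\<close>

definition cell :: "bool \<Rightarrow> (nat \<Rightarrow> nat) \<Rightarrow> (nat \<Rightarrow> nat) \<Rightarrow> nat \<Rightarrow> nat"
  where "cell b r q l = r (Suc l) - r l + (if b \<and> q l < r l then 1 else 0)"

text \<open>The exponent of x_k; in row \<open>i\<close> this letter has level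
  \<open>k - Suc i\<close>, and \<open>i < k\<close> guards the subtraction.\<close>

definition content :: "bool \<Rightarrow> nat \<Rightarrow> (nat \<Rightarrow> nat) \<Rightarrow> (nat \<Rightarrow> nat \<Rightarrow> nat) \<Rightarrow> nat \<Rightarrow> nat"
  where "content b n lev I k = (\<Sum>i<n. if i < k \<and> k - Suc i \<le> lev i
    then cell b (I i) (I (Suc i)) (k - Suc i) else 0)"

definition pattern :: "nat \<Rightarrow> (nat \<Rightarrow> nat) \<Rightarrow> (nat \<Rightarrow> nat) \<Rightarrow> (nat \<Rightarrow> nat \<Rightarrow> nat) \<Rightarrow> bool"
  where "pattern n len lev I \<longleftrightarrow> (\<forall>i<n. valid_row (len i) (lev i) (I i)) \<and>
    (\<forall>i\<ge>n. \<forall>l. I i l = 0) \<and> (\<forall>i l. I (Suc i) l \<le> I i l)"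

lemma content_0 [simp]: "content b n lev I 0 = 0"
  by (simp add: content_def)

lemma content_Suc:
  "content b (Suc n) lev I (Suc k) = (if k \<le> lev 0 then cell b (I 0) (I (Suc 0)) k else 0)
    + content b n (\<lambda>i. lev (Suc i)) (\<lambda>i. I (Suc i)) k"
  unfolding content_def sum.lessThan_Suc_shift diff_Suc_Suc by simp

abbreviation list_pattern :: "(nat \<times> nat) list \<Rightarrow> (nat \<Rightarrow> nat \<Rightarrow> nat) \<Rightarrow> bool"
  where "list_pattern rs \<equiv> pattern (length rs) (\<lambda>i. fst (rs ! i)) (\<lambda>i. snd (rs ! i))"

abbreviation list_content :: "bool \<Rightarrow> (nat \<times> nat) list \<Rightarrow> (nat \<Rightarrow> nat \<Rightarrow> nat) \<Rightarrow> nat \<Rightarrow> nat"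
  where "list_content b rs \<equiv> content b (length rs) (\<lambda>i. snd (rs ! i))"

text \<open>\<open>row_poly\<close> compares neighbouring rows only up to level \<open>v\<close>.
  Beyond it the upper row is full, and the lower row is not longer by
  \<open>flag_ok\<close>.\<close>

lemma list_pattern_Cons:
  assumes "flag_ok ((a, v) # rs)"
  shows "list_pattern ((a, v) # rs) I \<longleftrightarrow> valid_row a v (I 0) \<and> list_pattern rs (\<lambda>i. I (Suc i))
    \<and> (\<forall>l\<le>v. I (Suc 0) l \<le> I 0 l)" (is "?L \<longleftrightarrow> ?R")
proof
  show ?L if ?R
  proof -
    have "I (Suc 0) l \<le> I 0 l" for l
    proof (cases "l \<le> v")
      case False
      then have I0: "I 0 l = a" using that by (auto simp: valid_row_def)
      show ?thesis
      proof (cases rs)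
        case Nil
        then show ?thesis using that by (simp add: pattern_def)
      next
        case (Cons x rs')
        then have "valid_row (fst x) (snd x) (I (Suc 0))" using that by (auto simp: pattern_def)
        moreover have "fst x \<le> a" using assms Cons by (cases x) auto
        ultimately show ?thesis using valid_row_le I0 by (metis order_trans)
      qed
    qed (use that in simp)
    then have "I (Suc i) l \<le> I i l" for i l
      using that by (cases i) (auto simp: pattern_def)
    moreover have "I i l = 0" if "Suc (length rs) \<le> i" for i l
      using that \<open>?R\<close> by (cases i) (auto simp: pattern_def)
    moreover have "valid_row (fst (((a, v) # rs) ! i)) (snd (((a, v) # rs) ! i)) (I i)"
      if "i < Suc (length rs)" for i
      using that \<open>?R\<close> by (cases i) (auto simp: pattern_def)
    ultimately show ?thesis by (simp add: pattern_def)
  qed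
  show ?R if ?L
  proof -
    have "valid_row (fst (((a, v) # rs) ! i)) (snd (((a, v) # rs) ! i)) (I i)"
      if "i < Suc (length rs)" for i
      using that \<open>?L\<close> unfolding pattern_def by simp
    from this [of 0] this [of "Suc _"] show ?thesis
      using that unfolding pattern_def by auto
  qed
qed

lemma signed_row_factors:
  assumes "r \<in> rows ((a, v) # rs)"
  shows "signed a (\<Prod>l\<le>v. xvar (Suc l) ^ (r (Suc l) - r l))"
    and "signed 0 (\<Prod>l\<le>v. cap (xvar (Suc l)) (r l) (q l))"
proof -
  have r: "valid_row a v r" using assms by simp
  have "(\<Sum>l\<le>v. r (Suc l) - r l) = a"
  proof -
    have "(\<Sum>l<n. r (Suc l) - r l) = r n" for n
    proof (induction n)
      case (Suc n)
      then show ?case using r by (auto simp: valid_row_def)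
    qed (use r in \<open>simp add: valid_row_def\<close>)
    from this [of "Suc v"] show ?thesis using r by (simp add: lessThan_Suc_atMost valid_row_def)
  qed
  then show "signed a (\<Prod>l\<le>v. xvar (Suc l) ^ (r (Suc l) - r l))"
    using signed_prod(1) [of "{..v}" "\<lambda>l. r (Suc l) - r l" "\<lambda>l. xvar (Suc l) ^ (r (Suc l) - r l)"]
    by (simp add: signed_xvar_power)
  show "signed 0 (\<Prod>l\<le>v. cap (xvar (Suc l)) (r l) (q l))"
    using signed_prod(1) [of "{..v}" "\<lambda>l. 0" "\<lambda>l. cap (xvar (Suc l)) (r l) (q l)"]
    by (simp add: signed_cap)
qed

lemma signed_row_poly: "signed (sum_list (map fst rs)) (row_poly rs r)"
proof (induction rs arbitrary: r)
  case (Cons x rs)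
  obtain a v where x: "x = (a, v)" by (cases x)
  show ?case
  proof (cases "r \<in> rows ((a, v) # rs)")
    case True
    have "signed (0 + sum_list (map fst rs))
      ((\<Prod>l\<le>v. cap (xvar (Suc l)) (r l) (q l)) * shift (row_poly rs q))" for q
      by (intro signed_mult(1) signed_row_factors(2) [OF True] signed_shift Cons.IH)
    then have "signed (sum_list (map fst rs))
      (\<Sum>q\<in>rows rs. (\<Prod>l\<le>v. cap (xvar (Suc l)) (r l) (q l)) * shift (row_poly rs q))"
      by (intro signed_sum) auto
    from signed_mult(1) [OF signed_row_factors(1) [OF True] this] True show ?thesis
      by (simp add: x)
  qed (simp add: x)
qed simp

lemma keys_row_poly_Cons:
  assumes "r \<in> rows ((a, v) # rs)"
  shows "f \<in> Poly_Mapping.keys (row_poly ((a, v) # rs) r) \<longleftrightarrow>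
    (\<exists>q g h. q \<in> rows rs \<and> (\<forall>l\<le>v. g l \<in> Poly_Mapping.keys (cap (xvar (Suc l)) (r l) (q l))) \<and>
      h \<in> Poly_Mapping.keys (row_poly rs q) \<and>
      f = (\<Sum>l\<le>v. Poly_Mapping.single (Suc l) (r (Suc l) - r l)) + (sum g {..v} + shift_monom h))"
proof -
  let ?C = "\<lambda>q. \<Prod>l\<le>v. cap (xvar (Suc l)) (r l) (q l)"
  let ?s = "sum_list (map fst rs)"
  have s1: "signed (0 + ?s) (?C q * shift (row_poly rs q))" for q
    by (intro signed_mult(1) signed_row_factors(2) [OF assms] signed_shift signed_row_poly)
  then have s2: "signed ?s (\<Sum>q\<in>rows rs. ?C q * shift (row_poly rs q))"
    by (intro signed_sum) auto
  have k1: "Poly_Mapping.keys (?C q * shift (row_poly rs q)) =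
      {m + m' |m m'. m \<in> Poly_Mapping.keys (?C q) \<and> m' \<in> Poly_Mapping.keys (shift (row_poly rs q))}" for q
    by (rule signed_mult(2) [OF signed_row_factors(2) [OF assms] signed_shift [OF signed_row_poly]])
  have k2: "Poly_Mapping.keys (?C q)
      = {sum g {..v} |g. \<forall>l\<in>{..v}. g l \<in> Poly_Mapping.keys (cap (xvar (Suc l)) (r l) (q l))}" for q
    by (rule signed_prod(2)) (auto intro: signed_cap)
  have k3: "Poly_Mapping.keys (\<Sum>q\<in>rows rs. ?C q * shift (row_poly rs q))
      = (\<Union>q\<in>rows rs. Poly_Mapping.keys (?C q * shift (row_poly rs q)))"
    using s1 by (intro signed_sum(2) [of _ ?s]) auto
  have k4: "Poly_Mapping.keys (\<Prod>l\<le>v. xvar (Suc l) ^ (r (Suc l) - r l))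
      = {\<Sum>l\<le>v. Poly_Mapping.single (Suc l) (r (Suc l) - r l)}"
  proof -
    have "Poly_Mapping.keys (\<Prod>l\<le>v. xvar (Suc l) ^ (r (Suc l) - r l))
      = {sum g {..v} |g. \<forall>l\<in>{..v}. g l \<in> Poly_Mapping.keys (xvar (Suc l) ^ (r (Suc l) - r l))}"
      by (rule signed_prod(2)) (auto intro: signed_xvar_power)
    also have "\<dots> = {\<Sum>l\<le>v. Poly_Mapping.single (Suc l) (r (Suc l) - r l)}"
      by (auto simp: keys_xvar_power intro!: sum.cong)
    finally show ?thesis .
  qed
  have "Poly_Mapping.keys (row_poly ((a, v) # rs) r) =
      {m + m' |m m'. m \<in> Poly_Mapping.keys (\<Prod>l\<le>v. xvar (Suc l) ^ (r (Suc l) - r l)) \<and>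
        m' \<in> Poly_Mapping.keys (\<Sum>q\<in>rows rs. ?C q * shift (row_poly rs q))}"
    using signed_mult(2) [OF signed_row_factors(1) [OF assms] s2] assms by simp
  then show ?thesis
    unfolding k4 k3 k1 k2 keys_shift by (simp only: mem_Collect_eq UN_iff) blast
qed

lemma lookup_sum_single:
  assumes "\<And>l. l \<le> v \<Longrightarrow> Poly_Mapping.keys (g l) \<subseteq> {Suc l}"
  shows "Poly_Mapping.lookup (sum g {..v}) k
    = (case k of 0 \<Rightarrow> 0 | Suc j \<Rightarrow> if j \<le> v then Poly_Mapping.lookup (g j) k else 0)"
proof -
  have z: "Poly_Mapping.lookup (g l) k = 0" if "l \<le> v" "k \<noteq> Suc l" for l
    using assms [OF that(1)] that(2) by (auto simp: in_keys_iff)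
  show ?thesis
  proof (cases k)
    case 0
    then show ?thesis using z by (simp add: lookup_sum)
  next
    case (Suc j)
    show ?thesis
    proof (cases "j \<le> v")
      case True
      have "(\<Sum>l\<le>v. Poly_Mapping.lookup (g l) k) = (\<Sum>l\<in>{j}. Poly_Mapping.lookup (g l) k)"
        by (rule sum.mono_neutral_right) (use True z Suc in auto)
      then show ?thesis using True Suc by (simp add: lookup_sum)
    next
      case False
      then show ?thesis using z Suc by (auto simp: lookup_sum intro!: sum.neutral)
    qed
  qed
qed

text \<open>Choosing 1 in every \<open>cap\<close> gives the lower content, and choosing the
  variable wherever it is offered gives the upper one. Any other choice lies between; the two
  extremes are realized in \<open>keys_row_polyI\<close>.\<close>

lemma keys_row_polyD:
  assumes "flag_ok rs" "f \<in> Poly_Mapping.keys (row_poly rs r)"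
  shows "\<exists>I. list_pattern rs I \<and> I 0 = r \<and>
    (\<forall>k. list_content False rs I k \<le> Poly_Mapping.lookup f k \<and>
      Poly_Mapping.lookup f k \<le> list_content True rs I k)"
  using assms
proof (induction rs arbitrary: f r)
  case Nil
  then have "r = (\<lambda>_. 0)" "f = 0" by (auto split: if_splits)
  then show ?case
    by (intro exI [of _ "\<lambda>_ _. 0"]) (simp add: pattern_def content_def)
next
  case (Cons x rs)
  obtain a v where x: "x = (a, v)" by (cases x)
  have r: "r \<in> rows ((a, v) # rs)" using Cons.prems(2) x row_poly_outside by fastforce
  from Cons.prems(2) [unfolded x keys_row_poly_Cons [OF r]] obtain q g h
    where q: "q \<in> rows rs" and g: "\<And>l. l \<le> v \<Longrightarrow> g l \<in> Poly_Mapping.keys (cap (xvar (Suc l)) (r l) (q l))"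
      and h: "h \<in> Poly_Mapping.keys (row_poly rs q)"
      and f: "f = (\<Sum>l\<le>v. Poly_Mapping.single (Suc l) (r (Suc l) - r l)) + (sum g {..v} + shift_monom h)"
    by blast
  obtain I where I: "list_pattern rs I" "I 0 = q"
    "\<And>k. list_content False rs I k \<le> Poly_Mapping.lookup h k"
    "\<And>k. Poly_Mapping.lookup h k \<le> list_content True rs I k"
    using Cons.IH [OF flag_ok_tl [OF Cons.prems(1)] h] by blast
  let ?J = "case_nat r I"
  have g': "q l \<le> r l" "g l = 0 \<or> q l < r l \<and> g l = Poly_Mapping.single (Suc l) 1" if "l \<le> v" for l
    using g [OF that] by (auto simp: keys_cap split: if_splits)
  have "list_pattern (x # rs) ?J"
    using Cons.prems(1) r I(1,2) g'(1) unfolding x by (subst list_pattern_Cons) auto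
  moreover have "list_content False (x # rs) ?J k \<le> Poly_Mapping.lookup f k \<and>
      Poly_Mapping.lookup f k \<le> list_content True (x # rs) ?J k" for k
  proof (cases k)
    case 0
    have "Poly_Mapping.keys (g l) \<subseteq> {Suc l}" if "l \<le> v" for l using g'(2) [OF that] by auto
    then show ?thesis unfolding f lookup_add 0 by (subst (1 2) lookup_sum_single) auto
  next
    case (Suc j)
    have gk: "Poly_Mapping.keys (g l) \<subseteq> {Suc l}" if "l \<le> v" for l using g'(2) [OF that] by auto
    have "Poly_Mapping.lookup f k = (if j \<le> v then r (Suc j) - r j + Poly_Mapping.lookup (g j) (Suc j) else 0)
        + Poly_Mapping.lookup h j"
      unfolding f lookup_add Suc by (subst (1 2) lookup_sum_single) (auto simp: gk)
    moreover have "j \<le> v \<Longrightarrow> Poly_Mapping.lookup (g j) (Suc j) \<le> (if q j < r j then 1 else 0)"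
      using g'(2) [of j] by auto
    ultimately show ?thesis
      using I(3) [of j] I(4) [of j] unfolding Suc x by (auto simp: content_Suc cell_def I(2))
  qed
  ultimately show ?case by (intro exI [of _ ?J]) simp
qed

lemma keys_row_polyI:
  assumes "flag_ok rs" "list_pattern rs I"
  shows "\<exists>f\<in>Poly_Mapping.keys (row_poly rs (I 0)). \<forall>k. Poly_Mapping.lookup f k = list_content b rs I k"
  using assms
proof (induction rs arbitrary: I)
  case Nil
  then have "I 0 = (\<lambda>_. 0)" by (auto simp: pattern_def)
  then show ?case by (simp add: content_def)
next
  case (Cons x rs)
  obtain a v where x: "x = (a, v)" by (cases x)
  have I: "valid_row a v (I 0)" "list_pattern rs (\<lambda>i. I (Suc i))" "\<And>l. l \<le> v \<Longrightarrow> I (Suc 0) l \<le> I 0 l"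
    using Cons.prems list_pattern_Cons unfolding x by blast+
  obtain h where h: "h \<in> Poly_Mapping.keys (row_poly rs (I (Suc 0)))"
    "\<And>k. Poly_Mapping.lookup h k = list_content b rs (\<lambda>i. I (Suc i)) k"
    using Cons.IH [OF flag_ok_tl [OF Cons.prems(1)] I(2)] by blast
  have q: "I (Suc 0) \<in> rows rs" using h(1) row_poly_outside by fastforce
  let ?g = "\<lambda>l. if b \<and> I (Suc 0) l < I 0 l then Poly_Mapping.single (Suc l) 1 else (0 :: monom)"
  let ?f = "(\<Sum>l\<le>v. Poly_Mapping.single (Suc l) (I 0 (Suc l) - I 0 l)) + (sum ?g {..v} + shift_monom h)"
  have "?g l \<in> Poly_Mapping.keys (cap (xvar (Suc l)) (I 0 l) (I (Suc 0) l))" if "l \<le> v" for l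
    using I(3) [OF that] by (auto simp: keys_cap)
  then have "?f \<in> Poly_Mapping.keys (row_poly (x # rs) (I 0))"
    unfolding x using I(1) q h(1)
    by (subst keys_row_poly_Cons) (simp, intro exI [of _ "I (Suc 0)"] exI [of _ ?g] exI [of _ h], simp)
  moreover have "Poly_Mapping.lookup ?f k = list_content b (x # rs) I k" for k
  proof (cases k)
    case 0
    show ?thesis unfolding lookup_add 0 by (subst (1 2) lookup_sum_single) auto
  next
    case (Suc j)
    show ?thesis
      unfolding lookup_add Suc x by (subst (1 2) lookup_sum_single) (auto simp: h(2) content_Suc cell_def)
  qed
  ultimately show ?case by blast
qed

lemma keys_flag_poly: "Poly_Mapping.keys (flag_poly rs) = (\<Union>r\<in>rows rs. Poly_Mapping.keys (row_poly rs r))"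
  unfolding flag_poly_def by (rule signed_sum(2)) (auto intro: signed_row_poly)

lemma keys_flag_polyD:
  assumes "flag_ok rs" "f \<in> Poly_Mapping.keys (flag_poly rs)"
  obtains I where "list_pattern rs I" "\<And>k. list_content False rs I k \<le> Poly_Mapping.lookup f k"
    "\<And>k. Poly_Mapping.lookup f k \<le> list_content True rs I k"
  using keys_row_polyD [OF assms(1)] assms(2) unfolding keys_flag_poly by blast

lemma keys_flag_polyI:
  assumes "flag_ok rs" "list_pattern rs I"
  obtains f where "f \<in> Poly_Mapping.keys (flag_poly rs)"
    "\<And>k. Poly_Mapping.lookup f k = list_content b rs I k"
proof -
  obtain f where f: "f \<in> Poly_Mapping.keys (row_poly rs (I 0))"
    "\<And>k. Poly_Mapping.lookup f k = list_content b rs I k"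
    using keys_row_polyI [OF assms] by blast
  moreover have "I 0 \<in> rows rs" using f(1) row_poly_outside by fastforce
  ultimately show ?thesis by (intro that [of f]) (auto simp: keys_flag_poly)
qed

section \<open>Where a column with too few drops can be raised\<close>

section \<open>Moves on patterns\<close>

text \<open>\<open>f\<close> and \<open>g\<close> stand for one column of two patterns; a row is
  good if the column lies within its flag. In the other rows both patterns have the full length, so
  drops can be compared on each maximal run of good rows separately. On a run, \<open>stuck\<close>
  makes \<open>f\<close> drop strictly and then stay constant. If \<open>g\<close> has more drops
  there and the same final value, it lies high enough to show that the lengths leave room above
  \<open>f\<close>.\<close>

lemma run_exists:
  fixes f g len :: "nat \<Rightarrow> nat" and good :: "nat \<Rightarrow> bool"
  assumes anti: "\<And>i. f (Suc i) \<le> f i" "\<And>i. g (Suc i) \<le> g i"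
    and bad: "\<And>i. i < n \<Longrightarrow> \<not> good i \<Longrightarrow> f i = g i" "f n = g n"
    and len: "\<And>i. g i \<le> len i"
    and stuck: "\<And>i. Suc i < n \<Longrightarrow> good i \<Longrightarrow> good (Suc i) \<Longrightarrow> f i = f (Suc i) \<Longrightarrow> f (Suc i) = f (Suc (Suc i))"
    and less: "card {i. i < n \<and> good i \<and> f (Suc i) < f i} < card {i. i < n \<and> good i \<and> g (Suc i) < g i}"
  shows "\<exists>s j. s \<le> j \<and> j < n \<and> (\<forall>i. s \<le> i \<and> i \<le> j \<longrightarrow> good i) \<and> (s = 0 \<or> \<not> good (s - 1)) \<and>
    f j = f (Suc j) \<and> (\<forall>i. s \<le> i \<and> i < j \<longrightarrow> f (Suc i) < f i) \<and>
    (\<forall>i. s \<le> i \<and> i \<le> j \<longrightarrow> f j + (j - i) < len i)"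
proof (rule ccontr)
  assume contra: "\<not> ?thesis"
  define cnt where "cnt h a b = card {i. a \<le> i \<and> i < b \<and> good i \<and> h (Suc i) < h i}"
    for h :: "nat \<Rightarrow> nat" and a b
  have cnt_split: "cnt h a c = cnt h a b + cnt h b c" if "a \<le> b" "b \<le> c" for h a b c
  proof -
    have "{i. a \<le> i \<and> i < c \<and> good i \<and> h (Suc i) < h i}
      = {i. a \<le> i \<and> i < b \<and> good i \<and> h (Suc i) < h i} \<union> {i. b \<le> i \<and> i < c \<and> good i \<and> h (Suc i) < h i}"
      using that by auto
    then show ?thesis unfolding cnt_def by (simp add: card_Un_disjoint disjoint_iff)
  qed
  have cnt_le: "cnt h a b \<le> b - a" for h a b
  proof -
    have "cnt h a b \<le> card {a..<b}" unfolding cnt_def by (rule card_mono) auto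
    then show ?thesis by simp
  qed
  have cnt_single: "cnt h a (Suc a) = (if good a \<and> h (Suc a) < h a then 1 else 0)" for h a
  proof -
    have "{i. a \<le> i \<and> i < Suc a \<and> good i \<and> h (Suc i) < h i}
      = (if good a \<and> h (Suc a) < h a then {a} else {})" by (auto simp: less_Suc_eq)
    then show ?thesis by (simp add: cnt_def)
  qed
  have g_ge: "g u + cnt g i u \<le> g i" if "i \<le> u" for i u
    using that
  proof (induction rule: inc_induct)
    case base
    then show ?case by (simp add: cnt_def)
  next
    case (step m)
    have "cnt g m u = cnt g m (Suc m) + cnt g (Suc m) u" using step by (intro cnt_split) auto
    then show ?case using step anti(2) [of m] by (simp add: cnt_single)
  qed
  have run: "cnt g s u \<le> cnt f s u"
    if u: "s \<le> u" "u \<le> n" "\<forall>i. s \<le> i \<and> i < u \<longrightarrow> good i" "f u = g u" and s: "s = 0 \<or> \<not> good (s - 1)" for s u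
  proof (rule ccontr)
    assume lt: "\<not> cnt g s u \<le> cnt f s u"
    \<comment> \<open>The first row of the run at which \<open>f\<close> does not drop; the end
      \<open>u\<close> of the run is the default.\<close>
    define c where "c = (LEAST c. s \<le> c \<and> (u \<le> c \<or> f c = f (Suc c)))"
    have c: "s \<le> c" "u \<le> c \<or> f c = f (Suc c)"
      using LeastI [of "\<lambda>c. s \<le> c \<and> (u \<le> c \<or> f c = f (Suc c))" u] u(1) by (auto simp: c_def)
    have cu: "c \<le> u" unfolding c_def by (rule Least_le) (use u in auto)
    have strict: "f (Suc i) < f i" if "s \<le> i" "i < c" for i
    proof -
      have "\<not> (s \<le> i \<and> (u \<le> i \<or> f i = f (Suc i)))"
        using that(2) unfolding c_def by (rule not_less_Least)
      then show ?thesis using that(1) anti(1) [of i] by auto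
    qed
    have "{s..<c} \<subseteq> {i. s \<le> i \<and> i < u \<and> good i \<and> f (Suc i) < f i}"
      using strict u(3) cu by auto
    then have "card {s..<c} \<le> cnt f s u" unfolding cnt_def by (intro card_mono) auto
    then have cg: "c - s < cnt g s u" using lt by simp
    then have clu: "c < u" using cnt_le [of g s u] by linarith
    have const: "f x = f (Suc x)" if "c \<le> x" "x < u" for x
      using that
    proof (induction x rule: dec_induct)
      case base
      then show ?case using c clu by simp
    next
      case (step m)
      then show ?case using stuck [of m] u c(1) by auto
    qed
    have fc: "f x = f c" if "c \<le> x" "x \<le> u" for x
      using that
    proof (induction x rule: dec_induct)
      case (step m)
      then show ?case using const [of m] by simp
    qed simp
    \<comment> \<open>\<open>g\<close> has more than \<open>c - s\<close> drops on the run and at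
      most one per row, so more than \<open>c - i\<close> of them occur from row \<open>i\<close>
      on. Hence \<open>g i\<close> exceeds the common final value, which is \<open>f c\<close>, by
      more than \<open>c - i\<close>.\<close>
    have "f c + (c - i) < len i" if "s \<le> i" "i \<le> c" for i
    proof -
      have "cnt g s u = cnt g s i + cnt g i u" using that cu by (intro cnt_split) auto
      then have "c - i < cnt g i u" using cg cnt_le [of g s i] that by linarith
      moreover have "g u + cnt g i u \<le> g i" using that cu by (intro g_ge) auto
      ultimately show ?thesis using len [of i] fc [of u] clu u(4) by simp
    qed
    then have "s \<le> c \<and> c < n \<and> (\<forall>i. s \<le> i \<and> i \<le> c \<longrightarrow> good i) \<and> (s = 0 \<or> \<not> good (s - 1)) \<and>
      f c = f (Suc c) \<and> (\<forall>i. s \<le> i \<and> i < c \<longrightarrow> f (Suc i) < f i) \<and>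
      (\<forall>i. s \<le> i \<and> i \<le> c \<longrightarrow> f c + (c - i) < len i)"
      using c clu u s strict by auto
    then show False using contra by blast
  qed
  have "cnt g s n \<le> cnt f s n" if "s \<le> n" "s = 0 \<or> \<not> good (s - 1)" for s
    using that
  proof (induction "n - s" arbitrary: s rule: less_induct)
    case less
    \<comment> \<open>The end of the run of good rows starting at \<open>s\<close>; the run may be
      empty.\<close>
    define u where "u = (LEAST u. s \<le> u \<and> (u = n \<or> \<not> good u))"
    let ?P = "\<lambda>u. s \<le> u \<and> (u = n \<or> \<not> good u)"
    have u: "s \<le> u" "u = n \<or> \<not> good u"
      using LeastI [of ?P n] less.prems(1) by (auto simp: u_def)
    have un: "u \<le> n" unfolding u_def by (rule Least_le) (use less.prems in auto)
    have gd: "good i" if "s \<le> i" "i < u" for i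
      using not_less_Least [of i ?P] that unfolding u_def by auto
    have fu: "f u = g u" using u(2) un bad by (cases "u = n") auto
    have r: "cnt g s u \<le> cnt f s u" using run [OF u(1) un _ fu less.prems(2)] gd by blast
    show ?case
    proof (cases "u = n")
      case False
      then have un': "u < n" "\<not> good u" using un u by auto
      have "cnt g (Suc u) n \<le> cnt f (Suc u) n"
        by (rule less.hyps) (use un' u in auto)
      moreover have "cnt h s n = cnt h s u + (cnt h u (Suc u) + cnt h (Suc u) n)" for h
        using cnt_split [of s u n h] cnt_split [of u "Suc u" n h] u un' by simp
      ultimately show ?thesis using r un' by (simp add: cnt_single)
    qed (use r in simp)
  qed
  from this [of 0] less show False by (simp add: cnt_def)
qed

section \<open>Raising and lowering entries of a pattern\<close>

lemma pattern_row: "pattern n len lev I \<Longrightarrow> i < n \<Longrightarrow> valid_row (len i) (lev i) (I i)"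
  and pattern_Suc_le: "pattern n len lev I \<Longrightarrow> I (Suc i) l \<le> I i l"
  and pattern_zero: "pattern n len lev I \<Longrightarrow> n \<le> i \<Longrightarrow> I i l = 0"
  by (simp_all add: pattern_def)

lemma pattern_mono: "pattern n len lev I \<Longrightarrow> l \<le> l' \<Longrightarrow> I i l \<le> I i l'"
  using valid_row_mono pattern_row pattern_zero by (cases "i < n") fastforce+

lemma pattern_upd:
  assumes I: "pattern n len lev I" and "i < n" "valid_row (len i) (lev i) r"
    "\<And>l. I (Suc i) l \<le> r l" "\<And>l. 0 < i \<Longrightarrow> r l \<le> I (i - 1) l"
  shows "pattern n len lev (I(i := r))"
  unfolding pattern_def
proof (intro conjI allI impI)
  fix j l
  show "(I(i := r)) (Suc j) l \<le> (I(i := r)) j l"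
    using assms(4) [of l] assms(5) [of l] pattern_Suc_le [OF I, of j l] by (auto split: if_splits)
qed (use assms in \<open>auto simp: pattern_def\<close>)

definition term_at :: "(nat \<Rightarrow> nat) \<Rightarrow> (nat \<Rightarrow> nat \<Rightarrow> nat) \<Rightarrow> nat \<Rightarrow> nat \<Rightarrow> nat"
  where "term_at lev I k i = (if i < k \<and> k - Suc i \<le> lev i
    then cell True (I i) (I (Suc i)) (k - Suc i) else 0)"

lemma content_term_at: "content True n lev I k = (\<Sum>i<n. term_at lev I k i)"
  by (simp add: content_def term_at_def)

text \<open>Row \<open>i\<close> enters its own term and, through the room for extra letters, that
  of the row above; a change of row \<open>i\<close> affects no other term.\<close>

definition two_terms :: "(nat \<Rightarrow> nat) \<Rightarrow> (nat \<Rightarrow> nat \<Rightarrow> nat) \<Rightarrow> nat \<Rightarrow> nat \<Rightarrow> nat"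
  where "two_terms lev I k i = (if i = 0 then 0 else term_at lev I k (i - 1)) + term_at lev I k i"

lemma content_upd:
  assumes "i < n"
  shows "content True n lev (I(i := r)) k + two_terms lev I k i
    = content True n lev I k + two_terms lev (I(i := r)) k i"
proof -
  have split: "(\<Sum>j<n. h j) = (\<Sum>j\<in>{..<n} - {i, i - 1}. h j) + ((if i = 0 then 0 else h (i - 1)) + h i)"
    for h :: "nat \<Rightarrow> nat"
  proof -
    have "(\<Sum>j<n. h j) = (\<Sum>j\<in>{..<n} - {i, i - 1}. h j) + (\<Sum>j\<in>{i, i - 1}. h j)"
      by (rule sum.subset_diff) (use assms in auto)
    then show ?thesis by auto
  qed
  have "(\<Sum>j\<in>{..<n} - {i, i - 1}. term_at lev (I(i := r)) k j) = (\<Sum>j\<in>{..<n} - {i, i - 1}. term_at lev I k j)"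
    by (rule sum.cong) (auto simp: term_at_def)
  then show ?thesis unfolding content_term_at two_terms_def by (subst (1 2) split) simp
qed

text \<open>
  Raising \<open>I i l\<close> forces the later equal entries of the row to be raised as well;
  each of these steps is again a move of the same kind.
\<close>

lemma add_move:
  assumes I: "pattern n len lev I" and i: "i < n" and l: "1 \<le> l" "l \<le> lev i"
    and eq: "I i l = I (Suc i) l" and lt: "I i l < len i" and up: "0 < i \<Longrightarrow> I i l < I (i - 1) l"
  defines "r \<equiv> \<lambda>m. if l \<le> m then max (I i m) (Suc (I i l)) else I i m"
  shows "pattern n len lev (I(i := r))"
    and "content True n lev I k \<le> content True n lev (I(i := r)) k"
    and "content True n lev I (i + l) < content True n lev (I(i := r)) (i + l) \<or>
      0 < i \<and> l \<le> lev (i - 1) \<and> I (i - 1) l = Suc (I i l)"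
proof -
  have row: "valid_row (len i) (lev i) (I i)" by (rule pattern_row [OF I i])
  have mono: "I j m \<le> I j m'" if "m \<le> m'" for j m m' using pattern_mono [OF I that] .
  have "r m \<le> r (Suc m)" for m
    using mono [of m "Suc m" i] mono [of m l i] by (auto simp: r_def)
  then have "valid_row (len i) (lev i) r"
    using row l lt by (auto simp: valid_row_def r_def)
  moreover have "I (Suc i) m \<le> r m" for m
    using pattern_Suc_le [OF I, of i m] by (simp add: r_def le_max_iff_disj)
  moreover have r_up: "r m \<le> I (i - 1) m" if "0 < i" for m
    using pattern_Suc_le [OF I, of "i - 1" m] that up mono [of l m "i - 1"] by (auto simp: r_def)
  ultimately show pat: "pattern n len lev (I(i := r))" by (rule pattern_upd [OF I i])
  have r_eq: "r m = (if l \<le> m \<and> I i m = I i l then Suc (I i m) else I i m)" for m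
    using mono [of l m i] by (auto simp: r_def)
  have below: "I (Suc i) m = I i m" if "l \<le> m" "I i m = I i l" for m
    using mono [OF that(1), of "Suc i"] pattern_Suc_le [OF I, of i m] eq that by simp
  have lev_i: "m \<le> lev i" if "l \<le> m" "I i m = I i l" for m
  proof (rule ccontr)
    assume "\<not> m \<le> lev i"
    then show False using row lt that by (simp add: valid_row_def)
  qed
  show "content True n lev I k \<le> content True n lev (I(i := r)) k" for k
  proof -
    have "two_terms lev I k i \<le> two_terms lev (I(i := r)) k i"
    proof -
      consider "k < i" | "k = i" | m where "k = Suc (i + m)"
        by (rule linorder_cases [of k i]) (blast dest: less_imp_Suc_add)+
      then show ?thesis
      proof cases
        case 1
        then show ?thesis by (auto simp: two_terms_def term_at_def)
      next
        case 2
        have "r 0 = I i 0" using l by (simp add: r_def)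
        then show ?thesis using 2 by (simp add: two_terms_def term_at_def cell_def)
      next
        case 3
        let ?d = "r (Suc m) - I i (Suc m)"
        have le: "I i m \<le> I i (Suc m)" "r m \<le> r (Suc m)" "I i (Suc m) \<le> r (Suc m)"
          using mono \<open>r m \<le> r (Suc m)\<close> by (auto simp: r_eq)
        \<comment> \<open>A raised entry at \<open>m\<close> costs a box of level \<open>m\<close>.
          It was equal to the entry below it, so room for an extra letter opens and compensates the
          loss. A raised entry at \<open>m + 1\<close> adds a box, counted by
          \<open>?d\<close>.\<close>
        have "term_at lev (I(i := r)) k i = term_at lev I k i + ?d"
        proof (cases "m \<le> lev i")
          case True
          have "r m - I i m + (if I (Suc i) m < I i m then 1 else 0) = (if I (Suc i) m < r m then 1 else 0)"
          proof (cases "l \<le> m \<and> I i m = I i l")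
            case True
            then show ?thesis using below [of m] r_eq [of m] by simp
          next
            case False
            then show ?thesis unfolding r_eq [of m] if_not_P [OF False] by simp
          qed
          moreover have "I i m \<le> r m" by (simp add: r_def)
          moreover have "y' - x' + q' = y - x + q + (y' - y)"
            if "x' - x + q = q'" "x \<le> x'" "x \<le> y" "x' \<le> y'" "y \<le> y'" for x x' y y' q q' :: nat
            using that by linarith
          ultimately show ?thesis using True le by (simp add: 3 term_at_def cell_def)
        next
          case False
          then have "r (Suc m) = I i (Suc m)" using lev_i [of "Suc m"] r_eq [of "Suc m"] by auto
          then show ?thesis using False by (simp add: 3 term_at_def)
        qed
        \<comment> \<open>The same letter has level \<open>m + 1\<close> in the row above. That row
          can lose only its extra letter, and only if the entry there was raised, so
          \<open>?d\<close> pays for it.\<close>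
        moreover have "term_at lev I k (i - 1) \<le> term_at lev (I(i := r)) k (i - 1) + ?d" if "0 < i"
        proof -
          have "k - Suc (i - 1) = Suc m" "i - 1 < k" "i - Suc 0 \<noteq> i" using 3 that by auto
          moreover have "(if I i (Suc m) < I (i - 1) (Suc m) then 1 else 0)
              \<le> (if r (Suc m) < I (i - 1) (Suc m) then 1 else 0) + ?d"
            using le by auto
          ultimately show ?thesis using that
            by (cases "Suc m \<le> lev (i - 1)")
              (simp_all add: term_at_def cell_def add.assoc split del: if_split)
        qed
        ultimately show ?thesis by (simp add: two_terms_def)
      qed
    qed
    then show ?thesis using content_upd [OF i, of lev I r k] by simp
  qed
  show "content True n lev I (i + l) < content True n lev (I(i := r)) (i + l) \<or>
      0 < i \<and> l \<le> lev (i - 1) \<and> I (i - 1) l = Suc (I i l)"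
  proof (rule disjCI)
    assume *: "\<not> (0 < i \<and> l \<le> lev (i - 1) \<and> I (i - 1) l = Suc (I i l))"
    \<comment> \<open>In row \<open>i\<close> the letter i + l has level \<open>m\<close>, and it
      gains a box because \<open>r l\<close> rises while \<open>r m\<close> stays. In row
      \<open>i - 1\<close> it has level \<open>l\<close>, and only the excluded case destroys an
      extra letter there.\<close>
    obtain m where m: "l = Suc m" using l by (cases l) auto
    have "I i m \<le> I i l" using mono m by simp
    moreover have "r m = I i m" "r l = Suc (I i l)" by (simp_all add: r_def m)
    ultimately have "term_at lev (I(i := r)) (i + l) i = Suc (term_at lev I (i + l) i)"
      using l by (simp add: term_at_def cell_def m)
    moreover have "term_at lev (I(i := r)) (i + l) (i - 1) = term_at lev I (i + l) (i - 1)" if "0 < i"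
    proof -
      have "i + l - Suc (i - 1) = l" "i - Suc 0 \<noteq> i" "i - 1 < i + l" using that by simp_all
      moreover have "Suc (I i l) < I (i - 1) l" if "l \<le> lev (i - 1)"
        using * up \<open>0 < i\<close> that by (simp add: Suc_lessI)
      ultimately show ?thesis
        using that \<open>r l = Suc (I i l)\<close> up
        by (cases "l \<le> lev (i - 1)") (simp_all add: term_at_def cell_def)
    qed
    ultimately have "two_terms lev I (i + l) i < two_terms lev (I(i := r)) (i + l) i"
      by (simp add: two_terms_def)
    then show "content True n lev I (i + l) < content True n lev (I(i := r)) (i + l)"
      using content_upd [OF i, of lev I r "i + l"] by simp
  qed
qed

text \<open>A lowered entry at level m + 1 takes a box of level m from its row; the entry above was
  equal to it, so the row above now has room for this same letter as an extra one. A lowered entry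
  at level m adds a box of level m, which pays for the extra letter that its row may lose. Equal
  entries at smaller levels have to be lowered as well.\<close>

lemma remove_move:
  assumes I: "pattern n len lev I" and i: "Suc i < n" and l: "l \<le> lev i" "l \<le> lev (Suc i)"
    and eq: "I i l = I (Suc i) l" and lt: "I (Suc (Suc i)) l < I (Suc i) l"
  defines "r \<equiv> \<lambda>m. if m \<le> l then min (I (Suc i) m) (I (Suc i) l - 1) else I (Suc i) m"
  shows "pattern n len lev (I(Suc i := r))"
    and "content True n lev I k \<le> content True n lev (I(Suc i := r)) k"
    and "r m \<le> I (Suc i) m" "r l < I (Suc i) l"
proof -
  have row: "valid_row (len (Suc i)) (lev (Suc i)) (I (Suc i))" by (rule pattern_row [OF I i])
  have mono: "I j m \<le> I j m'" if "m \<le> m'" for j m m' using pattern_mono [OF I that] .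
  show "r m \<le> I (Suc i) m" "r l < I (Suc i) l" for m using lt by (auto simp: r_def)
  have r_mono: "r m \<le> r (Suc m)" for m
    using mono [of m "Suc m" "Suc i"] mono [of m l "Suc i"] by (auto simp: r_def)
  have "valid_row (len (Suc i)) (lev (Suc i)) r"
    using row l r_mono by (auto simp: valid_row_def r_def)
  moreover have "I (Suc (Suc i)) m \<le> r m" for m
    using pattern_Suc_le [OF I, of "Suc i" m] mono [of m l "Suc (Suc i)"] lt by (auto simp: r_def)
  moreover have "r m \<le> I (Suc i - 1) m" for m
    using pattern_Suc_le [OF I, of i m] by (auto simp: r_def)
  ultimately show pat: "pattern n len lev (I(Suc i := r))" by (intro pattern_upd [OF I i])
  have r_eq: "r m = (if m \<le> l \<and> I (Suc i) m = I (Suc i) l then I (Suc i) m - 1 else I (Suc i) m)" for m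
    using mono [of m l "Suc i"] by (auto simp: r_def)
  have pos: "0 < I (Suc i) l" using lt by simp
  have above: "I i m = I (Suc i) m" if "m \<le> l" "I (Suc i) m = I (Suc i) l" for m
    using mono [OF that(1), of i] pattern_Suc_le [OF I, of i m] eq that by simp
  have below: "I (Suc (Suc i)) m < I (Suc i) m" if "m \<le> l" "I (Suc i) m = I (Suc i) l" for m
    using mono [OF that(1), of "Suc (Suc i)"] lt that by simp
  show "content True n lev I k \<le> content True n lev (I(Suc i := r)) k"
  proof -
    have "two_terms lev I k (Suc i) \<le> two_terms lev (I(Suc i := r)) k (Suc i)"
    proof -
      consider "k < Suc i" | "k = Suc i" | m where "k = Suc (Suc i + m)"
        by (rule linorder_cases [of k "Suc i"]) (blast dest: less_imp_Suc_add)+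
      then show ?thesis
      proof cases
        case 1
        then show ?thesis by (auto simp: two_terms_def term_at_def)
      next
        case 2
        have "r 0 = 0" "I (Suc i) 0 = 0" using row by (auto simp: r_def valid_row_def)
        then show ?thesis using 2 by (simp add: two_terms_def term_at_def cell_def)
      next
        case 3
        let ?d = "I (Suc i) (Suc m) - r (Suc m)"
        have le: "I (Suc i) m \<le> I (Suc i) (Suc m)" "r m \<le> r (Suc m)" "r (Suc m) \<le> I (Suc i) (Suc m)"
          using mono r_mono by (auto simp: r_def)
        have "term_at lev I k (Suc i) \<le> term_at lev (I(Suc i := r)) k (Suc i) + ?d"
        proof -
          have "(if I (Suc (Suc i)) m < I (Suc i) m then 1 else 0)
              \<le> I (Suc i) m - r m + (if I (Suc (Suc i)) m < r m then 1 else 0)"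
            using r_eq [of m] pos by auto
          moreover have "r m \<le> I (Suc i) m" by (simp add: r_def)
          moreover have "x - a + p \<le> x' - a' + p' + (x - x')"
            if "p \<le> a - a' + p'" "a' \<le> a" "a \<le> x" "a' \<le> x'" "x' \<le> x" for x x' a a' p p' :: nat
            using that by linarith
          ultimately show ?thesis using le by (simp add: 3 term_at_def cell_def)
        qed
        moreover have "term_at lev (I(Suc i := r)) k i = term_at lev I k i + ?d"
        proof (cases "Suc m \<le> l \<and> I (Suc i) (Suc m) = I (Suc i) l")
          case True
          then show ?thesis using above [of "Suc m"] r_eq [of "Suc m"] pos l
            by (simp add: 3 term_at_def cell_def)
        next
          case False
          then have "r (Suc m) = I (Suc i) (Suc m)" using r_eq [of "Suc m"] by (simp only: if_False)
          then show ?thesis by (simp add: 3 term_at_def cell_def)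
        qed
        ultimately show ?thesis by (simp add: two_terms_def)
      qed
    qed
    then show ?thesis using content_upd [OF i, of lev I r k] by simp
  qed
qed

section \<open>Degrees of the contents and improvement of a pattern\<close>

definition drops :: "nat \<Rightarrow> (nat \<Rightarrow> nat) \<Rightarrow> (nat \<Rightarrow> nat \<Rightarrow> nat) \<Rightarrow> nat"
  where "drops n lev I = (\<Sum>i<n. card {l. l \<le> lev i \<and> I (Suc i) l < I i l})"

lemma sum_content:
  assumes I: "pattern n len lev I" and N: "\<And>i. i < n \<Longrightarrow> Suc (i + lev i) \<le> N"
  shows "(\<Sum>k\<le>N. content b n lev I k) = (\<Sum>i<n. len i) + (if b then drops n lev I else 0)"
proof -
  have "(\<Sum>k\<le>N. if i < k \<and> k - Suc i \<le> lev i then cell b (I i) (I (Suc i)) (k - Suc i) else 0)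
    = len i + (if b then card {l. l \<le> lev i \<and> I (Suc i) l < I i l} else 0)" if i: "i < n" for i
  proof -
    have row: "valid_row (len i) (lev i) (I i)" by (rule pattern_row [OF I i])
    have "(\<Sum>k\<le>N. if i < k \<and> k - Suc i \<le> lev i then cell b (I i) (I (Suc i)) (k - Suc i) else 0)
      = (\<Sum>k\<in>{Suc i..Suc (i + lev i)}. cell b (I i) (I (Suc i)) (k - Suc i))"
      by (rule sum.mono_neutral_cong_right) (use N [OF i] in auto)
    also have "\<dots> = (\<Sum>l\<le>lev i. cell b (I i) (I (Suc i)) l)"
      by (rule sum.reindex_bij_witness [where i = "\<lambda>l. Suc (i + l)" and j = "\<lambda>k. k - Suc i"]) auto
    also have "\<dots> = (\<Sum>l\<le>lev i. I i (Suc l) - I i l) + (\<Sum>l\<le>lev i. if b \<and> I (Suc i) l < I i l then 1 else 0)"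
      unfolding cell_def by (rule sum.distrib)
    also have "(\<Sum>l\<le>lev i. I i (Suc l) - I i l) = len i"
    proof -
      have "(\<Sum>l<m. I i (Suc l) - I i l) = I i m" for m
      proof (induction m)
        case (Suc m)
        then show ?case using row by (auto simp: valid_row_def)
      qed (use row in \<open>simp add: valid_row_def\<close>)
      from this [of "Suc (lev i)"] show ?thesis
        using row by (simp add: lessThan_Suc_atMost valid_row_def)
    qed
    also have "(\<Sum>l\<le>lev i. if b \<and> I (Suc i) l < I i l then 1 else 0)
      = (if b then card {l. l \<le> lev i \<and> I (Suc i) l < I i l} else (0::nat))"
    proof -
      have "(\<Sum>l\<le>lev i. if I (Suc i) l < I i l then 1 else 0)
        = (\<Sum>l\<in>{l. l \<le> lev i \<and> I (Suc i) l < I i l}. (1::nat))"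
        by (rule sum.mono_neutral_cong_right) auto
      then show ?thesis by simp
    qed
    finally show ?thesis .
  qed
  then have "(\<Sum>i<n. \<Sum>k\<le>N. if i < k \<and> k - Suc i \<le> lev i
      then cell b (I i) (I (Suc i)) (k - Suc i) else 0)
    = (\<Sum>i<n. len i + (if b then card {l. l \<le> lev i \<and> I (Suc i) l < I i l} else 0))"
    by (intro sum.cong) auto
  then show ?thesis
    unfolding content_def drops_def by (subst sum.swap) (simp add: sum.distrib)
qed

lemma level_bound:
  fixes lev :: "nat \<Rightarrow> nat"
  obtains N where "\<And>i. i < n \<Longrightarrow> Suc (i + lev i) \<le> N"
proof -
  have "Suc (i + lev i) \<le> (\<Sum>i<n. Suc (i + lev i))" if "i < n" for i
    by (rule member_le_sum [of i "{..<n}" "\<lambda>i. Suc (i + lev i)"]) (use that in auto)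
  then show ?thesis using that by blast
qed

lemma monom_deg_mono:
  assumes "\<And>k. Poly_Mapping.lookup f k \<le> Poly_Mapping.lookup g k"
  shows "monom_deg f \<le> monom_deg g"
  using assms monom_deg_superset [of "Poly_Mapping.keys f \<union> Poly_Mapping.keys g"]
  by (simp add: sum_mono)

lemma monom_deg_strict_mono:
  assumes "\<And>k. Poly_Mapping.lookup f k \<le> Poly_Mapping.lookup g k"
    and "Poly_Mapping.lookup f j < Poly_Mapping.lookup g j"
  shows "monom_deg f < monom_deg g"
proof -
  let ?A = "Poly_Mapping.keys f \<union> Poly_Mapping.keys g"
  have "j \<in> ?A" using assms(2) by (auto simp: in_keys_iff)
  then have "(\<Sum>k\<in>?A. Poly_Mapping.lookup f k) < (\<Sum>k\<in>?A. Poly_Mapping.lookup g k)"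
    using assms by (intro sum_strict_mono_ex1) auto
  then show ?thesis using monom_deg_superset [of ?A] by simp
qed

lemma monom_deg_content:
  assumes "pattern n len lev I" "\<And>k. Poly_Mapping.lookup f k = content b n lev I k"
  shows "monom_deg f = (\<Sum>i<n. len i) + (if b then drops n lev I else 0)"
proof -
  obtain N where N: "\<And>i. i < n \<Longrightarrow> Suc (i + lev i) \<le> N" using level_bound [of n lev] by blast
  have "Poly_Mapping.keys f \<subseteq> {..N}"
  proof
    fix k assume "k \<in> Poly_Mapping.keys f"
    then have "content b n lev I k \<noteq> 0" using assms(2) by (simp add: in_keys_iff)
    then obtain i where "i \<in> {..<n}"
      "(if i < k \<and> k - Suc i \<le> lev i then cell b (I i) (I (Suc i)) (k - Suc i) else 0) \<noteq> 0"
      unfolding content_def by (rule sum.not_neutral_contains_not_neutral)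
    then show "k \<in> {..N}" using N [of i] by (auto split: if_splits)
  qed
  then have "monom_deg f = (\<Sum>k\<le>N. content b n lev I k)"
    using assms(2) by (simp add: monom_deg_superset [of "{..N}"])
  then show ?thesis using sum_content [OF assms(1) N] by simp
qed

text \<open>Raising row \<open>j\<close> gains a letter unless the row above loses an extra one. In
  that case its entry was larger by exactly one, the two rows have become equal in this column, and
  the row above can be raised next. At \<open>s\<close> the chain must gain: either there is no row
  above, or the row above is already full at level \<open>l\<close>. The bound on
  \<open>I j l + (j - i)\<close> is the room needed when the chain reaches row
  \<open>i\<close>.\<close>

lemma chain_of_moves:
  assumes "pattern n len lev I" "1 \<le> l" "s \<le> j" "j < n"
    and "\<And>i. s \<le> i \<Longrightarrow> i \<le> j \<Longrightarrow> l \<le> lev i" "s = 0 \<or> lev (s - 1) < l"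
    and "I j l = I (Suc j) l" "\<And>i. s \<le> i \<Longrightarrow> i < j \<Longrightarrow> I (Suc i) l < I i l"
    and "\<And>i. s \<le> i \<Longrightarrow> i \<le> j \<Longrightarrow> I j l + (j - i) < len i"
    and anti: "\<And>i. Suc i < n \<Longrightarrow> len (Suc i) \<le> len i"
  shows "\<exists>J. pattern n len lev J \<and> (\<forall>k. content True n lev I k \<le> content True n lev J k) \<and>
    (\<exists>k. content True n lev I k < content True n lev J k)"
  using assms(1-9)
proof (induction j arbitrary: I)
  case (0 I)
  let ?r = "\<lambda>m. if l \<le> m then max (I 0 m) (Suc (I 0 l)) else I 0 m"
  have "I 0 l < len 0" using 0(9) [of 0] 0(3) by simp
  then show ?case
    using add_move [OF 0(1,4) 0(2) 0(5) 0(7)] 0(3) by blast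
next
  case (Suc j I)
  note I = Suc.prems(1)
  let ?r = "\<lambda>m. if l \<le> m then max (I (Suc j) m) (Suc (I (Suc j) l)) else I (Suc j) m"
  let ?J = "I(Suc j := ?r)"
  have lt: "I (Suc j) l < len (Suc j)" using Suc.prems(9) [of "Suc j"] Suc.prems(3) by simp
  have up: "I (Suc j) l < I (Suc j - 1) l"
  proof (cases "s = Suc j")
    case True
    then have "lev j < l" using Suc.prems(6) by simp
    then have "I j l = len j" using pattern_row [OF I, of j] Suc.prems(4) by (simp add: valid_row_def)
    then show ?thesis using lt anti [of j] Suc.prems(4) by simp
  next
    case False
    then show ?thesis using Suc.prems(3,8) by simp
  qed
  note move = add_move [OF I Suc.prems(4,2) Suc.prems(5) [OF Suc.prems(3) order_refl] Suc.prems(7) lt up]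
  show ?case
  proof (cases "content True n lev I (Suc j + l) < content True n lev ?J (Suc j + l)")
    case True
    then show ?thesis using move(1,2) by blast
  next
    case False
    then have j: "l \<le> lev j" "I j l = Suc (I (Suc j) l)" using move(3) by auto
    then have sj: "s \<le> j" using Suc.prems(3,6) by (cases "s = Suc j") auto
    have "\<exists>J'. pattern n len lev J' \<and> (\<forall>k. content True n lev ?J k \<le> content True n lev J' k) \<and>
      (\<exists>k. content True n lev ?J k < content True n lev J' k)"
    proof (rule Suc.IH)
      show "pattern n len lev ?J" by (rule move(1))
      show "?J i l > ?J (Suc i) l" if "s \<le> i" "i < j" for i
        using Suc.prems(8) [of i] that by simp
      show "?J j l + (j - i) < len i" if "s \<le> i" "i \<le> j" for i
        using Suc.prems(9) [of i] that j by simp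
    qed (use Suc.prems sj j in auto)
    then obtain J' k where "pattern n len lev J'"
      "\<And>k. content True n lev ?J k \<le> content True n lev J' k"
      "content True n lev ?J k < content True n lev J' k" by blast
    then show ?thesis using move(2) by (meson order.strict_trans1 order_trans)
  qed
qed

text \<open>Lowering decreases the sum of all entries, hence terminates. If it leaves the upper
  monomial unchanged, it also preserves the number of drops, by the degree formula, so the
  comparison with \<open>J\<close> persists. When nothing can be lowered, some column has fewer
  drops than in \<open>J\<close>, and \<open>run_exists\<close> finds a chain there.\<close>

lemma improve:
  assumes "pattern n len lev I" and J: "pattern n len lev J"
    and "drops n lev I < drops n lev J"
    and anti: "\<And>i. Suc i < n \<Longrightarrow> len (Suc i) \<le> len i"
  shows "\<exists>I'. pattern n len lev I' \<and> (\<forall>k. content True n lev I k \<le> content True n lev I' k) \<and>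
    (\<exists>k. content True n lev I k < content True n lev I' k)"
  using assms(1,3)
proof (induction "\<Sum>i<n. \<Sum>l\<le>lev i. I i l" arbitrary: I rule: less_induct)
  case less
  note I = less.prems(1)
  show ?case
  proof (cases "\<exists>i l. Suc i < n \<and> l \<le> lev i \<and> l \<le> lev (Suc i) \<and> I i l = I (Suc i) l
      \<and> I (Suc (Suc i)) l < I (Suc i) l")
    case True
    then obtain i l where il: "Suc i < n" "l \<le> lev i" "l \<le> lev (Suc i)" "I i l = I (Suc i) l"
      "I (Suc (Suc i)) l < I (Suc i) l" by blast
    let ?r = "\<lambda>m. if m \<le> l then min (I (Suc i) m) (I (Suc i) l - 1) else I (Suc i) m"
    let ?K = "I(Suc i := ?r)"
    note move = remove_move [OF I il]
    have "(\<Sum>m\<le>lev (Suc i). ?K (Suc i) m) < (\<Sum>m\<le>lev (Suc i). I (Suc i) m)"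
    proof (rule sum_strict_mono_ex1)
      show "\<forall>m\<in>{..lev (Suc i)}. ?K (Suc i) m \<le> I (Suc i) m" using move(3) by simp
      show "\<exists>m\<in>{..lev (Suc i)}. ?K (Suc i) m < I (Suc i) m"
        using move(4) il(3) by (intro bexI [of _ l]) simp_all
    qed simp
    moreover have "(\<Sum>m\<le>lev j. ?K j m) \<le> (\<Sum>m\<le>lev j. I j m)" for j
      by (rule sum_mono) (use move(3) in auto)
    ultimately have smaller: "(\<Sum>j<n. \<Sum>m\<le>lev j. ?K j m) < (\<Sum>j<n. \<Sum>m\<le>lev j. I j m)"
      using il(1) by (intro sum_strict_mono_ex1) auto
    show ?thesis
    proof (cases "\<exists>k. content True n lev I k < content True n lev ?K k")
      case True
      then show ?thesis using move(1,2) by blast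
    next
      case False
      then have eq: "content True n lev ?K k = content True n lev I k" for k
        using move(2) [of k] by (meson le_antisym not_less)
      obtain N where N: "\<And>i. i < n \<Longrightarrow> Suc (i + lev i) \<le> N" using level_bound [of n lev] by blast
      have "drops n lev ?K = drops n lev I"
        using sum_content [OF move(1) N, of True] sum_content [OF I N, of True] by (simp only: eq) simp
      then show ?thesis using less.hyps [OF smaller move(1)] less.prems(2) by (simp only: eq)
    qed
  next
    case False
    let ?D = "\<lambda>I l. card {i. i < n \<and> l \<le> lev i \<and> I (Suc i) l < I i l}"
    obtain N where N: "\<And>i. i < n \<Longrightarrow> Suc (i + lev i) \<le> N" using level_bound [of n lev] by blast
    have count: "drops n lev I = (\<Sum>l\<le>N. ?D I l)" for I :: "nat \<Rightarrow> nat \<Rightarrow> nat"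
    proof -
      have "card {l. l \<le> lev i \<and> I (Suc i) l < I i l}
          = (\<Sum>l\<le>N. if l \<le> lev i \<and> I (Suc i) l < I i l then 1 else 0)" if "i < n" for i
      proof -
        have "(\<Sum>l\<le>N. if l \<le> lev i \<and> I (Suc i) l < I i l then 1 else 0)
          = (\<Sum>l\<in>{l. l \<le> lev i \<and> I (Suc i) l < I i l}. 1::nat)"
          by (rule sum.mono_neutral_cong_right) (use N [OF that] in auto)
        then show ?thesis by simp
      qed
      then have "drops n lev I = (\<Sum>i<n. \<Sum>l\<le>N. if l \<le> lev i \<and> I (Suc i) l < I i l then 1 else 0)"
        unfolding drops_def by (intro sum.cong) auto
      also have "\<dots> = (\<Sum>l\<le>N. \<Sum>i<n. if l \<le> lev i \<and> I (Suc i) l < I i l then 1 else 0)"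
        by (rule sum.swap)
      also have "\<dots> = (\<Sum>l\<le>N. ?D I l)"
      proof (rule sum.cong)
        fix l
        have "(\<Sum>i<n. if l \<le> lev i \<and> I (Suc i) l < I i l then 1 else 0)
          = (\<Sum>i\<in>{i. i < n \<and> l \<le> lev i \<and> I (Suc i) l < I i l}. 1::nat)"
          by (rule sum.mono_neutral_cong_right) auto
        then show "(\<Sum>i<n. if l \<le> lev i \<and> I (Suc i) l < I i l then 1 else 0) = ?D I l" by simp
      qed simp
      finally show ?thesis .
    qed
    have "\<exists>l. ?D I l < ?D J l"
    proof (rule ccontr)
      assume "\<nexists>l. ?D I l < ?D J l"
      then have "?D J l \<le> ?D I l" for l by (meson not_less)
      then have "drops n lev J \<le> drops n lev I" unfolding count by (intro sum_mono)
      then show False using less.prems(2) by simp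
    qed
    then obtain l where l: "?D I l < ?D J l" by blast
    \<comment> \<open>Column 0 vanishes in every pattern and has no drops.\<close>
    have l1: "1 \<le> l"
    proof (rule ccontr)
      assume "\<not> 1 \<le> l"
      then have "l = 0" by simp
      then have "{i. i < n \<and> l \<le> lev i \<and> J (Suc i) l < J i l} = {}"
        using pattern_row [OF J] by (auto simp: valid_row_def)
      then have "?D J l = 0" by (simp only: card.empty)
      then show False using l by linarith
    qed
    \<comment> \<open>The length is set to 0 from row \<open>n\<close> on, so that it bounds the
      column of \<open>J\<close> in every row.\<close>
    have "\<exists>s j. s \<le> j \<and> j < n \<and> (\<forall>i. s \<le> i \<and> i \<le> j \<longrightarrow> l \<le> lev i) \<and> (s = 0 \<or> \<not> l \<le> lev (s - 1)) \<and>
      I j l = I (Suc j) l \<and> (\<forall>i. s \<le> i \<and> i < j \<longrightarrow> I (Suc i) l < I i l) \<and>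
      (\<forall>i. s \<le> i \<and> i \<le> j \<longrightarrow> I j l + (j - i) < (if i < n then len i else 0))"
    proof (rule run_exists [where g = "\<lambda>i. J i l"])
      show "I i l = J i l" if "i < n" "\<not> l \<le> lev i" for i
        using pattern_row [OF I, of i] pattern_row [OF J, of i] that by (simp add: valid_row_def)
      show "J i l \<le> (if i < n then len i else 0)" for i
        using valid_row_le [OF pattern_row [OF J, of i]] pattern_zero [OF J] by auto
      show "I (Suc i) l = I (Suc (Suc i)) l" if "Suc i < n" "l \<le> lev i" "l \<le> lev (Suc i)" "I i l = I (Suc i) l" for i
      proof -
        have "\<not> I (Suc (Suc i)) l < I (Suc i) l" using False that by blast
        then show ?thesis using pattern_Suc_le [OF I, of "Suc i" l] by simp
      qed
      show "I n l = J n l" by (simp add: pattern_zero [OF I] pattern_zero [OF J])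
    qed (use pattern_Suc_le [OF I] pattern_Suc_le [OF J] l in simp_all)
    then obtain s j where sj: "s \<le> j" "j < n" "\<And>i. s \<le> i \<Longrightarrow> i \<le> j \<Longrightarrow> l \<le> lev i"
      "s = 0 \<or> \<not> l \<le> lev (s - 1)" "I j l = I (Suc j) l"
      "\<And>i. s \<le> i \<Longrightarrow> i < j \<Longrightarrow> I (Suc i) l < I i l"
      "\<And>i. s \<le> i \<Longrightarrow> i \<le> j \<Longrightarrow> I j l + (j - i) < (if i < n then len i else 0)"
      by blast
    have len: "I j l + (j - i) < len i" if "s \<le> i" "i \<le> j" for i
      using sj(7) [OF that] that sj(2) by simp
    show ?thesis
      by (rule chain_of_moves [OF I l1 sj(1,2) sj(3) _ sj(5) sj(6) len anti])
        (use sj(4) in \<open>auto simp: not_le\<close>)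
  qed
qed

section \<open>Monomials of extremal degree\<close>

lemma flag_ok_antimono:
  "flag_ok rs \<Longrightarrow> Suc i < length rs \<Longrightarrow> fst (rs ! Suc i) \<le> fst (rs ! i)"
proof (induction rs arbitrary: i rule: flag_ok.induct)
  case (1 a v b u rs)
  then show ?case by (cases i) auto
qed auto

lemma monom_poly_dvd:
  assumes "\<And>k. Poly_Mapping.lookup f k \<le> Poly_Mapping.lookup g k"
  shows "monom_poly f dvd monom_poly g"
proof -
  have "g = f + (g - f)"
    by (rule poly_mapping_eqI) (simp add: lookup_add lookup_minus assms)
  then have "monom_poly g = monom_poly f * monom_poly (g - f)"
    unfolding monom_poly_def mult_single by simp
  then show ?thesis by simp
qed

lemma flag_poly_min_degree:
  assumes ok: "flag_ok rs" and f: "f \<in> Poly_Mapping.keys (flag_poly rs)"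
  shows "\<exists>g\<in>Poly_Mapping.keys (flag_poly rs).
    (\<forall>h\<in>Poly_Mapping.keys (flag_poly rs). monom_deg g \<le> monom_deg h) \<and> monom_poly g dvd monom_poly f"
proof -
  have low: "\<exists>g\<in>Poly_Mapping.keys (flag_poly rs). (\<forall>k. Poly_Mapping.lookup g k \<le> Poly_Mapping.lookup h k)
      \<and> monom_deg g = (\<Sum>i<length rs. fst (rs ! i))"
    if h: "h \<in> Poly_Mapping.keys (flag_poly rs)" for h
  proof -
    obtain I where I: "list_pattern rs I" "\<And>k. list_content False rs I k \<le> Poly_Mapping.lookup h k"
      using keys_flag_polyD [OF ok h] by blast
    obtain g where "g \<in> Poly_Mapping.keys (flag_poly rs)"
      "\<And>k. Poly_Mapping.lookup g k = list_content False rs I k"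
      using keys_flag_polyI [OF ok I(1)] by blast
    then show ?thesis
      using monom_deg_content [OF I(1), of g False] I(2) by (intro bexI [of _ g]) simp_all
  qed
  obtain g where g: "g \<in> Poly_Mapping.keys (flag_poly rs)"
    "\<And>k. Poly_Mapping.lookup g k \<le> Poly_Mapping.lookup f k" "monom_deg g = (\<Sum>i<length rs. fst (rs ! i))"
    using low [OF f] by blast
  have "monom_deg g \<le> monom_deg h" if "h \<in> Poly_Mapping.keys (flag_poly rs)" for h
  proof -
    obtain g' where "\<And>k. Poly_Mapping.lookup g' k \<le> Poly_Mapping.lookup h k"
      "monom_deg g' = (\<Sum>i<length rs. fst (rs ! i))"
      using low [OF \<open>h \<in> _\<close>] by blast
    then show ?thesis using monom_deg_mono [of g' h] g(3) by simp
  qed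
  then show ?thesis using g monom_poly_dvd by blast
qed

text \<open>Let \<open>g\<close> have the largest degree among the monomials divisible by
  \<open>f\<close>. A monomial \<open>h\<close> of larger degree would give an upper monomial with
  more drops than that of a pattern for \<open>g\<close>. Then \<open>improve\<close> would produce
  a multiple of \<open>f\<close> of degree larger than that of \<open>g\<close>.\<close>

lemma flag_poly_max_degree:
  assumes ok: "flag_ok rs" and f: "f \<in> Poly_Mapping.keys (flag_poly rs)"
  shows "\<exists>g\<in>Poly_Mapping.keys (flag_poly rs).
    (\<forall>h\<in>Poly_Mapping.keys (flag_poly rs). monom_deg h \<le> monom_deg g) \<and> monom_poly f dvd monom_poly g"
proof -
  let ?K = "Poly_Mapping.keys (flag_poly rs)"
  let ?above = "\<lambda>f g. \<forall>k. Poly_Mapping.lookup f k \<le> Poly_Mapping.lookup g k"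
  have up: "\<exists>I g. list_pattern rs I \<and> g \<in> ?K \<and> (\<forall>k. Poly_Mapping.lookup g k = list_content True rs I k)
      \<and> ?above h g" if h: "h \<in> ?K" for h
  proof -
    obtain I where I: "list_pattern rs I" "\<And>k. Poly_Mapping.lookup h k \<le> list_content True rs I k"
      using keys_flag_polyD [OF ok h] by blast
    obtain g where "g \<in> ?K" "\<And>k. Poly_Mapping.lookup g k = list_content True rs I k"
      using keys_flag_polyI [OF ok I(1)] by blast
    then show ?thesis using I by (intro exI [of _ I] exI [of _ g]) simp
  qed
  let ?M = "monom_deg ` {g \<in> ?K. ?above f g}"
  have fin: "finite ?M" "?M \<noteq> {}" using f by auto
  from Max_in [OF this] have "\<exists>g\<in>{g \<in> ?K. ?above f g}. Max ?M = monom_deg g" by (rule imageE) blast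
  then have "\<exists>g\<in>{g \<in> ?K. ?above f g}. \<forall>h\<in>{g \<in> ?K. ?above f g}. monom_deg h \<le> monom_deg g"
    using Max_ge [OF fin(1)] by (metis (no_types, lifting) imageI)
  then obtain g where g: "g \<in> ?K" "?above f g"
    and max: "\<And>h. h \<in> ?K \<Longrightarrow> ?above f h \<Longrightarrow> monom_deg h \<le> monom_deg g"
    by blast
  have "monom_deg h \<le> monom_deg g" if h: "h \<in> ?K" for h
  proof (rule ccontr)
    assume less: "\<not> monom_deg h \<le> monom_deg g"
    obtain I g' where I: "list_pattern rs I" and g': "g' \<in> ?K"
      "\<And>k. Poly_Mapping.lookup g' k = list_content True rs I k" "?above g g'"
      using up [OF g(1)] by blast
    obtain J h' where J: "list_pattern rs J" and h': "h' \<in> ?K"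
      "\<And>k. Poly_Mapping.lookup h' k = list_content True rs J k" "?above h h'"
      using up [OF h] by blast
    have "?above f g'" using g(2) g'(3) order_trans by blast
    then have "monom_deg g' \<le> monom_deg g" using max g'(1) by blast
    moreover have "monom_deg h \<le> monom_deg h'" using h'(3) monom_deg_mono by blast
    ultimately have "monom_deg g' < monom_deg h'" using less by simp
    then have "drops (length rs) (\<lambda>i. snd (rs ! i)) I < drops (length rs) (\<lambda>i. snd (rs ! i)) J"
      using monom_deg_content [OF I g'(2)] monom_deg_content [OF J h'(2)] by simp
    from improve [OF I J this flag_ok_antimono [OF ok]] obtain I' k where I': "list_pattern rs I'"
      "\<And>k. list_content True rs I k \<le> list_content True rs I' k"
      "list_content True rs I k < list_content True rs I' k" by blast
    obtain e where e: "e \<in> ?K" "\<And>k. Poly_Mapping.lookup e k = list_content True rs I' k"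
      using keys_flag_polyI [OF ok I'(1)] by blast
    have "?above f e"
    proof
      fix k
      show "Poly_Mapping.lookup f k \<le> Poly_Mapping.lookup e k"
        using \<open>?above f g'\<close> [rule_format, of k] g'(2) [of k] I'(2) [of k] e(2) [of k] by simp
    qed
    then have "monom_deg e \<le> monom_deg g" using max e(1) by blast
    moreover have "monom_deg g' < monom_deg e"
      by (rule monom_deg_strict_mono [of _ _ k]) (use I' e g' in auto)
    moreover have "monom_deg g \<le> monom_deg g'" using g'(3) monom_deg_mono by blast
    ultimately show False by simp
  qed
  then show ?thesis using g monom_poly_dvd by blast
qed

theorem theorem3p3:
  fixes n :: nat and w :: "nat \<Rightarrow> nat" and f :: monom
  assumes "w permutes {1..n}"
    and "vexillary n w"
    and "f \<in> Poly_Mapping.keys (grothendieck n w)"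
  shows "(\<exists>f1 \<in> Poly_Mapping.keys (grothendieck n w).
            (\<forall>g \<in> Poly_Mapping.keys (grothendieck n w). monom_deg f1 \<le> monom_deg g) \<and>
            monom_poly f1 dvd monom_poly f)
       \<and> (\<exists>f2 \<in> Poly_Mapping.keys (grothendieck n w).
            (\<forall>g \<in> Poly_Mapping.keys (grothendieck n w). monom_deg g \<le> monom_deg f2) \<and>
            monom_poly f dvd monom_poly f2)"
proof -
  obtain rs where rs: "grothendieck n w = flag_poly rs" "flag_ok rs"
    using vexillary_grothendieck [OF assms(1,2)] by blast
  show ?thesis
    using flag_poly_min_degree [OF rs(2)] flag_poly_max_degree [OF rs(2)] assms(3) unfolding rs(1) by blast
qed

end
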